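(* Let $n\ge1$ and let $V=\mathbb{T}^n\times\mathbb{R}^n$ or $V=\mathbb{R}^n\times\mathbb{R}^n$. Every real-analytic Hamiltonian map $f$ of $V$ is approximated, on compact sets in the $C^\omega$ sense, by compositions of vertical and horizontal shears of $V$. That is, for every compact $K\subset V$ there is a complex neighborhood $W$ of $K$ to which $f$ extends holomorphically, such that for every $\delta>0$ there is a finite composition $g=S_M\circ\cdots\circ S_1$ of vertical and horizontal shears of $V$ which extends holomorphically to $W$ and satisfies $\sup_W\|f-g\|<\delta$.
   Context: $\mathbb{T}^n=\mathbb{R}^n/\mathbb{Z}^n$. $V=B\times\mathbb{R}^n$, with $B=\mathbb{T}^n$ or $B=\mathbb{R}^n$, has coordinates $(q,p)$ and symplectic form $\omega=\sum_i dp_i\wedge dq_i$. The complexification of $V$ is $(\mathbb{C}^n/\mathbb{Z}^n)\times\mathbb{C}^n$ or $\mathbb{C}^n\times\mathbb{C}^n$ respectively. A complex neighborhood of a subset of $V$ is an open neighborhood of it in this complexification, and $\|\cdot\|$ refers to the flat distance. A real-analytic Hamiltonian map of $V$ is a diffeomorphism $\phi_H^{0,1}$ of $V$, the time $0\to1$ map of the system $(\dot q,\dot p)=(\partial_p H_t,-\partial_q H_t)$, whose flow is defined on all of $V$ for $t\in[0,1]$. Here $(H_t)$ is a family of real-analytic functions on $V$ depending continuously on $t$ in $C^\omega(V,\mathbb{R})$: for every compact $K\subset V$ there is a complex neighborhood of $K$ to which all $H_t$, $t\in[0,1]$, extend holomorphically, with continuous dependence on $t$ in the sup norm. A horizontal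 shear of $V$ is a map $(q,p)\mapsto(q+\nabla\tau(p),p)$ with $\tau\in C^\omega(\mathbb{R}^n,\mathbb{R})$. A vertical shear of $V$ is a map $(q,p)\mapsto(q,p-\nabla v(q))$ with $v\in C^\omega(B,\mathbb{R})$. *)

theory Defs
  imports "HOL-Analysis.Analysis"
begin

section \<open>Holomorphic maps of several complex variables\<close>

class complex_normed_space = real_normed_vector +
  fixes scaleC :: "complex \<Rightarrow> 'a \<Rightarrow> 'a" (infixr "*\<^sub>C" 75)
  assumes scaleC_add_right: "c *\<^sub>C (x + y) = c *\<^sub>C x + c *\<^sub>C y"
    and scaleC_add_left: "(c + d) *\<^sub>C x = c *\<^sub>C x + d *\<^sub>C x"
    and scaleC_scaleC: "c *\<^sub>C d *\<^sub>C x = (c * d) *\<^sub>C x"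
    and scaleC_of_real: "complex_of_real r *\<^sub>C x = r *\<^sub>R x"
    and norm_scaleC: "norm (c *\<^sub>C x) = cmod c * norm x"

instantiation complex :: complex_normed_space
begin

definition scaleC_complex :: "complex \<Rightarrow> complex \<Rightarrow> complex" where
  "scaleC_complex c x = c * x"

instance
  by standard (auto simp: scaleC_complex_def algebra_simps norm_mult scaleR_conv_of_real)

end

instantiation vec :: (complex_normed_space, finite) complex_normed_space
begin

definition scaleC_vec :: "complex \<Rightarrow> 'a ^ 'b \<Rightarrow> 'a ^ 'b" where
  "scaleC_vec c x = (\<chi> i. c *\<^sub>C x $ i)"

instance
  by standard
    (auto simp: scaleC_vec_def vec_eq_iff scaleC_add_right scaleC_add_left scaleC_scaleC
      scaleC_of_real norm_vec_def norm_scaleC L2_set_right_distrib)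

end

instantiation prod :: (complex_normed_space, complex_normed_space) complex_normed_space
begin

definition scaleC_prod :: "complex \<Rightarrow> 'a \<times> 'b \<Rightarrow> 'a \<times> 'b" where
  "scaleC_prod c x = (c *\<^sub>C fst x, c *\<^sub>C snd x)"

instance
proof
  fix c :: complex and x :: "'a \<times> 'b"
  have "(norm (c *\<^sub>C x))\<^sup>2 = (cmod c * norm x)\<^sup>2"
    by (simp add: scaleC_prod_def norm_prod_def norm_scaleC power_mult_distrib algebra_simps)
  then show "norm (c *\<^sub>C x) = cmod c * norm x"
    by (simp add: power2_eq_iff_nonneg)
qed (auto simp: scaleC_prod_def prod_eq_iff scaleC_add_right scaleC_add_left scaleC_scaleC
      scaleC_of_real)

end

definition cholomorphic_on ::
    "('a::complex_normed_space \<Rightarrow> 'b::complex_normed_space) \<Rightarrow> 'a set \<Rightarrow> bool" where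
  "cholomorphic_on G U \<longleftrightarrow>
     (\<forall>z\<in>U. \<exists>D. (G has_derivative D) (at z) \<and> (\<forall>c v. D (c *\<^sub>C v) = c *\<^sub>C D v))"

definition cvec :: "real ^ 'n \<Rightarrow> complex ^ 'n" where
  "cvec x = (\<chi> i. complex_of_real (x $ i))"

text \<open>Real-analytic: locally the restriction of a holomorphic function.\<close>

definition real_analytic :: "(real ^ 'n \<Rightarrow> real) \<Rightarrow> bool" where
  "real_analytic \<phi> \<longleftrightarrow>
     (\<forall>x. \<exists>U \<Phi>. open U \<and> cvec x \<in> U \<and> cholomorphic_on \<Phi> U \<and>
        (\<forall>y. cvec y \<in> U \<longrightarrow> \<Phi> (cvec y) = complex_of_real (\<phi> y)))"

text \<open>
  \<open>C\<^sup>k\<close> on an open subset \<open>U\<close> of a finite-dimensional space, by iterated directional derivatives.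
\<close>

primrec ck_on ::
    "nat \<Rightarrow> ('a::real_normed_vector \<Rightarrow> 'b::real_normed_vector) \<Rightarrow> 'a set \<Rightarrow> bool" where
  "ck_on 0 f U \<longleftrightarrow> continuous_on U f"
| "ck_on (Suc k) f U \<longleftrightarrow>
     (\<forall>x\<in>U. f differentiable (at x)) \<and> (\<forall>v. ck_on k (\<lambda>x. frechet_derivative f (at x) v) U)"

definition smooth_on ::
    "('a::real_normed_vector \<Rightarrow> 'b::real_normed_vector) \<Rightarrow> 'a set \<Rightarrow> bool" where
  "smooth_on f U \<longleftrightarrow> (\<forall>k. ck_on k f U)"


section \<open>The torus and its complexification\<close>

text \<open>
  For \<open>'a = real\<close> this is \<open>\<real>\<^sup>n / \<int>\<^sup>n\<close>, for \<open>'a = complex\<close> it is \<open>\<complex>\<^sup>n / \<int>\<^sup>n\<close>.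
\<close>

definition int_vec :: "int ^ 'n \<Rightarrow> 'a::real_normed_algebra_1 ^ 'n" where
  "int_vec k = (\<chi> i. of_int (k $ i))"

lemma int_vec_0 [simp]: "int_vec 0 = 0"
  and int_vec_add: "int_vec (k + l) = int_vec k + int_vec l"
  and int_vec_minus: "int_vec (- k) = - int_vec k"
  and int_vec_diff: "int_vec (k - l) = int_vec k - int_vec l"
  by (simp_all add: int_vec_def vec_eq_iff)

quotient_type (overloaded) ('a, 'n) torus =
  "'a::real_normed_algebra_1 ^ 'n::finite" / "\<lambda>x y. \<exists>k. y = x + int_vec k"
  morphisms torus_rep torus_proj
proof (rule equivpI)
  show "reflp (\<lambda>x y::'a ^ 'n. \<exists>k. y = x + int_vec k)"
  proof (rule reflpI)
    show "\<exists>k. x = x + int_vec k" for x :: "'a ^ 'n"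
      by (rule exI[of _ 0]) simp
  qed
  show "symp (\<lambda>x y::'a ^ 'n. \<exists>k. y = x + int_vec k)"
  proof (rule sympI, elim exE)
    show "\<exists>k. x = y + int_vec k" if "y = x + int_vec k" for x y :: "'a ^ 'n" and k
      by (rule exI[of _ "- k"]) (simp add: that int_vec_minus)
  qed
  show "transp (\<lambda>x y::'a ^ 'n. \<exists>k. y = x + int_vec k)"
  proof (rule transpI, elim exE)
    show "\<exists>k. z = x + int_vec k" if "y = x + int_vec k" "z = y + int_vec l"
      for x y z :: "'a ^ 'n" and k l
      by (rule exI[of _ "k + l"]) (simp add: that int_vec_add)
  qed
qed

lemma torus_proj_eq_iff: "torus_proj x = torus_proj y \<longleftrightarrow> (\<exists>k. y = x + int_vec k)"
  by (rule torus.abs_eq_iff)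

lemma torus_proj_cases: obtains a where "x = torus_proj a"
  using Quotient3_abs_rep[OF Quotient3_torus, of x] by (rule that[OF sym])

lemma norm_int_vec_ge_1:
  assumes "k \<noteq> 0"
  shows "norm (int_vec k :: 'a::real_normed_algebra_1 ^ 'n::finite) \<ge> 1"
proof -
  from assms obtain i where i: "k $ i \<noteq> 0" by (auto simp: vec_eq_iff)
  have "1 \<le> norm ((int_vec k :: 'a ^ 'n) $ i)"
    using i by (simp add: int_vec_def)
  also have "\<dots> \<le> norm (int_vec k :: 'a ^ 'n)" by (rule Finite_Cartesian_Product.norm_nth_le)
  finally show ?thesis .
qed

instantiation torus :: (real_normed_algebra_1, finite) metric_space
begin

definition dist_torus :: "('a, 'b) torus \<Rightarrow> ('a, 'b) torus \<Rightarrow> real" where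
  "dist_torus x y = Inf {dist a b | a b. torus_proj a = x \<and> torus_proj b = y}"

definition uniformity_torus :: "(('a, 'b) torus \<times> ('a, 'b) torus) filter" where
  "uniformity_torus = (INF e\<in>{0 <..}. principal {(x, y). dist x y < e})"

definition open_torus :: "('a, 'b) torus set \<Rightarrow> bool" where
  "open_torus U \<longleftrightarrow> (\<forall>x\<in>U. eventually (\<lambda>(x', y). x' = x \<longrightarrow> y \<in> U) uniformity)"

instance
proof
  have le: "dist (torus_proj a) (torus_proj b) \<le> dist a b" for a b :: "'a ^ 'b"
    unfolding dist_torus_def by (rule cInf_lower) (auto intro!: bdd_belowI[of _ 0])
  have approx: "\<exists>b. torus_proj b = y \<and> dist a b < e"
    if "dist (torus_proj a) y < e" for a :: "'a ^ 'b" and y e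
  proof -
    obtain b0 where "y = torus_proj b0" by (rule torus_proj_cases)
    then have "{dist a' b | a' b. torus_proj a' = torus_proj a \<and> torus_proj b = y} \<noteq> {}"
      by blast
    from cInf_lessD[OF this that[unfolded dist_torus_def]]
    obtain a' b where ab: "torus_proj a' = torus_proj a" "torus_proj b = y" "dist a' b < e"
      by blast
    then obtain k where k: "a = a' + int_vec k" by (auto simp: torus_proj_eq_iff)
    have "torus_proj (b + int_vec k) = torus_proj b"
      using torus_proj_eq_iff[of b "b + int_vec k"] by auto
    moreover have "dist a (b + int_vec k) = dist a' b" by (simp add: k dist_norm)
    ultimately show ?thesis using ab by auto
  qed
  show "dist x y = 0 \<longleftrightarrow> x = y" for x y :: "('a, 'b) torus"
  proof
    obtain a where a: "x = torus_proj a" by (rule torus_proj_cases)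
    have nonneg: "dist x y \<ge> 0"
    proof (rule ccontr)
      assume "\<not> dist x y \<ge> 0"
      then show False using approx[of a y 0] by (auto simp: a)
    qed
    {
      assume "x = y"
      then show "dist x y = 0" using le[of a a] nonneg by (simp add: a)
    }
    assume 0: "dist x y = 0"
    obtain b where b: "torus_proj b = y" "dist a b < 1 / 2"
      using approx[of a y "1 / 2"] 0 by (auto simp: a)
    have "dist a b \<le> e" if e: "e > 0" for e
    proof -
      obtain c where c: "torus_proj c = y" "dist a c < min e (1 / 2)"
        using approx[of a y "min e (1 / 2)"] 0 e a by auto
      then obtain k where k: "c = b + int_vec k" using b(1) torus_proj_eq_iff[of b c] by auto
      have "norm (int_vec k :: 'a ^ 'b) = dist c b" by (simp add: k dist_norm)
      also have "\<dots> < 1"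
        using dist_triangle3[of c b a] b(2) c(2) by simp
      finally have "k = 0" using norm_int_vec_ge_1[of k, where 'a = 'a] by (meson not_le)
      then show ?thesis using c(2) k by simp
    qed
    then have "dist a b \<le> 0" by (metis field_le_epsilon add_0)
    then show "x = y" using a b by simp
  qed
  show "dist x y \<le> dist x z + dist y z" for x y z :: "('a, 'b) torus"
  proof (rule field_le_epsilon)
    fix e :: real assume e: "e > 0"
    obtain c where c: "z = torus_proj c" by (rule torus_proj_cases)
    have sym: "dist u v = dist v u" for u v :: "('a, 'b) torus"
    proof -
      have "{dist a b | a b. torus_proj a = u \<and> torus_proj b = v} \<subseteq>
            {dist a b | a b. torus_proj a = v \<and> torus_proj b = u}"
        for u v :: "('a, 'b) torus"
      proof clarify
        fix a b :: "'a ^ 'b"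
        show "\<exists>a' b'. dist a b = dist a' b' \<and> torus_proj a' = torus_proj b \<and> torus_proj b' = torus_proj a"
          by (intro exI[of _ b] exI[of _ a] conjI dist_commute refl)
      qed
      then have "{dist a b | a b. torus_proj a = u \<and> torus_proj b = v} =
            {dist a b | a b. torus_proj a = v \<and> torus_proj b = u}"
        by (intro equalityI)
      then show ?thesis unfolding dist_torus_def by simp
    qed
    obtain a where a: "torus_proj a = x" "dist c a < dist x z + e / 2"
      using approx[of c x "dist x z + e / 2"] e sym[of x z] unfolding c by auto
    obtain b where b: "torus_proj b = y" "dist c b < dist y z + e / 2"
      using approx[of c y "dist y z + e / 2"] e sym[of y z] unfolding c by auto
    have "dist x y \<le> dist a b" using le[of a b] a b by simp
    also have "\<dots> \<le> dist c a + dist c b" by (rule dist_triangle3)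
    finally show "dist x y \<le> dist x z + dist y z + e" using a(2) b(2) by simp
  qed
qed (simp_all add: uniformity_torus_def open_torus_def)

end

lift_definition torus_incl :: "(real, 'n::finite) torus \<Rightarrow> (complex, 'n) torus" is cvec
  by (auto simp: cvec_def int_vec_def vec_eq_iff)


section \<open>Phase space\<close>

text \<open>
  A base \<open>B\<close> is presented by its covering \<open>\<real>\<^sup>n \<rightarrow> B\<close>, the covering by \<open>\<complex>\<^sup>n\<close> of its
  complexification, and the inclusion of \<open>B\<close> into its complexification. Local notions on
  \<open>V = B \<times> \<real>\<^sup>n\<close> and on its complexification are read in the charts given by the coverings.
\<close>

record ('n::finite, 'b, 'c) base_space =
  base_proj :: "real ^ 'n \<Rightarrow> 'b"
  base_cproj :: "complex ^ 'n \<Rightarrow> 'c"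
  base_incl :: "'b \<Rightarrow> 'c"

definition euclidean_base :: "('n::finite, real ^ 'n, complex ^ 'n) base_space" where
  "euclidean_base = \<lparr>base_proj = id, base_cproj = id, base_incl = cvec\<rparr>"

definition torus_base :: "('n::finite, (real, 'n) torus, (complex, 'n) torus) base_space" where
  "torus_base = \<lparr>base_proj = torus_proj, base_cproj = torus_proj, base_incl = torus_incl\<rparr>"

definition proj :: "('n::finite, 'b, 'c) base_space \<Rightarrow> (real ^ 'n) \<times> (real ^ 'n) \<Rightarrow> 'b \<times> (real ^ 'n)" where
  "proj B = map_prod (base_proj B) id"

definition cproj ::
    "('n::finite, 'b, 'c) base_space \<Rightarrow> (complex ^ 'n) \<times> (complex ^ 'n) \<Rightarrow> 'c \<times> (complex ^ 'n)" where
  "cproj B = map_prod (base_cproj B) id"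

definition incl :: "('n::finite, 'b, 'c) base_space \<Rightarrow> 'b \<times> (real ^ 'n) \<Rightarrow> 'c \<times> (complex ^ 'n)" where
  "incl B = map_prod (base_incl B) cvec"

definition complex_nbhd ::
    "('n::finite, 'b, 'c::topological_space) base_space \<Rightarrow>
     ('c \<times> (complex ^ 'n)) set \<Rightarrow> ('b \<times> (real ^ 'n)) set \<Rightarrow> bool" where
  "complex_nbhd B W K \<longleftrightarrow> open W \<and> incl B ` K \<subseteq> W"

text \<open>
  \<open>f\<close> has regularity \<open>R\<close> on \<open>W\<close> if, near each point of \<open>W\<close>, it is covered by a map of
  regularity \<open>R\<close> between the covering spaces.
\<close>

definition locally_lifts ::
    "(('a::topological_space \<Rightarrow> 'a) \<Rightarrow> 'a set \<Rightarrow> bool) \<Rightarrow> ('a \<Rightarrow> 'v) \<Rightarrow> ('v \<Rightarrow> 'v) \<Rightarrow> 'v set \<Rightarrow> bool" where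
  "locally_lifts R P f W \<longleftrightarrow>
     (\<forall>x \<in> P -` W. \<exists>U G. open U \<and> x \<in> U \<and> U \<subseteq> P -` W \<and> R G U \<and> (\<forall>y\<in>U. f (P y) = P (G y)))"

definition holomorphic_extension ::
    "('n::finite, 'b, 'c) base_space \<Rightarrow> ('c \<times> (complex ^ 'n)) set \<Rightarrow>
     ('b \<times> (real ^ 'n) \<Rightarrow> 'b \<times> (real ^ 'n)) \<Rightarrow> ('c \<times> (complex ^ 'n) \<Rightarrow> 'c \<times> (complex ^ 'n)) \<Rightarrow> bool" where
  "holomorphic_extension B W f F \<longleftrightarrow>
     locally_lifts cholomorphic_on (cproj B) F W \<and>
     (\<forall>x. incl B x \<in> W \<longrightarrow> F (incl B x) = incl B (f x))"

definition diffeomorphism ::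
    "('n::finite, 'b, 'c) base_space \<Rightarrow> ('b \<times> (real ^ 'n) \<Rightarrow> 'b \<times> (real ^ 'n)) \<Rightarrow> bool" where
  "diffeomorphism B f \<longleftrightarrow>
     bij f \<and> locally_lifts smooth_on (proj B) f UNIV \<and> locally_lifts smooth_on (proj B) (inv f) UNIV"


section \<open>Hamiltonian maps and shears\<close>

definition analytic_family ::
    "('n::finite, 'b::topological_space, 'c::topological_space) base_space \<Rightarrow>
     (real \<Rightarrow> 'b \<times> (real ^ 'n) \<Rightarrow> real) \<Rightarrow> bool" where
  "analytic_family B H \<longleftrightarrow>
     (\<forall>K. compact K \<longrightarrow> (\<exists>W \<H>. complex_nbhd B W K \<and>
        (\<forall>t\<in>{0..1}. cholomorphic_on (\<H> t \<circ> cproj B) (cproj B -` W) \<and>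
           (\<forall>x. incl B x \<in> W \<longrightarrow> \<H> t (incl B x) = complex_of_real (H t x))) \<and>
        (\<forall>t\<in>{0..1}. uniform_limit W \<H> (\<H> t) (at t within {0..1}))))"

text \<open>
  \<open>c\<close> is a solution on \<open>[0,1]\<close> of \<open>(q', p') = (\<partial>\<^sub>p H\<^sub>t, - \<partial>\<^sub>q H\<^sub>t)\<close>; here \<open>u\<close> is a lift of \<open>c\<close> and
  \<open>(a, b) = (\<partial>\<^sub>q H\<^sub>t, \<partial>\<^sub>p H\<^sub>t)\<close>.
\<close>

definition hamiltonian_solution ::
    "('n::finite, 'b, 'c) base_space \<Rightarrow> (real \<Rightarrow> 'b \<times> (real ^ 'n) \<Rightarrow> real) \<Rightarrow>
     (real \<Rightarrow> 'b \<times> (real ^ 'n)) \<Rightarrow> bool" where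
  "hamiltonian_solution B H c \<longleftrightarrow>
     (\<exists>u. \<forall>t\<in>{0..1}. c t = proj B (u t) \<and>
        (\<exists>a b. GDERIV (H t \<circ> proj B) (u t) :> (a, b) \<and>
               (u has_vector_derivative (b, - a)) (at t within {0..1})))"

definition hamiltonian_map ::
    "('n::finite, 'b::topological_space, 'c::topological_space) base_space \<Rightarrow>
     ('b \<times> (real ^ 'n) \<Rightarrow> 'b \<times> (real ^ 'n)) \<Rightarrow> bool" where
  "hamiltonian_map B f \<longleftrightarrow>
     diffeomorphism B f \<and>
     (\<exists>H. analytic_family B H \<and>
        (\<forall>x. \<exists>c. hamiltonian_solution B H c \<and> c 0 = x \<and> c 1 = f x))"

definition horizontal_shear ::
    "('n::finite, 'b, 'c) base_space \<Rightarrow> ('b \<times> (real ^ 'n) \<Rightarrow> 'b \<times> (real ^ 'n)) \<Rightarrow> bool" where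
  "horizontal_shear B S \<longleftrightarrow>
     (\<exists>\<tau> D. real_analytic \<tau> \<and> (\<forall>p. GDERIV \<tau> p :> D p) \<and>
        (\<forall>q p. S (base_proj B q, p) = (base_proj B (q + D p), p)))"

text \<open>Here \<open>v\<close> is a function on the base, so its lift to \<open>\<real>\<^sup>n\<close> is periodic for the torus.\<close>

definition vertical_shear ::
    "('n::finite, 'b, 'c) base_space \<Rightarrow> ('b \<times> (real ^ 'n) \<Rightarrow> 'b \<times> (real ^ 'n)) \<Rightarrow> bool" where
  "vertical_shear B S \<longleftrightarrow>
     (\<exists>v D. real_analytic (v \<circ> base_proj B) \<and> (\<forall>q. GDERIV (v \<circ> base_proj B) q :> D q) \<and>
        (\<forall>q p. S (base_proj B q, p) = (base_proj B q, p - D q)))"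

definition shear_composition ::
    "('n::finite, 'b, 'c) base_space \<Rightarrow> ('b \<times> (real ^ 'n) \<Rightarrow> 'b \<times> (real ^ 'n)) \<Rightarrow> bool" where
  "shear_composition B g \<longleftrightarrow>
     (\<exists>Ss. (\<forall>S\<in>set Ss. vertical_shear B S \<or> horizontal_shear B S) \<and> g = fold (\<circ>) Ss id)"

end

theory Submission
  imports Defs "HOL-Complex_Analysis.Complex_Analysis"
begin

text \<open>
  The time-\<open>h\<close> flow of a ridge function \<open>c cos (a \<bullet> q + b \<bullet> p + \<phi>)\<close> is explicit, and it is exactly a
  composition of at most three shears: for \<open>a \<noteq> 0\<close> conjugation with \<open>q \<mapsto> q + S p\<close>, where \<open>S\<close> is
  symmetric and \<open>S a = b\<close>, turns it into a vertical shear, and for \<open>a = 0\<close> it is a horizontal one.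

  A Hamiltonian that is holomorphic near a real box is a uniform limit of finite sums of ridge
  functions, on a complex neighborhood of a smaller box that is the same for all Hamiltonians. Indeed
  the substitution \<open>w = R sin (2 \<pi> \<theta>)\<close> in the non-periodic coordinates makes it periodic in all
  coordinates; convolution with normalized powers of \<open>\<Prod>\<^sub>i sin\<^sup>2 (\<pi> \<theta>\<^sub>i)\<close> over real translations then
  yields trigonometric polynomials, also at complex points.

  Splitting a Hamiltonian into ridge functions hence gives one-step schemes of shears that are
  consistent with the Hamiltonian vector field on a complex tube around the real solutions. By a
  discrete Gronwall estimate, schemes with smaller and smaller steps form a uniform Cauchy sequence
  on a complex neighborhood of the compact set. Their limit is holomorphic, and it is the given map
  on real points because the schemes also follow the given real solutions.
\<close>

section \<open>Holomorphic maps\<close>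

text \<open>The neighborhood \<open>W\<close> is fixed before \<delta>, so no domain may shrink as
  the accuracy improves. The radii in the approximation lemmas therefore depend on the given box and
  tube and never on the tolerance, and all short-time errors are measured on one fixed tube. A
  second obstacle is that the hypothesis provides solutions through real points only. No complex
  flow is constructed: two schemes with different steps are compared with each other at the same
  complex point, and a nearby real solution serves to keep both inside the tube. Dyadic numbers of
  steps make the finer grid refine the coarser one. Derivatives are never approximated separately,
  since Cauchy's estimate converts closeness of Hamiltonians into closeness of vector fields at the
  cost of a smaller radius. The torus and the Euclidean case run in parallel: all constructions live
  on the covering, commute with a lattice of translations of the positions (trivial in the Euclidean
  case), and descend at the end.\<close>

lemma scaleC_0_left [simp]: "0 *\<^sub>C x = (0 :: 'a::complex_normed_space)"
  using scaleC_of_real[of 0 x] by simp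

lemma scaleC_1_left [simp]: "1 *\<^sub>C x = (x :: 'a::complex_normed_space)"
  using scaleC_of_real[of 1 x] by simp

lemma scaleC_0_right [simp]: "c *\<^sub>C 0 = (0 :: 'a::complex_normed_space)"
  using norm_scaleC[of c 0] by simp

lemma bounded_linear_scaleC_left: "bounded_linear (\<lambda>c. c *\<^sub>C (x :: 'a::complex_normed_space))"
proof (rule bounded_linear_intro[where K = "norm x"])
  show "(r *\<^sub>R c) *\<^sub>C x = r *\<^sub>R c *\<^sub>C x" for r c
    by (simp add: scaleR_conv_of_real scaleC_scaleC[symmetric] scaleC_of_real)
qed (simp_all add: scaleC_add_left norm_scaleC)

lemma scaleC_vec_nth [simp]: "(c *\<^sub>C x) $ i = c *\<^sub>C x $ i"
  by (simp add: scaleC_vec_def)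

lemma fst_scaleC [simp]: "fst (c *\<^sub>C x) = c *\<^sub>C fst x"
  and snd_scaleC [simp]: "snd (c *\<^sub>C x) = c *\<^sub>C snd x"
  by (simp_all add: scaleC_prod_def)

lemma scaleC_complex [simp]: "c *\<^sub>C (x::complex) = c * x"
  by (simp add: scaleC_complex_def)

text \<open>The pointwise form of \<open>cholomorphic_on\<close>: closure rules for it can be used
  as introduction rules without carrying an open set along.\<close>

definition cdiff :: "('a::complex_normed_space \<Rightarrow> 'b::complex_normed_space) \<Rightarrow> 'a \<Rightarrow> bool" where
  "cdiff G z \<longleftrightarrow> (\<exists>D. (G has_derivative D) (at z) \<and> (\<forall>c v. D (c *\<^sub>C v) = c *\<^sub>C D v))"

lemma cholomorphic_on_cdiff: "cholomorphic_on G U \<longleftrightarrow> (\<forall>z\<in>U. cdiff G z)"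
  by (simp add: cholomorphic_on_def cdiff_def)

lemma cdiffI: "(G has_derivative D) (at z) \<Longrightarrow> (\<And>c v. D (c *\<^sub>C v) = c *\<^sub>C D v) \<Longrightarrow> cdiff G z"
  by (auto simp: cdiff_def)

named_theorems cdiff_intros

lemma cdiff_compose:
  assumes "cdiff f (g z)" "cdiff g z"
  shows "cdiff (\<lambda>x. f (g x)) z"
proof -
  obtain D E where "(f has_derivative D) (at (g z))" "\<forall>c v. D (c *\<^sub>C v) = c *\<^sub>C D v"
    "(g has_derivative E) (at z)" "\<forall>c v. E (c *\<^sub>C v) = c *\<^sub>C E v"
    using assms by (auto simp: cdiff_def)
  then show ?thesis
    by (intro cdiffI[OF has_derivative_compose[where f = g and g = f]]) auto
qed

lemma cdiff_const [cdiff_intros]: "cdiff (\<lambda>x. c) z"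
  by (rule cdiffI[of _ "\<lambda>_. 0"]) auto

lemma cdiff_id [cdiff_intros]: "cdiff (\<lambda>x. x) z"
  by (rule cdiffI[of _ "\<lambda>v. v"]) auto

lemma cdiff_add [cdiff_intros]:
  assumes "cdiff f z" "cdiff g z"
  shows "cdiff (\<lambda>x. f x + g x) z"
proof -
  obtain D E where "(f has_derivative D) (at z)" "\<forall>c v. D (c *\<^sub>C v) = c *\<^sub>C D v"
    "(g has_derivative E) (at z)" "\<forall>c v. E (c *\<^sub>C v) = c *\<^sub>C E v"
    using assms by (auto simp: cdiff_def)
  then show ?thesis
    by (intro cdiffI[of _ "\<lambda>v. D v + E v"] has_derivative_add) (auto simp: scaleC_add_right)
qed

lemma cdiff_of_field:
  fixes f :: "complex \<Rightarrow> complex"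
  assumes "f field_differentiable at z"
  shows "cdiff f z"
  using assms unfolding field_differentiable_def has_field_derivative_def
  by (auto intro!: cdiffI)

lemma cdiff_field_compose:
  fixes f :: "complex \<Rightarrow> complex"
  assumes "f field_differentiable at (g z)" "cdiff g z"
  shows "cdiff (\<lambda>x. f (g x)) z"
  using cdiff_compose[OF cdiff_of_field] assms by blast

lemma cdiff_mult [cdiff_intros]:
  fixes f g :: "'a::complex_normed_space \<Rightarrow> complex"
  assumes "cdiff f z" "cdiff g z"
  shows "cdiff (\<lambda>x. f x * g x) z"
proof -
  obtain D E where *: "(f has_derivative D) (at z)" "\<forall>c v. D (c *\<^sub>C v) = c *\<^sub>C D v"
    "(g has_derivative E) (at z)" "\<forall>c v. E (c *\<^sub>C v) = c *\<^sub>C E v"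
    using assms by (auto simp: cdiff_def)
  show ?thesis
    by (rule cdiffI[OF has_derivative_mult[OF *(1,3)]]) (use * in \<open>auto simp: algebra_simps\<close>)
qed

lemma cdiff_minus [cdiff_intros]:
  fixes f :: "'a::complex_normed_space \<Rightarrow> complex"
  assumes "cdiff f z"
  shows "cdiff (\<lambda>x. - f x) z"
  using cdiff_mult[OF cdiff_const[of "-1"] assms] by simp

lemma cdiff_diff [cdiff_intros]:
  fixes f g :: "'a::complex_normed_space \<Rightarrow> complex"
  assumes "cdiff f z" "cdiff g z"
  shows "cdiff (\<lambda>x. f x - g x) z"
  using cdiff_add[OF assms(1) cdiff_minus[OF assms(2)]] by simp

lemma cdiff_sum [cdiff_intros]:
  fixes f :: "'i \<Rightarrow> 'a::complex_normed_space \<Rightarrow> complex"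
  assumes "\<And>i. i \<in> I \<Longrightarrow> cdiff (f i) z"
  shows "cdiff (\<lambda>x. \<Sum>i\<in>I. f i x) z"
  using assms by (induction I rule: infinite_finite_induct) (auto intro: cdiff_intros)

lemma cdiff_exp [cdiff_intros]: "cdiff g z \<Longrightarrow> cdiff (\<lambda>x. exp (g x :: complex)) z"
  and cdiff_sin [cdiff_intros]: "cdiff g z \<Longrightarrow> cdiff (\<lambda>x. sin (g x :: complex)) z"
  and cdiff_cos [cdiff_intros]: "cdiff g z \<Longrightarrow> cdiff (\<lambda>x. cos (g x :: complex)) z"
  using cdiff_field_compose[OF field_differentiable_within_exp]
    cdiff_field_compose[OF field_differentiable_within_sin]
    cdiff_field_compose[OF field_differentiable_within_cos] by blast+

lemma cdiff_vec_nth [cdiff_intros]: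
  fixes g :: "'a::complex_normed_space \<Rightarrow> 'b::complex_normed_space ^ 'n"
  assumes "cdiff g z"
  shows "cdiff (\<lambda>x. g x $ i) z"
proof (rule cdiff_compose[OF _ assms])
  show "cdiff (\<lambda>x. x $ i) (g z)"
    by (rule cdiffI[OF bounded_linear_imp_has_derivative[OF bounded_linear_vec_nth]]) simp
qed

lemma cdiff_fst [cdiff_intros]:
  assumes "cdiff g z"
  shows "cdiff (\<lambda>x. fst (g x)) z"
  by (rule cdiff_compose[OF _ assms], rule cdiffI[OF bounded_linear_imp_has_derivative[OF bounded_linear_fst]]) simp

lemma cdiff_snd [cdiff_intros]:
  assumes "cdiff g z"
  shows "cdiff (\<lambda>x. snd (g x)) z"
  by (rule cdiff_compose[OF _ assms], rule cdiffI[OF bounded_linear_imp_has_derivative[OF bounded_linear_snd]]) simp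

lemma cdiff_Pair [cdiff_intros]:
  assumes "cdiff f z" "cdiff g z"
  shows "cdiff (\<lambda>x. (f x, g x)) z"
proof -
  obtain D E where *: "(f has_derivative D) (at z)" "\<forall>c v. D (c *\<^sub>C v) = c *\<^sub>C D v"
    "(g has_derivative E) (at z)" "\<forall>c v. E (c *\<^sub>C v) = c *\<^sub>C E v"
    using assms by (auto simp: cdiff_def)
  show ?thesis
    by (rule cdiffI[OF has_derivative_Pair[OF *(1,3)]]) (use * in \<open>auto simp: scaleC_prod_def\<close>)
qed

lemma cdiff_vec_lambda [cdiff_intros]:
  fixes f :: "'n::finite \<Rightarrow> 'a::complex_normed_space \<Rightarrow> complex"
  assumes "\<And>i. cdiff (f i) z"
  shows "cdiff (\<lambda>x. \<chi> i. f i x) z"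
proof -
  obtain D where D: "\<And>i. (f i has_derivative D i) (at z)" "\<And>i c v. D i (c *\<^sub>C v) = c *\<^sub>C D i v"
    using assms unfolding cdiff_def by metis
  show ?thesis
  proof (rule cdiffI[of _ "\<lambda>v. \<chi> i. D i v"])
    show "((\<lambda>x. \<chi> i. f i x) has_derivative (\<lambda>v. \<chi> i. D i v)) (at z)"
    proof (subst has_derivative_componentwise_within, rule ballI)
      fix b :: "complex ^ 'n" assume "b \<in> Basis"
      then obtain i u where b: "b = axis i u" "u \<in> Basis" by (auto simp: Basis_vec_def)
      have "((\<lambda>x. f i x \<bullet> u) has_derivative (\<lambda>v. D i v \<bullet> u)) (at z)"
        using D(1) by (intro derivative_eq_intros refl) auto
      then show "((\<lambda>x. (\<chi> i. f i x) \<bullet> b) has_derivative (\<lambda>x. (\<chi> i. D i x) \<bullet> b)) (at z)"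
        by (simp add: b inner_axis)
    qed
  qed (simp add: D(2) vec_eq_iff)
qed

lemma cdiff_continuous: "cdiff f z \<Longrightarrow> continuous (at z) f"
  by (auto simp: cdiff_def dest: has_derivative_continuous)

lemma cholomorphic_on_continuous: "cholomorphic_on f U \<Longrightarrow> continuous_on U f"
  by (auto simp: cholomorphic_on_cdiff intro!: continuous_at_imp_continuous_on cdiff_continuous)

lemma cholomorphic_on_subset: "cholomorphic_on f U \<Longrightarrow> V \<subseteq> U \<Longrightarrow> cholomorphic_on f V"
  by (auto simp: cholomorphic_on_def)

section \<open>Restriction to complex lines, Cauchy estimates and uniform limits\<close>

lemma cdiff_line: "cdiff (\<lambda>w. z + w *\<^sub>C v) w0"
  by (rule cdiff_add[OF cdiff_const],
      rule cdiffI[OF bounded_linear_imp_has_derivative[OF bounded_linear_scaleC_left]])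
     (simp add: scaleC_scaleC)

lemma cdiff_imp_field_differentiable:
  fixes f :: "complex \<Rightarrow> complex"
  assumes "cdiff f z"
  shows "f field_differentiable at z"
proof -
  obtain D where D: "(f has_derivative D) (at z)" "\<And>c v. D (c *\<^sub>C v) = c *\<^sub>C D v"
    using assms by (auto simp: cdiff_def)
  have "D c = D 1 * c" for c using D(2)[of c 1] by simp
  then have "D = (*) (D 1)" by (intro ext)
  then show ?thesis
    using D(1) unfolding field_differentiable_def has_field_derivative_def by metis
qed

text \<open>The bridge to one complex variable: results in several variables are reduced to library
  theorems along lines \<open>z + w v\<close>.\<close>

lemma holomorphic_on_line:
  fixes f :: "'a::complex_normed_space \<Rightarrow> complex"
  assumes "cholomorphic_on f U" "\<And>w. w \<in> S \<Longrightarrow> z + w *\<^sub>C v \<in> U"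
  shows "(\<lambda>w. f (z + w *\<^sub>C v)) holomorphic_on S"
  unfolding holomorphic_on_def
proof
  fix w assume "w \<in> S"
  then have "cdiff (\<lambda>w. f (z + w *\<^sub>C v)) w"
    using assms by (intro cdiff_compose[OF _ cdiff_line]) (auto simp: cholomorphic_on_cdiff)
  then show "(\<lambda>w. f (z + w *\<^sub>C v)) field_differentiable at w within S"
    by (rule field_differentiable_at_within[OF cdiff_imp_field_differentiable])
qed

lemma has_derivative_line: "((\<lambda>w. z + w *\<^sub>C v) has_derivative (\<lambda>w. w *\<^sub>C v)) (at w0)"
  using has_derivative_add[OF has_derivative_const[of z]
      bounded_linear_imp_has_derivative[OF bounded_linear_scaleC_left[of v]]] by simp

text \<open>Directional derivative, defined as a one-variable derivative along a complex line so
  that Cauchy's inequality applies to it directly; where \<open>f\<close> is complex differentiable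
  it is the value of the derivative at \<open>v\<close>.\<close>

definition dd :: "('a::complex_normed_space \<Rightarrow> complex) \<Rightarrow> 'a \<Rightarrow> 'a \<Rightarrow> complex" where
  "dd f z v = deriv (\<lambda>w. f (z + w *\<^sub>C v)) 0"

lemma has_derivative_dd:
  assumes "(f has_derivative D) (at z)" "\<And>c v. D (c *\<^sub>C v) = c *\<^sub>C D v"
  shows "((\<lambda>w. f (z + w *\<^sub>C v)) has_field_derivative D v) (at 0)" "dd f z v = D v"
proof -
  have "((\<lambda>w. f (z + w *\<^sub>C v)) has_derivative (\<lambda>w. D (w *\<^sub>C v))) (at 0)"
    by (rule has_derivative_compose[where f = "\<lambda>w. z + w *\<^sub>C v" and g = f])
       (use assms in \<open>simp_all add: has_derivative_line\<close>)
  then show *: "((\<lambda>w. f (z + w *\<^sub>C v)) has_field_derivative D v) (at 0)"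
    by (auto simp: has_field_derivative_def assms(2) mult.commute[of _ "D v"])
  then show "dd f z v = D v" unfolding dd_def by (rule DERIV_imp_deriv)
qed

lemma cdiff_has_field_derivative_dd:
  assumes "cdiff f (z + w *\<^sub>C v)"
  shows "((\<lambda>w. f (z + w *\<^sub>C v)) has_field_derivative dd f (z + w *\<^sub>C v) v) (at w)"
proof -
  obtain D where D: "(f has_derivative D) (at (z + w *\<^sub>C v))" "\<And>c v. D (c *\<^sub>C v) = c *\<^sub>C D v"
    using assms by (auto simp: cdiff_def)
  have "((\<lambda>w. f (z + w *\<^sub>C v)) has_derivative (\<lambda>w. D (w *\<^sub>C v))) (at w)"
    by (rule has_derivative_compose[where f = "\<lambda>w. z + w *\<^sub>C v" and g = f])
       (use D in \<open>simp_all add: has_derivative_line\<close>)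
  then show ?thesis
    using has_derivative_dd(2)[OF D, of v]
    by (auto simp: has_field_derivative_def D(2) mult.commute[of _ "D v"])
qed

lemma dd_diff:
  assumes "cdiff f z" "cdiff g z"
  shows "dd (\<lambda>x. f x - g x) z v = dd f z v - dd g z v"
proof -
  obtain D E where *: "(f has_derivative D) (at z)" "\<And>c v. D (c *\<^sub>C v) = c *\<^sub>C D v"
    "(g has_derivative E) (at z)" "\<And>c v. E (c *\<^sub>C v) = c *\<^sub>C E v"
    using assms unfolding cdiff_def by metis
  have "dd (\<lambda>x. f x - g x) z v = D v - E v"
    by (rule has_derivative_dd(2)) (use * in \<open>auto intro!: derivative_intros simp: algebra_simps\<close>)
  then show ?thesis using has_derivative_dd(2)[OF *(1,2)] has_derivative_dd(2)[OF *(3,4)] by simp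
qed

text \<open>Cauchy's inequality on the circle of radius \<open>s\<close> in the line spanned by
  \<open>v\<close>. Since \<open>f\<close> is controlled only on the open ball, \<open>s\<close>
  stays below \<open>r / norm v\<close> and tends to it at the end.\<close>

lemma dd_bound:
  assumes "cholomorphic_on f (ball z r)" "r > 0" "\<And>x. x \<in> ball z r \<Longrightarrow> cmod (f x) \<le> M"
  shows "cmod (dd f z v) \<le> M * norm v / r"
proof (cases "v = 0")
  case True
  then show ?thesis using assms(2) assms(3)[of z] by (simp add: dd_def)
next
  case False
  have M: "M \<ge> 0" using assms(2) assms(3)[of z] norm_ge_zero[of "f z"] by (auto simp del: norm_ge_zero)
  have in_ball: "z + w *\<^sub>C v \<in> ball z r" if "cmod w < r / norm v" for w
  proof -
    have "dist z (z + w *\<^sub>C v) = cmod w * norm v" by (simp add: dist_norm norm_scaleC)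
    then show ?thesis using that False by (simp add: field_simps)
  qed
  have *: "cmod (dd f z v) \<le> M / s" if s: "0 < s" "s < r / norm v" for s
  proof -
    have h: "(\<lambda>w. f (z + w *\<^sub>C v)) holomorphic_on cball 0 s"
      by (rule holomorphic_on_line[OF assms(1)]) (use s in \<open>simp del: mem_ball add: in_ball\<close>)
    have "cmod ((deriv ^^ 1) (\<lambda>w. f (z + w *\<^sub>C v)) 0) \<le> fact 1 * M / s ^ 1"
      by (rule Cauchy_inequality)
         (use s h in \<open>auto simp del: mem_ball intro!: assms(3) in_ball holomorphic_on_imp_continuous_on
           intro: holomorphic_on_subset[OF _ ball_subset_cball]\<close>)
    then show ?thesis by (simp add: dd_def)
  qed
  have r: "r / norm v > 0" using False assms(2) by simp
  have "((\<lambda>s. M / s) \<longlongrightarrow> M / (r / norm v)) (at_left (r / norm v))"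
    by (intro tendsto_intros) (use r in auto)
  moreover have "eventually (\<lambda>s. cmod (dd f z v) \<le> M / s) (at_left (r / norm v))"
    using eventually_at_left_real[OF r] by eventually_elim (use * in auto)
  ultimately have "cmod (dd f z v) \<le> M / (r / norm v)"
    by (intro tendsto_lowerbound) auto
  then show ?thesis by simp
qed

lemma dd_bound_on:
  assumes "cholomorphic_on f U" "ball z r \<subseteq> U" "r > 0" "\<And>x. x \<in> U \<Longrightarrow> cmod (f x) \<le> M"
  shows "cmod (dd f z v) \<le> M * norm v / r"
  by (rule dd_bound) (use assms in \<open>auto intro: cholomorphic_on_subset\<close>)

text \<open>Mean value inequality along the segment from \<open>y\<close> to \<open>x\<close>. Each
  point of the segment has a ball of radius \<open>r\<close> inside \<open>ball z (2*r)\<close>, on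
  which Cauchy's estimate bounds the derivative.\<close>

lemma cholomorphic_lipschitz:
  assumes "cholomorphic_on f (ball z (2*r))" "r > 0" "\<And>x. x \<in> ball z (2*r) \<Longrightarrow> cmod (f x) \<le> M"
    and "x \<in> ball z r" "y \<in> ball z r"
  shows "cmod (f x - f y) \<le> M / r * norm (x - y)"
proof -
  have line: "y + w *\<^sub>C (x - y) \<in> ball z r" if w: "w \<in> of_real ` {0..1}" for w
  proof -
    obtain t where t: "w = of_real t" "0 \<le> t" "t \<le> 1" using w by auto
    have "(1 - t) *\<^sub>R y + t *\<^sub>R x \<in> ball z r"
      by (rule convexD_alt[OF convex_ball]) (use assms t in auto)
    then show ?thesis by (simp add: t(1) scaleC_of_real algebra_simps)
  qed
  have der: "((\<lambda>w. f (y + w *\<^sub>C (x - y))) has_field_derivative dd f (y + w *\<^sub>C (x - y)) (x - y)) (at w within of_real ` {0..1})"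
    if "w \<in> of_real ` {0..1}" for w
    by (rule has_field_derivative_at_within, rule cdiff_has_field_derivative_dd)
       (use line[OF that] assms(1,2) in \<open>auto simp: cholomorphic_on_cdiff\<close>)
  have bd: "cmod (dd f (y + w *\<^sub>C (x - y)) (x - y)) \<le> M * norm (x - y) / r"
    if "w \<in> of_real ` {0..1}" for w
  proof (rule dd_bound_on[OF assms(1) _ assms(2)])
    show "ball (y + w *\<^sub>C (x - y)) r \<subseteq> ball z (2 * r)"
    proof
      fix u assume "u \<in> ball (y + w *\<^sub>C (x - y)) r"
      then show "u \<in> ball z (2*r)"
        using line[OF that] dist_triangle[of z u "y + w *\<^sub>C (x - y)"] by auto
    qed
  qed (use assms in auto)
  have "cmod ((\<lambda>w. f (y + w *\<^sub>C (x - y))) 1 - (\<lambda>w. f (y + w *\<^sub>C (x - y))) 0) \<le> (M * norm (x - y) / r) * cmod (1 - 0)"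
  proof (rule field_differentiable_bound[OF _ der bd])
    show "convex (complex_of_real ` {0..1})"
      by (intro convex_linear_image) (auto simp: linear_of_real)
  qed (auto intro: image_eqI[of _ _ 0] image_eqI[of _ _ 1])
  then show ?thesis by (simp add: field_simps)
qed

text \<open>Cauchy's estimate is applied to the difference of \<open>f\<close> and its translate by \<open>y - x\<close>.\<close>

lemma dd_lipschitz:
  assumes f: "cholomorphic_on f (ball z (4*r))" and r: "r > 0"
    and M: "\<And>x. x \<in> ball z (4*r) \<Longrightarrow> cmod (f x) \<le> M"
    and x: "x \<in> ball z r" and y: "y \<in> ball z r"
  shows "cmod (dd f x v - dd f y v) \<le> M / (2 * r^2) * norm (x - y) * norm v"
proof -
  let ?g = "\<lambda>u. f u - f (u + (y - x))"
  have sub: "u \<in> ball z (2*r)" "u + (y - x) \<in> ball z (2*r)" if "u \<in> ball x r" for u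
  proof -
    show "u \<in> ball z (2*r)" using that x dist_triangle[of z u x] by auto
    have "dist y (u + (y - x)) = dist x u" by (simp add: dist_norm algebra_simps)
    then show "u + (y - x) \<in> ball z (2*r)" using that y dist_triangle[of z "u + (y-x)" y] by auto
  qed
  have cd: "cdiff f u" if "u \<in> ball z (4*r)" for u using f that by (auto simp: cholomorphic_on_cdiff)
  have cd2: "cdiff f u" if "u \<in> ball z (2*r)" for u using cd[of u] r that by auto
  have cd': "cdiff (\<lambda>u. f (u + (y - x))) u" if "u \<in> ball x r" for u
    by (rule cdiff_compose) (use sub[OF that] cd2 in \<open>auto intro!: cdiff_intros\<close>)
  have "cmod (dd ?g x v) \<le> (M / (2 * r) * norm (x - y)) * norm v / r"
  proof (rule dd_bound)
    show "cholomorphic_on ?g (ball x r)"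
      by (auto simp: cholomorphic_on_cdiff intro!: cdiff_diff cd' cd2 sub)
    show "cmod (?g u) \<le> M / (2 * r) * norm (x - y)" if u: "u \<in> ball x r" for u
      using cholomorphic_lipschitz[of f z "2*r" M u "u + (y - x)"] sub[OF u] f r M
      by (simp add: norm_minus_commute)
  qed (use r in auto)
  moreover have "dd ?g x v = dd f x v - dd f y v"
  proof -
    have "dd (\<lambda>u. f (u + (y - x))) x v = dd f y v" unfolding dd_def
      by (rule arg_cong2[where f = deriv]) (auto simp: fun_eq_iff algebra_simps)
    then show ?thesis using dd_diff[OF cd2 cd', of x v] x r by auto
  qed
  ultimately have "cmod (dd f x v - dd f y v) \<le> (M / (2 * r) * norm (x - y)) * norm v / r" by simp
  also have "\<dots> = M / (2 * r^2) * norm (x - y) * norm v" by (simp add: power2_eq_square)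
  finally show ?thesis .
qed

text \<open>By Cauchy's estimate the derivatives form a uniform Cauchy sequence on the ball of half
  the radius, so the limit may be differentiated termwise; complex linearity of the derivative
  survives the limit.\<close>

lemma cdiff_uniform_limit:
  fixes f :: "nat \<Rightarrow> 'a::complex_normed_space \<Rightarrow> complex"
  assumes f: "\<And>n. cholomorphic_on (f n) (ball z r)" and r: "r > 0"
    and lim: "uniform_limit (ball z r) f g sequentially"
  shows "cdiff g z"
proof -
  define s where "s = r / 2"
  have s: "s > 0" "2 * s = r" using r by (auto simp: s_def)
  have cd: "cdiff (f n) x" if "x \<in> ball z r" for n x
    using f that by (auto simp: cholomorphic_on_cdiff)
  have "\<forall>p\<in>UNIV \<times> ball z r. \<exists>D. ((f (fst p)) has_derivative D) (at (snd p)) \<and> (\<forall>c v. D (c *\<^sub>C v) = c *\<^sub>C D v)"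
    using cd unfolding cdiff_def by auto
  from bchoice[OF this] obtain D' where D': "\<forall>p\<in>UNIV \<times> ball z r. ((f (fst p)) has_derivative D' p) (at (snd p))
      \<and> (\<forall>c v. D' p (c *\<^sub>C v) = c *\<^sub>C D' p v)" by blast
  define D where "D n x = D' (n, x)" for n x
  have D: "\<And>n x. x \<in> ball z r \<Longrightarrow> ((f n) has_derivative D n x) (at x)"
    "\<And>n x c v. x \<in> ball z r \<Longrightarrow> D n x (c *\<^sub>C v) = c *\<^sub>C D n x v"
    using D' unfolding D_def by auto
  have bsub: "ball x s \<subseteq> ball z r" if "x \<in> ball z s" for x
    using that s dist_triangle[of z _ x] by (smt (verit) mem_ball subsetI)
  have bd: "cmod (D n x v - D m x v) \<le> e * norm v / s"
    if x: "x \<in> ball z s" and e: "\<And>y. y \<in> ball z r \<Longrightarrow> cmod (f n y - f m y) \<le> e" for n m x v e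
  proof -
    have xr: "x \<in> ball z r" using x s by auto
    have "cmod (dd (\<lambda>y. f n y - f m y) x v) \<le> e * norm v / s"
      by (rule dd_bound_on[OF _ bsub[OF x]])
         (use e s cd in \<open>auto simp: cholomorphic_on_cdiff intro!: cdiff_intros\<close>)
    moreover have "dd (\<lambda>y. f n y - f m y) x v = D n x v - D m x v"
      using dd_diff[OF cd cd, OF xr xr] has_derivative_dd(2)[OF D(1) D(2), OF xr xr] by simp
    ultimately show ?thesis by simp
  qed
  have ucauchy: "\<exists>N. \<forall>n\<ge>N. \<forall>m\<ge>N. \<forall>y\<in>ball z r. cmod (f n y - f m y) \<le> e" if "e > 0" for e
  proof -
    have "uniformly_Cauchy_on (ball z r) f"
      using lim by (intro uniformly_convergent_Cauchy) (auto simp: uniformly_convergent_on_def)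
    then obtain N where "\<forall>y\<in>ball z r. \<forall>m\<ge>N. \<forall>n\<ge>N. dist (f m y) (f n y) < e"
      using \<open>e > 0\<close> unfolding uniformly_Cauchy_on_def by meson
    then show ?thesis by (intro exI[of _ N]) (auto simp: dist_norm intro: less_imp_le)
  qed
  have conv: "\<exists>l. (\<lambda>n. D n x v) \<longlonglongrightarrow> l" if x: "x \<in> ball z s" for x v
  proof -
    have "Cauchy (\<lambda>n. D n x v)"
    proof (rule CauchyI)
      fix e :: real assume e: "e > 0"
      define e' where "e' = e * s / (2 * (norm v + 1))"
      have e': "e' > 0" using e s by (auto simp: e'_def intro!: divide_pos_pos mult_pos_pos add_nonneg_pos)
      obtain N where N: "\<forall>n\<ge>N. \<forall>m\<ge>N. \<forall>y\<in>ball z r. cmod (f n y - f m y) \<le> e'" using ucauchy[OF e'] by blast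
      have "e' * norm v / s < e"
      proof -
        have "norm v / (2 * (norm v + 1)) < 1" by (simp add: divide_simps add_nonneg_pos add_nonneg_eq_0_iff)
        then have "e * (norm v / (2 * (norm v + 1))) < e * 1" using e by (intro mult_strict_left_mono)
        then show ?thesis using s by (simp add: e'_def)
      qed
      then show "\<exists>M. \<forall>m\<ge>M. \<forall>n\<ge>M. cmod (D m x v - D n x v) < e"
        using bd[OF x] N by (meson le_less_trans)
    qed
    then show ?thesis by (simp add: Cauchy_convergent_iff convergent_def)
  qed
  define g' where "g' x v = lim (\<lambda>n. D n x v)" for x v
  have g': "(\<lambda>n. D n x v) \<longlonglongrightarrow> g' x v" if "x \<in> ball z s" for x v
    using conv[OF that, of v] by (auto simp: g'_def limI)
  have "\<exists>g2. \<forall>x\<in>ball z s. (\<lambda>n. f n x) \<longlonglongrightarrow> g2 x \<and> (g2 has_derivative g' x) (at x within ball z s)"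
  proof (rule has_derivative_sequence[OF convex_ball])
    show "(f n has_derivative D n x) (at x within ball z s)" if "x \<in> ball z s" for n x
      using D(1)[of x n] that s by (auto intro: has_derivative_at_withinI)
    show "z \<in> ball z s" using s by simp
    show "(\<lambda>n. f n z) \<longlonglongrightarrow> g z" using tendsto_uniform_limitI[OF lim] r by simp
    show "\<forall>\<^sub>F n in sequentially. \<forall>x\<in>ball z s. \<forall>h. cmod (D n x h - g' x h) \<le> e * norm h" if e: "e > 0" for e
    proof -
      obtain N where N: "\<forall>n\<ge>N. \<forall>m\<ge>N. \<forall>y\<in>ball z r. cmod (f n y - f m y) \<le> e * s"
        using ucauchy[of "e * s"] e s by auto
      have "cmod (D n x h - g' x h) \<le> e * norm h" if "n \<ge> N" "x \<in> ball z s" for n x h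
      proof (rule tendsto_upperbound)
        show "((\<lambda>m. cmod (D n x h - D m x h)) \<longlongrightarrow> cmod (D n x h - g' x h)) sequentially"
          by (intro tendsto_intros g' that)
        have "cmod (D n x h - D m x h) \<le> e * norm h" if "m \<ge> N" for m
          using bd[of x n m "e * s" h] N \<open>n \<ge> N\<close> that \<open>x \<in> ball z s\<close> s by auto
        then show "\<forall>\<^sub>F m in sequentially. cmod (D n x h - D m x h) \<le> e * norm h"
          by (auto simp: eventually_sequentially)
      qed auto
      then show ?thesis unfolding eventually_sequentially by blast
    qed
  qed
  then obtain g2 where g2: "\<And>x. x \<in> ball z s \<Longrightarrow> (\<lambda>n. f n x) \<longlonglongrightarrow> g2 x"
    "\<And>x. x \<in> ball z s \<Longrightarrow> (g2 has_derivative g' x) (at x within ball z s)" by blast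
  have eq: "g2 x = g x" if "x \<in> ball z s" for x
    using LIMSEQ_unique[OF g2(1)[OF that] tendsto_uniform_limitI[OF lim, of x]] that s by auto
  have z: "z \<in> ball z s" using s by simp
  have "(g has_derivative g' z) (at z within ball z s)"
    using has_derivative_transform[OF z _ g2(2)[OF z]] eq by metis
  then have "(g has_derivative g' z) (at z)" using z by (simp add: at_within_open[OF z open_ball])
  moreover have "g' z (c *\<^sub>C v) = c *\<^sub>C g' z v" for c v
  proof (rule LIMSEQ_unique[OF g'[OF z]])
    have "(\<lambda>n. c * D n z v) \<longlonglongrightarrow> c * g' z v" by (intro tendsto_intros g' z)
    then show "(\<lambda>n. D n z (c *\<^sub>C v)) \<longlonglongrightarrow> c *\<^sub>C g' z v" using D(2) s by simp
  qed
  ultimately show ?thesis by (rule cdiffI)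
qed

text \<open>A local Lipschitz estimate for \<open>dd\<close>. It supplies the continuity of the
  integrand's derivative that differentiation under the integral sign requires.\<close>

lemma continuous_on_dd:
  fixes f :: "'a::complex_normed_space \<Rightarrow> complex"
  assumes f: "cholomorphic_on f U" and U: "open U"
  shows "continuous_on U (\<lambda>z. dd f z v)"
proof (rule continuous_at_imp_continuous_on, rule ballI)
  fix z assume z: "z \<in> U"
  then have "isCont f z" using f by (auto simp: cholomorphic_on_cdiff intro: cdiff_continuous)
  then obtain d where d: "d > 0" "\<And>x. dist x z < d \<Longrightarrow> dist (f x) (f z) < 1"
    unfolding continuous_at_eps_delta using zero_less_one by metis
  obtain e where e: "e > 0" "ball z e \<subseteq> U" using U z by (meson open_contains_ball)
  \<comment> \<open>On \<open>ball z (4 * r)\<close> the function stays within 1 of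
    \<open>f z\<close>, which gives the bound \<open>M\<close> for
    \<open>dd_lipschitz\<close>.\<close>
  define r where "r = min d e / 4"
  have r: "r > 0" using d e by (auto simp: r_def)
  have sub: "ball z (4 * r) \<subseteq> U" "ball z (4 * r) \<subseteq> ball z d" using e by (auto simp: r_def)
  have M: "cmod (f x) \<le> cmod (f z) + 1" if "x \<in> ball z (4*r)" for x
  proof -
    have "dist x z < d" using subsetD[OF sub(2) that] by (simp add: dist_commute)
    then have "norm (f x - f z) < 1" using d(2) by (simp add: dist_norm)
    then show ?thesis using norm_triangle_sub[of "f x" "f z"] by linarith
  qed
  define L where "L = (cmod (f z) + 1) / (2 * r^2) * norm v"
  have L: "cmod (dd f x v - dd f z v) \<le> L * norm (x - z)" if "x \<in> ball z r" for x
    using dd_lipschitz[OF cholomorphic_on_subset[OF f sub(1)] r M that, of z v] r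
    by (simp add: L_def mult.commute mult.left_commute)
  have "((\<lambda>x. dd f x v - dd f z v) \<longlongrightarrow> 0) (at z)"
  proof (rule Lim_null_comparison)
    show "\<forall>\<^sub>F x in at z. cmod (dd f x v - dd f z v) \<le> L * norm (x - z)"
      using L r unfolding eventually_at by (intro exI[of _ r]) (auto simp: dist_commute)
    have "((\<lambda>x. L * norm (x - z)) \<longlongrightarrow> L * norm (z - z)) (at z)" by (intro tendsto_intros)
    then show "((\<lambda>x. L * norm (x - z)) \<longlongrightarrow> 0) (at z)" by simp
  qed
  then show "isCont (\<lambda>z. dd f z v) z" by (simp add: isCont_def LIM_zero_iff)
qed

section \<open>Approximation of periodic holomorphic functions by trigonometric polynomials\<close>

inductive_set lincomb :: "('a \<Rightarrow> complex) set \<Rightarrow> ('a \<Rightarrow> complex) set" for B where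
  lincomb_zero: "(\<lambda>z. 0) \<in> lincomb B"
| lincomb_step: "E \<in> lincomb B \<Longrightarrow> b \<in> B \<Longrightarrow> (\<lambda>z. E z + c * b z) \<in> lincomb B"

lemma lincomb_base: "b \<in> B \<Longrightarrow> (\<lambda>z. c * b z) \<in> lincomb B"
  using lincomb_step[OF lincomb_zero, of b B c] by simp

lemma lincomb_add:
  assumes "E \<in> lincomb B" "E' \<in> lincomb B"
  shows "(\<lambda>z. E z + E' z) \<in> lincomb B"
  using assms(2) by induction (use assms(1) in \<open>auto simp: add.assoc[symmetric] intro: lincomb_step\<close>)

lemma lincomb_scale:
  assumes "E \<in> lincomb B"
  shows "(\<lambda>z. c * E z) \<in> lincomb B"
  using assms
proof induction
  case (lincomb_step E b d)
  then show ?case using lincomb.lincomb_step[of "\<lambda>z. c * E z" B b "c * d"] by (simp add: algebra_simps)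
qed (simp add: lincomb_zero)

text \<open>The span of a family closed under products is an algebra. It is applied to the
  characters of the torus and to the exponentials of real linear forms.\<close>

lemma lincomb_mult:
  assumes B: "\<And>b b'. b \<in> B \<Longrightarrow> b' \<in> B \<Longrightarrow> (\<lambda>z. b z * b' z) \<in> B"
    and "E \<in> lincomb B" "E' \<in> lincomb B"
  shows "(\<lambda>z. E z * E' z) \<in> lincomb B"
  using assms(2)
proof induction
  case (lincomb_step E b c)
  have "(\<lambda>z. b z * E' z) \<in> lincomb B"
    using assms(3)
  proof induction
    case (lincomb_step F b' d)
    then show ?case
      using lincomb.lincomb_step[of "\<lambda>z. b z * F z" B "\<lambda>z. b z * b' z" d] B[of b b'] \<open>b \<in> B\<close>
      by (simp add: algebra_simps)
  qed (simp add: lincomb_zero)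
  then have "(\<lambda>z. E z * E' z + c * (b z * E' z)) \<in> lincomb B"
    using lincomb_step.IH by (intro lincomb_add lincomb_scale) simp_all
  then show ?case by (simp add: algebra_simps)
qed (simp add: lincomb_zero)

text \<open>The character with integer frequency vector \<open>k\<close> of the real torus, extended
  holomorphically to complex arguments.\<close>

definition chr :: "('m \<Rightarrow> int) \<Rightarrow> complex ^ 'm \<Rightarrow> complex" where
  "chr k z = exp (\<Sum>i\<in>UNIV. 2 * of_real pi * \<i> * of_int (k i) * z $ i)"

lemma chr_add: "chr k (z + w) = chr k z * chr k w"
  by (simp add: chr_def algebra_simps sum.distrib exp_add)

lemma chr_mult: "chr k z * chr l z = chr (\<lambda>i. k i + l i) z"
  by (simp add: chr_def algebra_simps sum.distrib exp_add)

lemma chr_zero [simp]: "chr (\<lambda>_. 0) z = 1"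
  by (simp add: chr_def)

lemma chr_minus: "chr (\<lambda>i. - k i) z = chr k (- z)"
  by (simp add: chr_def)

lemma chr_int_vec [simp]: "chr k (int_vec l) = 1"
proof -
  have "(\<Sum>i\<in>UNIV. 2 * of_real pi * \<i> * of_int (k i) * int_vec l $ i) = (2 * of_int (\<Sum>i\<in>UNIV. k i * l $ i) * of_real pi) * \<i>"
    by (simp add: int_vec_def sum_distrib_left sum_distrib_right mult_ac)
  moreover have "exp ((2 * of_int n * of_real pi) * \<i>) = 1" for n
    using exp_integer_2pi[of "of_int n"] by simp
  ultimately show ?thesis unfolding chr_def by (simp only:)
qed

lemma chr_single: "chr (\<lambda>j. if j = i then n else 0) z = exp (2 * of_real pi * \<i> * of_int n * z $ i)"
proof -
  have "(\<Sum>j\<in>UNIV. 2 * of_real pi * \<i> * of_int (if j = i then n else 0) * z $ j)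
      = (\<Sum>j\<in>UNIV. if j = i then 2 * of_real pi * \<i> * of_int n * z $ j else 0)"
    by (rule sum.cong) auto
  then show ?thesis by (simp add: chr_def)
qed

lemma cdiff_chr: "cdiff (chr k) z"
  unfolding chr_def by (intro cdiff_intros)

lemma lincomb_chr_mult: "E \<in> lincomb (range chr) \<Longrightarrow> E' \<in> lincomb (range chr) \<Longrightarrow> (\<lambda>z. E z * E' z) \<in> lincomb (range chr)"
  by (erule (1) lincomb_mult[rotated]) (auto simp: chr_mult)

lemma lincomb_chr_const: "(\<lambda>z. c) \<in> lincomb (range chr)"
  using lincomb_base[of "chr (\<lambda>_. 0)" "range chr" c] by simp

lemma lincomb_chr_prod:
  assumes "\<And>i. i \<in> I \<Longrightarrow> E i \<in> lincomb (range chr)"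
  shows "(\<lambda>z. \<Prod>i\<in>I. E i z) \<in> lincomb (range chr)"
  using assms by (induction I rule: infinite_finite_induct) (auto intro: lincomb_chr_mult lincomb_chr_const)

lemma lincomb_chr_power:
  assumes "E \<in> lincomb (range chr)"
  shows "(\<lambda>z. E z ^ n) \<in> lincomb (range chr)"
  by (induction n) (auto intro: lincomb_chr_mult lincomb_chr_const assms)

lemma continuous_on_lincomb_chr:
  assumes "E \<in> lincomb (range chr)"
  shows "continuous_on S E"
  using assms
proof induction
  case (lincomb_step E b c)
  then have "continuous_on S b"
    by (auto intro!: continuous_at_imp_continuous_on cdiff_continuous cdiff_chr)
  then show ?case using lincomb_step by (intro continuous_intros)
qed simp

definition strip :: "real \<Rightarrow> (complex ^ 'm) set" where
  "strip s = {z. \<forall>i. \<bar>Im (z $ i)\<bar> < s}"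

lemma open_strip: "open (strip s :: (complex ^ 'm) set)"
proof -
  have "strip s = (\<Inter>i. {z :: complex ^ 'm. \<bar>Im (z $ i)\<bar> < s})" by (auto simp: strip_def)
  moreover have "open {z :: complex ^ 'm. \<bar>Im (z $ i)\<bar> < s}" for i
    by (intro open_Collect_less continuous_intros)
  ultimately show ?thesis by (simp add: open_INT)
qed

lemma cvec_nth [simp]: "cvec x $ i = of_real (x $ i)"
  by (simp add: cvec_def)

lemma cvec_add: "cvec (x + y) = cvec x + cvec y"
  and cvec_diff: "cvec (x - y) = cvec x - cvec y"
  and cvec_minus: "cvec (- x) = - cvec x"
  and cvec_scaleR: "cvec (r *\<^sub>R x) = r *\<^sub>R cvec x"
  and cvec_int_vec: "cvec (int_vec k) = int_vec k"
  and cvec_0 [simp]: "cvec 0 = 0"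
  by (simp_all add: vec_eq_iff int_vec_def scaleR_conv_of_real[of _ "_::complex"])

lemma norm_cvec [simp]: "norm (cvec x) = norm x"
  by (simp add: norm_vec_def)

lemma bounded_linear_cvec: "bounded_linear cvec"
  by (rule bounded_linear_intro[where K = 1]) (simp_all add: cvec_add cvec_scaleR)

lemmas continuous_on_cvec [continuous_intros] = bounded_linear.continuous_on[OF bounded_linear_cvec]

lemma strip_diff_cvec [simp]: "z - cvec x \<in> strip s \<longleftrightarrow> z \<in> strip s"
  by (simp add: strip_def)

lemma strip_add_cvec [simp]: "z + cvec x \<in> strip s \<longleftrightarrow> z \<in> strip s"
  by (simp add: strip_def)

section \<open>Integrals of periodic functions over the unit cube\<close>

abbreviation unit_cube :: "(real ^ 'm) set" where
  "unit_cube \<equiv> cbox 0 (\<chi> i. 1)"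

text \<open>The translated cube is cut by the hyperplane where coordinate \<open>i\<close> equals 1.
  The part beyond it moves back by one period, and both parts reassemble to the unit cube cut where
  coordinate \<open>i\<close> equals \<open>t\<close>.\<close>

lemma integral_translate_periodic1:
  fixes \<gamma> :: "real ^ 'm \<Rightarrow> complex"
  assumes c: "continuous_on UNIV \<gamma>" and p: "\<And>x k. \<gamma> (x + int_vec k) = \<gamma> x" and t: "0 \<le> t" "t \<le> 1"
  shows "integral unit_cube (\<lambda>s. \<gamma> (s + axis i t)) = integral unit_cube \<gamma>"
proof -
  let ?one = "(\<chi> i. 1) :: real ^ 'm" and ?e = "axis i 1 :: real ^ 'm"
  have e: "?e \<in> Basis" by (auto simp: Basis_vec_def)
  have int: "\<gamma> integrable_on cbox a b" for a b
    by (rule integrable_continuous) (rule continuous_on_subset[OF c], simp)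
  have split_cbox: "cbox a b \<inter> {x. x \<bullet> ?e \<le> c} = cbox a (\<chi> j. if j = i then min (b $ i) c else b $ j)"
    "cbox a b \<inter> {x. x \<bullet> ?e \<ge> c} = cbox (\<chi> j. if j = i then max (a $ i) c else a $ j) b" for a b c
    using interval_split_cart[where k = i and c = c and a = a and b = b] by (simp_all add: inner_axis interval_cbox_cart)
  have ev: "?e = int_vec (axis i 1)" by (auto simp: int_vec_def vec_eq_iff axis_def)
  have "integral unit_cube (\<lambda>s. \<gamma> (s + axis i t)) = integral unit_cube (\<gamma> \<circ> ((+) (axis i t)))"
    by (simp add: o_def add.commute)
  also have "\<dots> = integral (cbox (0 + axis i t) (?one + axis i t)) \<gamma>"
    by (rule integral_shift_cbox_plus)
  also have "\<dots> = integral (cbox (0 + axis i t) (?one + axis i t) \<inter> {x. x \<bullet> ?e \<le> 1}) \<gamma> +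
                 integral (cbox (0 + axis i t) (?one + axis i t) \<inter> {x. x \<bullet> ?e \<ge> 1}) \<gamma>"
    by (rule integral_split[OF int e])
  also have "cbox (0 + axis i t) (?one + axis i t) \<inter> {x. x \<bullet> ?e \<le> 1} = cbox (axis i t) ?one"
    using t by (simp add: split_cbox) (auto simp: vec_eq_iff axis_def intro!: arg_cong2[of _ _ _ _ cbox])
  also have "cbox (0 + axis i t) (?one + axis i t) \<inter> {x. x \<bullet> ?e \<ge> 1} = cbox (0 + ?e) ((?one - ?e + axis i t) + ?e)"
    using t by (simp add: split_cbox) (auto simp: vec_eq_iff axis_def intro!: arg_cong2[of _ _ _ _ cbox])
  also have "integral (cbox (0 + ?e) ((?one - ?e + axis i t) + ?e)) \<gamma> = integral (cbox 0 (?one - ?e + axis i t)) (\<gamma> \<circ> ((+) ?e))"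
    by (rule integral_shift_cbox_plus[symmetric])
  also have "\<gamma> \<circ> ((+) ?e) = \<gamma>"
    using p by (simp add: fun_eq_iff ev add.commute)
  also have "integral (cbox (axis i t) ?one) \<gamma> + integral (cbox 0 (?one - ?e + axis i t)) \<gamma>
     = integral (unit_cube \<inter> {x. x \<bullet> ?e \<le> t}) \<gamma> + integral (unit_cube \<inter> {x. x \<bullet> ?e \<ge> t}) \<gamma>"
  proof -
    have "unit_cube \<inter> {x. x \<bullet> ?e \<le> t} = cbox 0 (?one - ?e + axis i t)"
      using t by (simp add: split_cbox) (auto simp: vec_eq_iff axis_def intro!: arg_cong2[of _ _ _ _ cbox])
    moreover have "unit_cube \<inter> {x. x \<bullet> ?e \<ge> t} = cbox (axis i t) ?one"
      using t by (simp add: split_cbox) (auto simp: vec_eq_iff axis_def intro!: arg_cong2[of _ _ _ _ cbox])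
    ultimately show ?thesis by simp
  qed
  also have "\<dots> = integral unit_cube \<gamma>"
    by (rule integral_split[OF int e, symmetric])
  finally show ?thesis .
qed

text \<open>One coordinate at a time: the integer part of \<open>v $ i\<close> disappears by
  periodicity, and the fractional part is the case already treated.\<close>

lemma integral_translate_periodic:
  fixes \<gamma> :: "real ^ 'm \<Rightarrow> complex"
  assumes c: "continuous_on UNIV \<gamma>" and p: "\<And>x k. \<gamma> (x + int_vec k) = \<gamma> x"
  shows "integral unit_cube (\<lambda>s. \<gamma> (s + v)) = integral unit_cube \<gamma>"
proof -
  have *: "integral unit_cube (\<lambda>s. \<gamma> (s + (\<Sum>i\<in>A. axis i (v $ i)))) = integral unit_cube \<gamma>" if "finite A" for A
    using that
  proof induction
    case (insert i A)
    let ?w = "\<Sum>i\<in>A. axis i (v $ i)"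
    let ?\<gamma> = "\<lambda>s. \<gamma> (s + ?w)"
    have split: "axis i (v $ i) = axis i (frac (v $ i)) + (int_vec (axis i \<lfloor>v $ i\<rfloor>) :: real ^ 'm)"
      by (auto simp: vec_eq_iff int_vec_def axis_def frac_def)
    have pw: "?\<gamma> (x + int_vec k) = ?\<gamma> x" for x k
      using p[of "x + ?w" k] by (simp add: algebra_simps)
    have "integral unit_cube (\<lambda>s. \<gamma> (s + (\<Sum>i\<in>insert i A. axis i (v $ i)))) =
        integral unit_cube (\<lambda>s. ?\<gamma> (s + axis i (frac (v $ i)) + int_vec (axis i \<lfloor>v $ i\<rfloor>)))"
      using insert by (simp add: split algebra_simps)
    also have "\<dots> = integral unit_cube (\<lambda>s. ?\<gamma> (s + axis i (frac (v $ i))))"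
      by (simp only: pw)
    also have "\<dots> = integral unit_cube ?\<gamma>"
    proof (rule integral_translate_periodic1)
      show "continuous_on UNIV ?\<gamma>"
        by (rule continuous_on_compose2[OF c]) (auto intro!: continuous_intros)
    qed (use pw in \<open>auto simp: frac_lt_1 less_imp_le\<close>)
    finally show ?case using insert by simp
  qed simp
  have "v = (\<Sum>i\<in>UNIV. axis i (v $ i))"
    by (simp add: vec_eq_iff axis_def sum_component)
  then show ?thesis using *[of UNIV] by simp
qed

text \<open>Write \<open>z = x + i y\<close>. As a function of a complex parameter \<open>w\<close>,
  the integral of \<open>G (x - t + w y)\<close> over \<open>t\<close> is holomorphic, and for real
  \<open>w\<close> it is constant because \<open>x + w y\<close> is then a real translation. By the
  identity theorem it is constant up to \<open>w = i\<close>, which is the point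
  \<open>z\<close>.\<close>

lemma integral_slice_constant:
  fixes G :: "complex ^ 'm \<Rightarrow> complex"
  assumes G: "cholomorphic_on G (strip s)"
    and p: "\<And>z k. z \<in> strip s \<Longrightarrow> G (z + int_vec k) = G z"
    and z: "z \<in> strip s"
  shows "integral unit_cube (\<lambda>t. G (z - cvec t)) = integral unit_cube (\<lambda>t. G (- cvec t))"
proof -
  define x where "x = (\<chi> i. Re (z $ i))"
  define y where "y = (\<chi> i. Im (z $ i))"
  have zxy: "z = cvec x + \<i> *\<^sub>C cvec y" by (simp add: vec_eq_iff x_def y_def complex_eq_iff)
  \<comment> \<open>The parameters \<open>w\<close> for which \<open>x + w y\<close> lies in the
    strip: an open convex set that contains the real axis and, as \<open>z\<close> is in the strip,
    also the imaginary unit.\<close>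
  define U where "U = {w. \<forall>i. \<bar>Im w\<bar> * \<bar>y $ i\<bar> < s}"
  have s: "s > 0" using z by (auto simp: strip_def intro: le_less_trans[OF abs_ge_zero])
  have Ueq: "U = (\<Inter>i. {w. Im w * y $ i < s} \<inter> {w. - s < Im w * y $ i})"
  proof -
    have "\<bar>Im w\<bar> * \<bar>y $ i\<bar> < s \<longleftrightarrow> Im w * y $ i < s \<and> - s < Im w * y $ i" for w i
      by (simp add: abs_mult[symmetric] abs_less_iff) linarith
    then show ?thesis by (auto simp: U_def)
  qed
  have opU: "open U"
    unfolding Ueq by (intro open_INT open_Int open_Collect_less continuous_intros ballI) auto
  have cvU: "convex U"
  proof -
    have "convex {w. Im w * y $ i < s}" "convex {w. - s < Im w * y $ i}" for i
    proof -
      have l: "linear (\<lambda>w. Im w * y $ i)" by (rule linearI) (auto simp: algebra_simps)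
      have "{w. Im w * y $ i < s} = (\<lambda>w. Im w * y $ i) -` {..<s}" "{w. - s < Im w * y $ i} = (\<lambda>w. Im w * y $ i) -` {-s<..}" by auto
      then show "convex {w. Im w * y $ i < s}" "convex {w. - s < Im w * y $ i}"
        using convex_linear_vimage[OF l] by simp_all
    qed
    then show ?thesis unfolding Ueq by (intro convex_INT convex_Int)
  qed
  have U01: "of_real r \<in> U" "\<i> \<in> U" for r using s z by (auto simp: U_def y_def strip_def)
  have instrip: "(cvec x - cvec t) + w *\<^sub>C cvec y \<in> strip s" if "w \<in> U" for w t
    using that by (auto simp: strip_def U_def abs_mult)
  define \<psi> where "\<psi> w = integral unit_cube (\<lambda>t. G ((cvec x - cvec t) + w *\<^sub>C cvec y))" for w
  have cont: "continuous_on S (\<lambda>p. (cvec x - cvec (snd p)) + fst p *\<^sub>C cvec y)" for S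
    by (intro continuous_intros bounded_linear.continuous_on[OF bounded_linear_scaleC_left])
  have hol: "\<psi> holomorphic_on U"
    unfolding \<psi>_def
  proof (rule leibniz_rule_holomorphic[OF _ _ _ cvU])
    fix w t assume w: "w \<in> U"
    show "((\<lambda>w. G ((cvec x - cvec t) + w *\<^sub>C cvec y)) has_field_derivative
        dd G ((cvec x - cvec t) + w *\<^sub>C cvec y) (cvec y)) (at w within U)"
      by (rule has_field_derivative_at_within, rule cdiff_has_field_derivative_dd)
         (use G instrip[OF w] in \<open>auto simp: cholomorphic_on_cdiff\<close>)
  next
    fix w assume w: "w \<in> U"
    show "(\<lambda>t. G ((cvec x - cvec t) + w *\<^sub>C cvec y)) integrable_on unit_cube"
      by (rule integrable_continuous, rule continuous_on_compose2[OF cholomorphic_on_continuous[OF G]])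
         (use instrip[OF w] in \<open>auto intro!: continuous_intros\<close>)
  next
    have "continuous_on (U \<times> unit_cube) (\<lambda>p. dd G ((cvec x - cvec (snd p)) + fst p *\<^sub>C cvec y) (cvec y))"
      by (rule continuous_on_compose2[OF continuous_on_dd[OF G open_strip] cont]) (use instrip in auto)
    then show "continuous_on (U \<times> unit_cube) (\<lambda>(w, t). dd G ((cvec x - cvec t) + w *\<^sub>C cvec y) (cvec y))"
      by (simp add: case_prod_unfold)
  qed
  have real: "\<psi> (of_real r) = integral unit_cube (\<lambda>t. G (- cvec t))" for r
  proof -
    let ?\<gamma> = "\<lambda>t. G (- cvec t)"
    have 0: "- cvec t \<in> strip s" for t using s by (simp add: strip_def)
    have "integral unit_cube (\<lambda>t. ?\<gamma> (t + (- x - r *\<^sub>R y))) = integral unit_cube ?\<gamma>"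
    proof (rule integral_translate_periodic)
      show "continuous_on UNIV ?\<gamma>"
        by (rule continuous_on_compose2[OF cholomorphic_on_continuous[OF G]])
           (use 0 in \<open>auto intro!: continuous_intros\<close>)
      show "?\<gamma> (x + int_vec k) = ?\<gamma> x" for x k
        using p[OF 0, of x "- k"] by (simp add: cvec_add cvec_int_vec int_vec_minus)
    qed
    then show ?thesis
      by (simp add: \<psi>_def cvec_add cvec_diff cvec_minus cvec_scaleR scaleC_of_real algebra_simps)
  qed
  have "\<psi> \<i> - \<psi> 0 = 0"
  proof (rule analytic_continuation[where f = "\<lambda>w. \<psi> w - \<psi> 0" and S = U and U = "range of_real" and \<xi> = 0 and w = \<i>])
    show "(\<lambda>w. \<psi> w - \<psi> 0) holomorphic_on U" by (intro holomorphic_intros hol)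
    show "connected U" by (rule convex_connected[OF cvU])
    show "range of_real \<subseteq> U" using U01 by auto
    show "0 islimpt range complex_of_real"
      unfolding islimpt_approachable
    proof (intro allI impI)
      fix e :: real assume "e > 0"
      then show "\<exists>x'\<in>range complex_of_real. x' \<noteq> 0 \<and> dist x' 0 < e"
        by (intro bexI[of _ "of_real (e/2)"] rangeI) auto
    qed
    show "\<psi> w - \<psi> 0 = 0" if "w \<in> range of_real" for w using that real real[of 0] by auto
  qed (use opU U01 U01(1)[of 0] in auto)
  moreover have "\<psi> \<i> = integral unit_cube (\<lambda>t. G (z - cvec t))"
    by (simp add: \<psi>_def zxy algebra_simps)
  ultimately show ?thesis using real[of 0] by simp
qed

text \<open>Convolving with \<open>chr k\<close> over real translations multiplies
  \<open>chr k z\<close> by a Fourier coefficient, namely the integral of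
  \<open>G = g * chr (- k)\<close>. That this integral is the same for every complex
  \<open>z\<close> of the strip is \<open>integral_slice_constant\<close>, so the result is a
  trigonometric polynomial there and not only at real points.\<close>

lemma convolution_lincomb_chr:
  fixes g :: "complex ^ 'm \<Rightarrow> complex"
  assumes g: "cholomorphic_on g (strip s)"
    and p: "\<And>z k. z \<in> strip s \<Longrightarrow> g (z + int_vec k) = g z"
    and E: "E \<in> lincomb (range chr)"
  shows "\<exists>T\<in>lincomb (range chr). \<forall>z\<in>strip s. integral unit_cube (\<lambda>t. g (z - cvec t) * E (cvec t)) = T z"
  using E
proof induction
  case lincomb_zero
  show ?case by (rule bexI[OF _ lincomb.lincomb_zero]) simp
next
  case (lincomb_step E b c)
  then obtain k T where b: "b = chr k" and T: "T \<in> lincomb (range chr)"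
    "\<And>z. z \<in> strip s \<Longrightarrow> integral unit_cube (\<lambda>t. g (z - cvec t) * E (cvec t)) = T z" by blast
  define G where "G z = g z * chr (\<lambda>i. - k i) z" for z
  define a where "a = integral unit_cube (\<lambda>t. G (- cvec t))"
  have Gc: "integral unit_cube (\<lambda>t. G (z - cvec t)) = a" if "z \<in> strip s" for z
    unfolding a_def
  proof (rule integral_slice_constant[OF _ _ that])
    show "cholomorphic_on G (strip s)" unfolding G_def cholomorphic_on_cdiff
      using g by (auto simp: cholomorphic_on_cdiff intro!: cdiff_mult cdiff_chr)
  qed (simp add: G_def p chr_add)
  have "integral unit_cube (\<lambda>t. g (z - cvec t) * (E (cvec t) + c * b (cvec t))) = T z + c * a * chr k z"
    if z: "z \<in> strip s" for z
  proof -
    have cg: "continuous_on unit_cube (\<lambda>t. g (z - cvec t))"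
      by (rule continuous_on_compose2[OF cholomorphic_on_continuous[OF g]])
         (use z in \<open>auto intro!: continuous_intros\<close>)
    have cE: "continuous_on unit_cube (\<lambda>t. F (cvec t))" if "F \<in> lincomb (range chr)" for F
      by (rule continuous_on_compose2[OF continuous_on_lincomb_chr[OF that, of UNIV]])
         (auto intro!: continuous_intros)
    have cb: "continuous_on unit_cube (\<lambda>t. chr k (cvec t))"
      using cE[OF lincomb_base[of "chr k" _ 1]] by simp
    have eq: "g (z - cvec t) * chr k (cvec t) = chr k z * G (z - cvec t)" for t
    proof -
      have "chr k (cvec t) = chr k (z + (- (z - cvec t)))" by simp
      also have "\<dots> = chr k z * chr (\<lambda>i. - k i) (z - cvec t)" by (simp only: chr_add chr_minus)
      finally show ?thesis by (simp add: G_def)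
    qed
    have "integral unit_cube (\<lambda>t. g (z - cvec t) * (E (cvec t) + c * b (cvec t))) =
        integral unit_cube (\<lambda>t. g (z - cvec t) * E (cvec t) + c * (g (z - cvec t) * chr k (cvec t)))"
      by (simp add: b algebra_simps)
    also have "\<dots> = T z + integral unit_cube (\<lambda>t. c * (g (z - cvec t) * chr k (cvec t)))"
    proof -
      have "(\<lambda>t. g (z - cvec t) * E (cvec t)) integrable_on unit_cube"
        by (rule integrable_continuous) (intro continuous_intros cg cE lincomb_step.hyps(1))
      moreover have "(\<lambda>t. c * (g (z - cvec t) * chr k (cvec t))) integrable_on unit_cube"
        by (rule integrable_continuous) (intro continuous_intros cg cb)
      ultimately show ?thesis by (simp add: integral_add T(2)[OF z])
    qed
    also have "integral unit_cube (\<lambda>t. c * (g (z - cvec t) * chr k (cvec t))) = c * (chr k z * a)"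
      using Gc[OF z] by (simp add: eq)
    finally show ?thesis by simp
  qed
  then show ?case
    by (intro bexI[OF _ lincomb.lincomb_step[OF T(1), of "chr k" "c * a"]] ballI) simp_all
qed


section \<open>The convolution kernel\<close>

text \<open>Its normalized powers form an approximate identity of de la Vallee Poussin type. Sines
  place the unique maximum at the centre of the cube of integration, so the mass never concentrates
  on the boundary; the offset \<open>half_vec\<close> is removed later by a translation.\<close>

definition bump :: "real ^ 'm \<Rightarrow> real" where
  "bump x = (\<Prod>i\<in>UNIV. (sin (pi * x $ i))\<^sup>2)"

definition half_vec :: "real ^ 'm" where
  "half_vec = (\<chi> i. 1 / 2)"

lemma bump_range: "0 \<le> bump x" "bump x \<le> 1"
  unfolding bump_def by (auto intro!: prod_nonneg prod_le_1 simp: abs_square_le_1)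

lemma bump_half_vec [simp]: "bump half_vec = 1"
  by (simp add: bump_def half_vec_def)

lemma continuous_on_bump [continuous_intros]: "continuous_on S bump"
  unfolding bump_def by (intro continuous_intros)

lemma bump_less_1:
  assumes "x \<in> unit_cube" "x \<noteq> half_vec"
  shows "bump x < 1"
proof -
  obtain i where i: "x $ i \<noteq> 1 / 2" using assms(2) by (auto simp: half_vec_def vec_eq_iff)
  have x: "0 \<le> x $ i" "x $ i \<le> 1" using assms(1) by (auto simp: mem_box_cart)
  have "cos (pi * x $ i) \<noteq> 0"
  proof
    assume "cos (pi * x $ i) = 0"
    then have "cos (pi * x $ i) = cos (pi / 2)" by simp
    then have "pi * x $ i = pi / 2"
      by (rule cos_inj_pi[rotated 4]) (use x in \<open>simp_all\<close>)
    then show False using i by simp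
  qed
  then have lt: "(sin (pi * x $ i))\<^sup>2 < 1"
    using sin_cos_squared_add[of "pi * x $ i"] by (smt (verit) zero_less_power2)
  have "bump x = (sin (pi * x $ i))\<^sup>2 * (\<Prod>j\<in>UNIV - {i}. (sin (pi * x $ j))\<^sup>2)"
    unfolding bump_def by (rule prod.remove) auto
  also have "\<dots> \<le> (sin (pi * x $ i))\<^sup>2 * 1"
    by (intro mult_left_mono prod_le_1) (auto simp: abs_square_le_1)
  finally show ?thesis using lt by simp
qed

text \<open>The square of \<open>sin (pi x)\<close> is \<open>(1 - cos (2 pi x)) / 2\<close>, so it
  has period 1 and only the frequencies -1, 0 and 1.\<close>

lemma bump_lincomb_chr: "\<exists>E\<in>lincomb (range chr). \<forall>x::real^'m. E (cvec x) = of_real (bump x)"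
proof -
  define e where "e i z = 1/2 + ((-1/4) * chr (\<lambda>j. if j = i then 1 else 0) z + (-1/4) * chr (\<lambda>j. if j = i then -1 else 0) z)"
    for i and z :: "complex^'m"
  have "(\<lambda>z. \<Prod>i\<in>UNIV. e i z) \<in> lincomb (range chr)"
    unfolding e_def by (intro lincomb_chr_prod lincomb_add lincomb_chr_const lincomb_base) auto
  moreover have "e i (cvec x) = of_real ((sin (pi * x $ i))\<^sup>2)" for i and x :: "real^'m"
  proof -
    let ?w = "of_real (2 * (pi * x $ i)) :: complex"
    have "e i (cvec x) = 1/2 - (exp (\<i> * ?w) + exp (- (\<i> * ?w))) / 4"
      unfolding e_def chr_single by (simp add: algebra_simps)
    also have "\<dots> = (1 - cos ?w) / 2" by (simp add: cos_exp_eq field_simps)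
    also have "\<dots> = of_real ((1 - cos (2 * (pi * x $ i))) / 2)" by (simp add: cos_of_real[symmetric] del: of_real_mult)
    also have "(1 - cos (2 * (pi * x $ i))) / 2 = (sin (pi * x $ i))\<^sup>2" by (simp add: cos_double_sin)
    finally show ?thesis .
  qed
  ultimately show ?thesis by (intro bexI[of _ "\<lambda>z. \<Prod>i\<in>UNIV. e i z"]) (auto simp: bump_def)
qed

text \<open>
  Laplace's method: \<open>bump\<close> is at most some \<open>a < 1\<close> away from the centre, and at least some \<open>b > a\<close> on a
  small cube around the centre.
\<close>

lemma bump_concentration:
  fixes d e C :: real
  assumes d: "d > 0" and e: "e > 0" and C: "C \<ge> 0"
  obtains N where "integral unit_cube (\<lambda>x::real^'m. bump x ^ N) > 0"
    "\<And>x::real^'m. x \<in> unit_cube \<Longrightarrow> dist x half_vec \<ge> d \<Longrightarrow>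
       C * bump x ^ N \<le> e * integral unit_cube (\<lambda>x::real^'m. bump x ^ N)"
proof -
  let ?S = "unit_cube - ball (half_vec :: real^'m) d"
  obtain a where a: "0 \<le> a" "a < 1" "\<And>x. x \<in> ?S \<Longrightarrow> bump x \<le> a"
  proof (cases "?S = {}")
    case True
    show ?thesis by (rule that[of 0]) (use True in \<open>simp_all add: set_eq_iff\<close>)
  next
    case False
    have "compact ?S" by (intro compact_diff) auto
    from continuous_attains_sup[OF this False continuous_on_bump] obtain x0 where
      "x0 \<in> ?S" "\<forall>y\<in>?S. bump y \<le> bump x0" by blast
    moreover have "x0 \<noteq> half_vec" using \<open>x0 \<in> ?S\<close> d by auto
    ultimately show ?thesis
      by (intro that[of "bump x0"]) (use bump_range[of x0] bump_less_1[of x0] in auto)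
  qed
  define b where "b = (1 + a) / 2"
  have b: "0 < b" "a < b" "b < 1" using a by (auto simp: b_def)
  have "isCont bump (half_vec :: real^'m)"
    using continuous_on_bump[of "UNIV :: (real^'m) set"] by (simp add: continuous_on_eq_continuous_at)
  then obtain r where r: "r > 0" "\<And>x::real^'m. dist x half_vec < r \<Longrightarrow> dist (bump x) 1 < 1 - b"
    unfolding continuous_at_eps_delta using b(3) by (metis bump_half_vec diff_gt_0_iff_gt)
  define q where "q = min (1/2) (r / (2 * of_nat CARD('m)))"
  have q: "0 < q" "q \<le> 1/2" "q * of_nat CARD('m) < r"
  proof -
    show "0 < q" "q \<le> 1/2" using r by (auto simp: q_def)
    have "q * of_nat CARD('m) \<le> r / (2 * of_nat CARD('m)) * of_nat CARD('m)"
      by (intro mult_right_mono) (auto simp: q_def)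
    then show "q * of_nat CARD('m) < r" using r by simp
  qed
  let ?Q = "cbox (half_vec - (\<chi> i. q)) (half_vec + (\<chi> i. q)) :: (real^'m) set"
  have Qsub: "?Q \<subseteq> unit_cube" using q by (auto simp: mem_box_cart half_vec_def) (smt (verit) field_sum_of_halves)+
  have Qb: "bump x \<ge> b" if x: "x \<in> ?Q" for x
  proof -
    have "norm (x - half_vec) \<le> (\<Sum>i\<in>UNIV. \<bar>(x - half_vec) $ i\<bar>)" by (rule norm_le_l1_cart)
    also have "\<dots> \<le> (\<Sum>i\<in>(UNIV::'m set). q)"
      by (rule sum_mono) (use x in \<open>auto simp: mem_box_cart half_vec_def abs_le_iff algebra_simps\<close>)
    also have "\<dots> < r" using q(3) by (simp add: mult.commute)
    finally show ?thesis using r(2)[of x] by (auto simp: dist_norm dist_real_def)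
  qed
  define \<mu> where "\<mu> = measure lborel ?Q"
  have \<mu>: "\<mu> > 0"
    unfolding \<mu>_def using q by (subst content_pos_lt_eq) (auto simp: Basis_vec_def inner_axis)
  have int: "(\<lambda>x::real^'m. bump x ^ N) integrable_on cbox u v" for N u v
    by (intro integrable_continuous continuous_intros)
  have low: "\<mu> * b ^ N \<le> integral unit_cube (\<lambda>x::real^'m. bump x ^ N)" for N
  proof -
    have "\<mu> * b ^ N = integral ?Q (\<lambda>_. b ^ N)" by (simp add: \<mu>_def)
    also have "\<dots> \<le> integral ?Q (\<lambda>x. bump x ^ N)"
      by (rule integral_le) (use int Qb b in \<open>auto intro: power_mono\<close>)
    also have "\<dots> \<le> integral unit_cube (\<lambda>x::real^'m. bump x ^ N)"
      using Qsub int int by (rule integral_subset_le) (simp add: bump_range)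
    finally show ?thesis .
  qed
  have "(\<lambda>N. C * (a / b) ^ N) \<longlonglongrightarrow> C * 0"
    by (intro tendsto_intros LIMSEQ_realpow_zero) (use a b in auto)
  then have "\<forall>\<^sub>F N in sequentially. C * (a / b) ^ N < e * \<mu>"
    using e \<mu> by (intro order_tendstoD) auto
  then obtain N where N: "C * (a / b) ^ N < e * \<mu>" by (auto simp: eventually_sequentially)
  have pos: "0 < \<mu> * b ^ N" using \<mu> b by simp
  show ?thesis
  proof (rule that)
    show "integral unit_cube (\<lambda>x::real^'m. bump x ^ N) > 0" using low[of N] pos by linarith
    fix x :: "real^'m" assume x: "x \<in> unit_cube" "dist x half_vec \<ge> d"
    have "bump x ^ N \<le> a ^ N" using a(3)[of x] x bump_range[of x] by (intro power_mono) (auto simp: dist_commute)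
    then have "C * bump x ^ N \<le> C * a ^ N" using C by (rule mult_left_mono)
    also have "\<dots> \<le> e * (\<mu> * b ^ N)" using N b by (simp add: power_divide field_simps)
    also have "\<dots> \<le> e * integral unit_cube (\<lambda>x::real^'m. bump x ^ N)" using low[of N] e by simp
    finally show "C * bump x ^ N \<le> e * integral unit_cube (\<lambda>x::real^'m. bump x ^ N)" .
  qed
qed

text \<open>The strip is not compact, but modulo integer translations the smaller strip is
  relatively compact in the larger one. Real parts are normalized to \<open>[0,1)\<close>, and the
  box from -1 to 2 leaves room for a real displacement of norm below 1. This gives uniform bounds
  and uniform continuity for periodic functions.\<close>

lemma strip_periodic_compact:
  assumes "0 < s'" "s' < s"
  obtains K :: "(complex ^ 'm) set" where "compact K" "K \<subseteq> strip s"
    "\<And>z. z \<in> strip s' \<Longrightarrow> \<exists>k. z + int_vec k \<in> K \<and> (\<forall>x. norm x < 1 \<longrightarrow> z + int_vec k + cvec x \<in> K)"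
proof
  let ?f = "\<lambda>p :: (real^'m) \<times> (real^'m). cvec (fst p) + \<i> *\<^sub>C cvec (snd p)"
  let ?K = "?f ` (cbox (\<chi> i. -1) (\<chi> i. 2) \<times> cbox (\<chi> i. - s') (\<chi> i. s'))"
  have "continuous_on UNIV (\<lambda>x::complex^'m. \<i> *\<^sub>C x)"
  proof -
    have "bounded_linear (\<lambda>x::complex^'m. \<i> *\<^sub>C x)"
      by (rule bounded_linear_intro[where K = 1]) (auto simp: vec_eq_iff algebra_simps norm_scaleC)
    then show ?thesis by (rule linear_continuous_on)
  qed
  then have c: "continuous_on S ?f" for S
    by (intro continuous_intros) (rule continuous_on_compose2, assumption, auto intro!: continuous_intros)
  show "compact ?K" by (intro compact_continuous_image c compact_Times compact_cbox)
  show "?K \<subseteq> strip s" using assms by (auto simp: strip_def mem_box_cart abs_less_iff) (smt (verit))+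
  fix z :: "complex^'m" assume z: "z \<in> strip s'"
  define k where "k = (\<chi> i. - \<lfloor>Re (z $ i)\<rfloor>)"
  have K: "z + int_vec k + cvec x \<in> ?K" if "norm x < 1" for x
  proof (rule image_eqI)
    let ?p = "((\<chi> i. frac (Re (z $ i)) + x $ i), (\<chi> i. Im (z $ i)))"
    show "z + int_vec k + cvec x = ?f ?p"
      by (simp add: vec_eq_iff complex_eq_iff k_def int_vec_def frac_def)
    have xi: "\<bar>x $ i\<bar> < 1" for i using component_le_norm_cart[of x i] that by linarith
    have "- 1 \<le> frac (Re (z $ i)) + x $ i \<and> frac (Re (z $ i)) + x $ i \<le> 2" for i
      using frac_ge_0[of "Re (z $ i)"] frac_lt_1[of "Re (z $ i)"] xi[of i] by linarith
    moreover have "- s' \<le> Im (z $ i) \<and> Im (z $ i) \<le> s'" for i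
      using z by (simp add: strip_def abs_less_iff) (smt (verit))
    ultimately show "?p \<in> cbox (\<chi> i. -1) (\<chi> i. 2) \<times> cbox (\<chi> i. - s') (\<chi> i. s')"
      by (auto simp: mem_box_cart)
  qed
  show "\<exists>k. z + int_vec k \<in> ?K \<and> (\<forall>x. norm x < 1 \<longrightarrow> z + int_vec k + cvec x \<in> ?K)"
    using K K[of 0] by auto
qed

text \<open>The convolution with the normalized kernel is a trigonometric polynomial. The error is
  split at distance \<open>d\<close> from the centre: nearby the oscillation of \<open>g\<close> is
  at most \<open>e'\<close>, and far away the kernel outweighs the bound
  \<open>2 * M\<close>.\<close>

lemma periodic_approx:
  fixes g :: "complex ^ 'm \<Rightarrow> complex"
  assumes s: "s > 0" and g: "cholomorphic_on g (strip s)"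
    and p: "\<And>z k. z \<in> strip s \<Longrightarrow> g (z + int_vec k) = g z" and e: "e > 0"
  shows "\<exists>T\<in>lincomb (range chr). \<forall>z\<in>strip (s / 2). cmod (T z - g z) < e"
proof -
  obtain K :: "(complex ^ 'm) set" where K: "compact K" "K \<subseteq> strip s"
    "\<And>z. z \<in> strip (s / 2) \<Longrightarrow> \<exists>k. z + int_vec k \<in> K \<and> (\<forall>x. norm x < 1 \<longrightarrow> z + int_vec k + cvec x \<in> K)"
    using strip_periodic_compact[of "s / 2" s] s by auto
  have cK: "continuous_on K g" by (rule continuous_on_subset[OF cholomorphic_on_continuous[OF g] K(2)])
  have mono: "z \<in> strip s" if "z \<in> strip (s/2)" for z :: "complex^'m"
  proof -
    have "\<bar>Im (z $ i)\<bar> < s" for i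
    proof -
      have "\<bar>Im (z $ i)\<bar> < s / 2" using that unfolding strip_def by blast
      then show ?thesis using s by linarith
    qed
    then show ?thesis by (simp add: strip_def)
  qed
  obtain M where M: "M > 0" "\<And>z. z \<in> K \<Longrightarrow> cmod (g z) \<le> M"
    using compact_imp_bounded[OF compact_continuous_image[OF cK K(1)]] unfolding bounded_pos by auto
  have Ms: "cmod (g z) \<le> M" if "z \<in> strip (s/2)" for z
    using K(3)[OF that] M(2) p[OF mono[OF that]] by metis
  \<comment> \<open>The near and the far part each contribute \<open>e' * I\<close> before
    normalization, so the final error is \<open>2 * e'\<close>, half of \<open>e\<close>.\<close>
  define e' where "e' = e / 4"
  have e': "e' > 0" using e by (simp add: e'_def)
  obtain d0 where d0: "d0 > 0" "\<And>z w. z \<in> K \<Longrightarrow> w \<in> K \<Longrightarrow> dist w z < d0 \<Longrightarrow> dist (g w) (g z) < e'"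
    using compact_uniformly_continuous[OF cK K(1)] e' unfolding uniformly_continuous_on_def by metis
  define d where "d = min d0 1"
  have d: "d > 0" using d0 by (simp add: d_def)
  have close: "cmod (g (z + cvec x) - g z) \<le> e'" if z: "z \<in> strip (s/2)" and x: "norm x < d" for z x
  proof -
    obtain k where k: "z + int_vec k \<in> K" "z + int_vec k + cvec x \<in> K"
      using K(3)[OF z] x by (auto simp: d_def)
    have "dist (g (z + int_vec k + cvec x)) (g (z + int_vec k)) < e'"
      by (rule d0(2)[OF k]) (use x in \<open>simp add: dist_norm d_def\<close>)
    moreover have "g (z + int_vec k + cvec x) = g (z + cvec x)"
      using p[of "z + cvec x" k] mono[OF z] by (simp add: algebra_simps)
    ultimately show ?thesis using p[OF mono[OF z], of k] by (simp add: dist_norm)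
  qed
  obtain N where N: "integral unit_cube (\<lambda>x::real^'m. bump x ^ N) > 0"
    "\<And>x::real^'m. x \<in> unit_cube \<Longrightarrow> dist x half_vec \<ge> d \<Longrightarrow>
       2 * M * bump x ^ N \<le> e' * integral unit_cube (\<lambda>x::real^'m. bump x ^ N)"
    using bump_concentration[OF d e', of "2 * M"] M(1) by auto
  define I where "I = integral unit_cube (\<lambda>x::real^'m. bump x ^ N)"
  have I: "I > 0" using N by (simp add: I_def)
  obtain E where E: "E \<in> lincomb (range chr)" "\<And>x::real^'m. E (cvec x) = of_real (bump x)"
    using bump_lincomb_chr by blast
  \<comment> \<open>Compensates the centre of the kernel: \<open>h (z - t)\<close> is close to
    \<open>g z\<close> exactly when \<open>t\<close> is close to \<open>half_vec\<close>.\<close>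
  define h where "h z = g (z + cvec half_vec)" for z
  have hh: "cholomorphic_on h (strip s)"
    unfolding h_def cholomorphic_on_cdiff
  proof
    fix z :: "complex^'m" assume "z \<in> strip s"
    then have "cdiff g (z + cvec half_vec)" using g by (simp add: cholomorphic_on_cdiff)
    then show "cdiff (\<lambda>z. g (z + cvec half_vec)) z"
      by (rule cdiff_compose) (intro cdiff_intros)
  qed
  have hp: "h (z + int_vec k) = h z" if "z \<in> strip s" for z k
    using p[of "z + cvec half_vec" k] that by (simp add: h_def algebra_simps)
  obtain T where T: "T \<in> lincomb (range chr)"
    "\<And>z. z \<in> strip s \<Longrightarrow> integral unit_cube (\<lambda>t. h (z - cvec t) * E (cvec t) ^ N) = T z"
    using convolution_lincomb_chr[OF hh hp lincomb_chr_power[OF E(1), of N]] by blast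
  have "cmod (of_real (1/I) * T z - g z) < e" if z: "z \<in> strip (s/2)" for z
  proof -
    have cont: "continuous_on unit_cube (\<lambda>t. h (z - cvec t))"
      by (rule continuous_on_compose2[OF cholomorphic_on_continuous[OF hh]])
         (use mono[OF z] in \<open>auto intro!: continuous_intros\<close>)
    have i1: "(\<lambda>t. of_real (bump t ^ N) * (h (z - cvec t) - g z)) integrable_on unit_cube"
      by (intro integrable_continuous continuous_intros cont)
    have i2: "(\<lambda>t. e' * bump t ^ N + e' * I) integrable_on (unit_cube :: (real^'m) set)"
      by (intro integrable_continuous continuous_intros)
    have "T z - of_real I * g z = integral unit_cube (\<lambda>t. of_real (bump t ^ N) * (h (z - cvec t) - g z))"
    proof -
      have "of_real I = integral unit_cube (\<lambda>t::real^'m. of_real (bump t ^ N) :: complex)"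
        unfolding I_def
        by (subst integral_linear[OF _ bounded_linear_of_real, symmetric, unfolded o_def])
           (intro integrable_continuous continuous_intros, simp)
      then have "of_real I * g z = integral unit_cube (\<lambda>t::real^'m. of_real (bump t ^ N) * g z)" by simp
      moreover have "T z = integral unit_cube (\<lambda>t. h (z - cvec t) * of_real (bump t ^ N))"
        using T(2)[OF mono[OF z]] E(2) by simp
      moreover have "(\<lambda>t. h (z - cvec t) * of_real (bump t ^ N)) integrable_on unit_cube"
        "(\<lambda>t::real^'m. of_real (bump t ^ N) * g z) integrable_on unit_cube"
        by (intro integrable_continuous continuous_intros cont)+
      ultimately have "T z - of_real I * g z =
          integral unit_cube (\<lambda>t. h (z - cvec t) * of_real (bump t ^ N) - of_real (bump t ^ N) * g z)"
        by (simp only: integral_diff)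
      then show ?thesis by (simp add: right_diff_distrib mult.commute)
    qed
    also have "cmod \<dots> \<le> integral unit_cube (\<lambda>t::real^'m. e' * bump t ^ N + e' * I)"
    proof (rule integral_norm_bound_integral[OF i1 i2])
      fix t :: "real^'m" assume t: "t \<in> unit_cube"
      have zt: "h (z - cvec t) = g (z + cvec (half_vec - t))" by (simp add: h_def cvec_diff algebra_simps)
      have B: "bump t ^ N \<ge> 0" by (simp add: bump_range)
      show "cmod (of_real (bump t ^ N) * (h (z - cvec t) - g z)) \<le> e' * bump t ^ N + e' * I"
      proof (cases "dist t half_vec < d")
        case True
        then have "cmod (h (z - cvec t) - g z) \<le> e'"
          unfolding zt by (intro close z) (simp add: dist_norm norm_minus_commute)
        then have "bump t ^ N * cmod (h (z - cvec t) - g z) \<le> bump t ^ N * e'" using B by (rule mult_left_mono)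
        moreover have "e' * I \<ge> 0" using e' I by simp
        ultimately show ?thesis by (simp add: norm_mult norm_power bump_range mult.commute)
      next
        case False
        have "cmod (h (z - cvec t) - g z) \<le> 2 * M"
          unfolding zt using Ms[OF z] Ms[of "z + cvec (half_vec - t)"] z
            norm_triangle_ineq4[of "g (z + cvec (half_vec - t))" "g z"] by simp
        then have "bump t ^ N * cmod (h (z - cvec t) - g z) \<le> bump t ^ N * (2 * M)" using B by (rule mult_left_mono)
        also have "\<dots> \<le> e' * I" using N(2)[OF t] False by (simp add: I_def mult.commute)
        finally have "bump t ^ N * cmod (h (z - cvec t) - g z) \<le> e' * I" .
        moreover have "e' * bump t ^ N \<ge> 0" using e' B by simp
        ultimately show ?thesis by (simp add: norm_mult norm_power bump_range)
      qed
    qed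
    also have "\<dots> = e' * I + e' * I"
    proof -
      have "integral unit_cube (\<lambda>t::real^'m. e' * bump t ^ N + e' * I)
          = integral unit_cube (\<lambda>t::real^'m. e' * bump t ^ N) + integral (unit_cube :: (real^'m) set) (\<lambda>_. e' * I)"
        by (intro integral_add integrable_continuous continuous_intros)
      moreover have "measure lborel (unit_cube :: (real^'m) set) = 1"
        by (subst content_cbox_cart) (auto simp: interval_ne_empty_cart)
      ultimately show ?thesis by (simp add: I_def)
    qed
    finally have *: "cmod (T z - of_real I * g z) \<le> 2 * e' * I" by (simp add: mult_ac)
    have "of_real (1/I) * T z - g z = of_real (1/I) * (T z - of_real I * g z)"
      using I by (simp add: field_simps)
    then have "cmod (of_real (1/I) * T z - g z) = 1 / I * cmod (T z - of_real I * g z)"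
      using I by (simp add: norm_mult norm_divide)
    also have "\<dots> \<le> 1 / I * (2 * e' * I)" using I * by (intro mult_left_mono) auto
    also have "\<dots> < e" using I e by (simp add: e'_def)
    finally show ?thesis .
  qed
  then show ?thesis using lincomb_scale[OF T(1), of "of_real (1/I)"] by (intro bexI[of _ "\<lambda>z. of_real (1/I) * T z"]) auto
qed

section \<open>Phase space coordinates\<close>

type_synonym 'n rpt = "(real ^ 'n) \<times> (real ^ 'n)"
type_synonym 'n cpt = "(complex ^ 'n) \<times> (complex ^ 'n)"

definition cv :: "('n::finite) rpt \<Rightarrow> 'n cpt" where
  "cv x = (cvec (fst x), cvec (snd x))"

text \<open>The positions have indices \<open>Inl i\<close>, the momenta \<open>Inr i\<close>.\<close>

definition coord :: "'n + 'n \<Rightarrow> ('a ^ 'n) \<times> ('a ^ 'n) \<Rightarrow> 'a" where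
  "coord j z = (case j of Inl i \<Rightarrow> fst z $ i | Inr i \<Rightarrow> snd z $ i)"

definition of_coords :: "('n + 'n \<Rightarrow> 'a) \<Rightarrow> ('a ^ 'n) \<times> ('a ^ 'n)" where
  "of_coords f = (\<chi> i. f (Inl i), \<chi> i. f (Inr i))"

lemma coord_of_coords [simp]: "coord j (of_coords f) = f j"
  by (cases j) (simp_all add: coord_def of_coords_def)

lemma coord_eqI: "(\<And>j. coord j z = coord j w) \<Longrightarrow> z = w"
proof -
  assume *: "\<And>j. coord j z = coord j w"
  show "z = w" using *[of "Inl _"] *[of "Inr _"]
    by (simp add: coord_def prod_eq_iff vec_eq_iff)
qed

lemma coord_simps [simp]:
  "coord j (z + w) = coord j z + coord j (w :: ('a::ring_1 ^ 'n) \<times> ('a ^ 'n))"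
  "coord j (z - w) = coord j z - coord j w"
  "coord j (- z) = - coord j z"
  "coord j 0 = 0"
  by (cases j; simp add: coord_def)+

lemma coord_scaleC [simp]: "coord j (c *\<^sub>C z) = c * coord j (z :: 'n::finite cpt)"
  by (cases j) (simp_all add: coord_def)

lemma coord_cv [simp]: "coord j (cv x) = of_real (coord j x)"
  by (cases j) (simp_all add: coord_def cv_def)

lemma norm_coord_le: "norm (coord j z) \<le> norm (z :: ('a::real_normed_vector ^ 'n) \<times> ('a ^ 'n))"
proof (cases j)
  case (Inl i)
  then show ?thesis using Finite_Cartesian_Product.norm_nth_le[of "fst z" i] norm_fst_le[of "fst z" "snd z"]
    by (simp add: coord_def)
next
  case (Inr i)
  then show ?thesis using Finite_Cartesian_Product.norm_nth_le[of "snd z" i] norm_snd_le[of "snd z" "fst z"]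
    by (simp add: coord_def)
qed

lemma sum_coord:
  fixes f :: "'n::finite + 'n \<Rightarrow> 'a::comm_monoid_add"
  shows "(\<Sum>j\<in>UNIV. f j) = (\<Sum>i\<in>UNIV. f (Inl i)) + (\<Sum>i\<in>UNIV. f (Inr i))"
  unfolding UNIV_sum by (subst sum.union_disjoint) (auto simp: sum.reindex)

lemma norm_le_sum_coord: "norm z \<le> (\<Sum>j\<in>UNIV. norm (coord j (z :: ('a::real_normed_vector ^ 'n) \<times> ('a ^ 'n))))"
proof -
  have v: "norm v \<le> (\<Sum>i\<in>UNIV. norm (v $ i))" for v :: "'a ^ 'n"
    unfolding norm_vec_def by (rule L2_set_le_sum) auto
  have "norm z \<le> norm (fst z) + norm (snd z)"
    using norm_Pair_le[of "fst z" "snd z"] by simp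
  also have "\<dots> \<le> (\<Sum>j\<in>UNIV. norm (coord j z))"
    using v[of "fst z"] v[of "snd z"] by (simp add: sum_coord coord_def)
  finally show ?thesis .
qed

lemma norm_le_card_coord:
  assumes "\<And>j. norm (coord j z) \<le> e"
  shows "norm (z :: ('a::real_normed_vector ^ 'n) \<times> ('a ^ 'n)) \<le> of_nat CARD('n + 'n) * e"
  using norm_le_sum_coord[of z] sum_mono[of UNIV "\<lambda>j. norm (coord j z)" "\<lambda>_. e"] assms by simp

lemma cdiff_coord [cdiff_intros]:
  fixes g :: "'a::complex_normed_space \<Rightarrow> 'n::finite cpt"
  assumes "cdiff g z"
  shows "cdiff (\<lambda>x. coord j (g x)) z"
  by (cases j) (auto simp: coord_def intro!: cdiff_intros assms)

lemma cdiff_of_coords [cdiff_intros]: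
  assumes "\<And>j. cdiff (f j) z"
  shows "cdiff (\<lambda>x. of_coords (\<lambda>j. f j x) :: 'n::finite cpt) z"
  unfolding of_coords_def by (intro cdiff_intros assms)

lemma cv_simps: "cv (x + y) = cv x + cv y" "cv (x - y) = cv x - cv y" "cv (r *\<^sub>R x) = r *\<^sub>R cv x" "cv 0 = 0"
  by (simp_all add: cv_def cvec_add cvec_diff cvec_scaleR prod_eq_iff)

lemma norm_cv [simp]: "norm (cv x) = norm x"
  by (simp add: cv_def norm_prod_def)

lemma dist_cv [simp]: "dist (cv x) (cv y) = dist x y"
  by (simp add: dist_norm flip: cv_simps)

lemma bounded_linear_cv: "bounded_linear cv"
  by (rule bounded_linear_intro[where K = 1]) (simp_all add: cv_simps)

text \<open>The flag \<open>per\<close> selects the case: all integer vectors for the torus, only 0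
  for the Euclidean base. One development thus covers both.\<close>

definition lattice :: "bool \<Rightarrow> (int ^ 'n) set" where
  "lattice per = {k. per \<or> k = 0}"

definition shift :: "int ^ 'n \<Rightarrow> ('a::real_normed_algebra_1 ^ 'n::finite) \<times> ('a ^ 'n)" where
  "shift k = (int_vec k, 0)"

lemma shift_simps: "shift 0 = 0" "shift (k + l) = shift k + shift l" "shift (- k) = - shift k" "shift (k - l) = shift k - shift l"
  by (simp_all add: shift_def int_vec_add int_vec_minus int_vec_diff prod_eq_iff)

lemma cv_shift: "cv (shift k) = shift k"
  by (simp add: cv_def shift_def cvec_int_vec)

lemma lattice_0 [simp]: "0 \<in> lattice per"
  and lattice_add: "k \<in> lattice per \<Longrightarrow> l \<in> lattice per \<Longrightarrow> k + l \<in> lattice per"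
  and lattice_minus: "k \<in> lattice per \<Longrightarrow> - k \<in> lattice per"
  by (auto simp: lattice_def)

definition phase_box :: "real \<Rightarrow> ('n::finite) rpt set" where
  "phase_box R = {x. \<forall>j. \<bar>coord j x\<bar> \<le> R}"

text \<open>A tube around all lattice translates of a real box. Being invariant under the lattice,
  it is the full preimage of a neighborhood in the complexified phase space.\<close>

definition nbhd :: "bool \<Rightarrow> real \<Rightarrow> real \<Rightarrow> ('n::finite) cpt set" where
  "nbhd per R r = {z. \<exists>x\<in>phase_box R. \<exists>k\<in>lattice per. dist z (cv x + shift k) < r}"

lemma nbhdI: "x \<in> phase_box R \<Longrightarrow> k \<in> lattice per \<Longrightarrow> dist z (cv x + shift k) < r \<Longrightarrow> z \<in> nbhd per R r"
  unfolding nbhd_def by blast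

lemma open_nbhd: "open (nbhd per R r :: ('n::finite) cpt set)"
proof -
  have "nbhd per R r = (\<Union>x\<in>phase_box R. \<Union>k\<in>lattice per. ball (cv x + shift k) r :: 'n cpt set)"
    by (simp add: nbhd_def set_eq_iff dist_commute)
  then show ?thesis by auto
qed

lemma nbhd_shift:
  fixes z :: "('n::finite) cpt"
  assumes "k \<in> lattice per"
  shows "z + shift k \<in> nbhd per R r \<longleftrightarrow> z \<in> nbhd per R r"
proof -
  have *: "z + shift k \<in> nbhd per R r" if "z \<in> nbhd per R r" "k \<in> lattice per" for z :: "'n cpt" and k
  proof -
    obtain x l where x: "x \<in> phase_box R" "l \<in> lattice per" "dist z (cv x + shift l) < r"
      using \<open>z \<in> nbhd per R r\<close> by (auto simp: nbhd_def)
    then have "dist (z + shift k) (cv x + shift (l + k)) < r"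
      by (simp add: shift_simps dist_norm algebra_simps)
    then show ?thesis using x lattice_add[OF x(2) \<open>k \<in> lattice per\<close>] unfolding nbhd_def by blast
  qed
  show ?thesis using *[of z k] *[of "z + shift k" "- k"] assms lattice_minus[OF assms]
    by (auto simp: shift_simps)
qed

lemma nbhd_mono: "R \<le> R' \<Longrightarrow> r \<le> r' \<Longrightarrow> nbhd per R r \<subseteq> nbhd per R' r'"
  unfolding nbhd_def phase_box_def by (blast intro: order_trans less_le_trans)

lemma ball_subset_nbhd:
  assumes "z \<in> nbhd per R r"
  shows "ball z r' \<subseteq> nbhd per R (r + r')"
proof
  fix w assume "w \<in> ball z r'"
  moreover obtain x l where x: "x \<in> phase_box R" "l \<in> lattice per" "dist z (cv x + shift l) < r"
    using assms by (auto simp: nbhd_def)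
  ultimately have "dist w (cv x + shift l) < r + r'"
    using dist_triangle[of w "cv x + shift l" z] by (simp add: dist_commute)
  then show "w \<in> nbhd per R (r + r')" using x unfolding nbhd_def by blast
qed

section \<open>Approximation by ridge functions\<close>

definition lin :: "('n + 'n \<Rightarrow> real) \<Rightarrow> ('n::finite) cpt \<Rightarrow> complex" where
  "lin a z = (\<Sum>j\<in>UNIV. of_real (a j) * coord j z)"

text \<open>In the periodic case the position frequencies are multiples of 2 pi, so that the
  exponential descends to the torus. The momentum frequencies are arbitrary real numbers.\<close>

definition frequency :: "bool \<Rightarrow> ('n + 'n \<Rightarrow> real) \<Rightarrow> bool" where
  "frequency per a \<longleftrightarrow> (per \<longrightarrow> (\<exists>k :: 'n \<Rightarrow> int. \<forall>i. a (Inl i) = 2 * pi * of_int (k i)))"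

definition ridge_exp :: "bool \<Rightarrow> (('n::finite) cpt \<Rightarrow> complex) set" where
  "ridge_exp per = {\<lambda>z. exp (\<i> * lin a z) |a. frequency per a}"

lemma lin_add_left: "lin (\<lambda>j. a j + b j) z = lin a z + lin b z"
  by (simp add: lin_def algebra_simps sum.distrib)

lemma lin_single: "lin (\<lambda>i. if i = j then c else 0) z = of_real c * coord j z"
proof -
  have "lin (\<lambda>i. if i = j then c else 0) z = (\<Sum>i\<in>UNIV. if i = j then of_real c * coord i z else 0)"
    unfolding lin_def by (rule sum.cong) auto
  then show ?thesis by simp
qed

lemma frequency_add: "frequency per a \<Longrightarrow> frequency per b \<Longrightarrow> frequency per (\<lambda>j. a j + b j)"
  unfolding frequency_def
proof (intro impI, elim impE exE)
  fix k l :: "'a \<Rightarrow> int"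
  assume "\<forall>i. a (Inl i) = 2 * pi * of_int (k i)" "\<forall>i. b (Inl i) = 2 * pi * of_int (l i)"
  then show "\<exists>k. \<forall>i. a (Inl i) + b (Inl i) = 2 * pi * of_int (k i)"
    by (intro exI[of _ "\<lambda>i. k i + l i"]) (simp add: algebra_simps)
qed

lemma ridge_exp_mult: "b \<in> ridge_exp per \<Longrightarrow> b' \<in> ridge_exp per \<Longrightarrow> (\<lambda>z. b z * b' z) \<in> ridge_exp per"
proof -
  assume "b \<in> ridge_exp per" "b' \<in> ridge_exp per"
  then obtain a a' where *: "b = (\<lambda>z. exp (\<i> * lin a z))" "b' = (\<lambda>z. exp (\<i> * lin a' z))"
    "frequency per a" "frequency per a'" by (auto simp: ridge_exp_def)
  have "(\<lambda>z. b z * b' z) = (\<lambda>z. exp (\<i> * lin (\<lambda>j. a j + a' j) z))"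
    by (simp add: * lin_add_left exp_add[symmetric] distrib_left)
  then show ?thesis using frequency_add[OF *(3,4)] unfolding ridge_exp_def by blast
qed

lemma ridge_exp_one: "(\<lambda>z. 1) \<in> ridge_exp per"
  unfolding ridge_exp_def
  by (intro CollectI exI[of _ "\<lambda>_. 0"]) (auto simp: lin_def frequency_def intro!: exI[of _ "\<lambda>_. 0"])

lemma lincomb_ridge_mult:
  "E \<in> lincomb (ridge_exp per) \<Longrightarrow> E' \<in> lincomb (ridge_exp per) \<Longrightarrow> (\<lambda>z. E z * E' z) \<in> lincomb (ridge_exp per)"
  by (erule (1) lincomb_mult[rotated]) (rule ridge_exp_mult)

lemma nbhd_Im_bound: "z \<in> nbhd per R r \<Longrightarrow> \<bar>Im (coord j z)\<bar> < r"
proof -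
  assume "z \<in> nbhd per R r"
  then obtain x k where x: "dist z (cv x + shift k) < r" by (auto simp: nbhd_def)
  have "Im (coord j z) = Im (coord j (z - cv (x + shift k)))" by simp
  then have "\<bar>Im (coord j z)\<bar> \<le> cmod (coord j (z - cv (x + shift k)))"
    using abs_Im_le_cmod[of "coord j (z - cv (x + shift k))"] by (simp only:)
  also have "\<dots> \<le> norm (z - cv (x + shift k))" by (rule norm_coord_le)
  also have "\<dots> < r" using x by (simp add: dist_norm cv_simps cv_shift)
  finally show ?thesis .
qed

text \<open>The coordinates that are defined only modulo 1, hence unbounded on \<open>nbhd\<close>.
  Exactly these are left unchanged by the sine substitution.\<close>

definition periodic_coord :: "bool \<Rightarrow> 'n + 'n \<Rightarrow> bool" where
  "periodic_coord per j \<longleftrightarrow> (case j of Inl _ \<Rightarrow> per | Inr _ \<Rightarrow> False)"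

lemma coord_shift:
  assumes "k \<in> lattice per" "\<not> periodic_coord per j"
  shows "coord j (shift k) = 0"
  using assms by (cases j) (auto simp: coord_def shift_def periodic_coord_def lattice_def int_vec_def)

lemma nbhd_coord_bound:
  assumes z: "z \<in> nbhd per R r" and j: "\<not> periodic_coord per j"
  obtains x where "\<bar>x\<bar> \<le> R" "cmod (coord j z - of_real x) < r"
proof -
  obtain x k where x: "x \<in> phase_box R" "k \<in> lattice per" "dist z (cv x + shift k) < r"
    using z by (auto simp: nbhd_def)
  have "cmod (coord j (z - (cv x + shift k))) < r"
    using norm_coord_le[of j "z - (cv x + shift k)"] x(3) by (simp add: dist_norm)
  then show ?thesis using that[of "coord j x"] x(1) by (auto simp: phase_box_def coord_shift[OF x(2) j])
qed

lemma nbhd_cmod_bound: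
  assumes "z \<in> nbhd per R r" "\<not> periodic_coord per j"
  shows "cmod (coord j z) < R + r"
proof -
  obtain x where "\<bar>x\<bar> \<le> R" "cmod (coord j z - of_real x) < r" using nbhd_coord_bound[OF assms] .
  then show ?thesis using norm_triangle_sub[of "coord j z" "of_real x"] by simp
qed

text \<open>Real parts of periodic coordinates are unbounded on the tube, but the modulus of
  \<open>exp (i lin a z)\<close> depends only on imaginary parts, which are below
  \<open>r\<close>.\<close>

lemma lincomb_ridge_bounded:
  assumes "E \<in> lincomb (ridge_exp per)"
  shows "\<exists>M>0. \<forall>z\<in>nbhd per R r. cmod (E z) \<le> M"
  using assms
proof induction
  case lincomb_zero
  show ?case by (intro exI[of _ 1]) auto
next
  case (lincomb_step E b c)
  then obtain a M where a: "b = (\<lambda>z. exp (\<i> * lin a z))" and M: "M > 0" "\<And>z. z \<in> nbhd per R r \<Longrightarrow> cmod (E z) \<le> M"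
    by (auto simp: ridge_exp_def)
  define C where "C = exp (\<Sum>j\<in>UNIV. \<bar>a j\<bar> * r)"
  have "cmod (b z) \<le> C" if z: "z \<in> nbhd per R r" for z
  proof -
    have "- Im (lin a z) \<le> (\<Sum>j\<in>UNIV. \<bar>a j\<bar> * r)"
      unfolding lin_def Im_sum sum_negf[symmetric]
    proof (rule sum_mono)
      fix j
      have "- (a j * Im (coord j z)) \<le> \<bar>a j\<bar> * \<bar>Im (coord j z)\<bar>"
        by (metis abs_ge_minus_self abs_mult)
      also have "\<dots> \<le> \<bar>a j\<bar> * r" using nbhd_Im_bound[OF z, of j] by (intro mult_left_mono) auto
      finally show "- Im (of_real (a j) * coord j z) \<le> \<bar>a j\<bar> * r" by simp
    qed
    then show ?thesis by (simp add: a C_def norm_exp_eq_Re)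
  qed
  then have "cmod (E z + c * b z) \<le> M + cmod c * C" if "z \<in> nbhd per R r" for z
    using that M(2)[OF that] by (intro order_trans[OF norm_triangle_ineq] add_mono) (auto simp: norm_mult mult_left_mono)
  then show ?case using M(1) by (intro exI[of _ "M + cmod c * C"]) (auto simp: C_def add_pos_nonneg)
qed

text \<open>The uniform closure of the span on one fixed tube. It is shown to be an algebra that is
  closed under uniform limits; membership proofs then replace explicit approximants.\<close>

definition ridge_closure :: "bool \<Rightarrow> real \<Rightarrow> real \<Rightarrow> (('n::finite) cpt \<Rightarrow> complex) set" where
  "ridge_closure per R r =
     {F. \<forall>e>0. \<exists>E\<in>lincomb (ridge_exp per). \<forall>z\<in>nbhd per R r. cmod (E z - F z) < e}"

lemma ridge_closure_lincomb: "E \<in> lincomb (ridge_exp per) \<Longrightarrow> E \<in> ridge_closure per R r"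
  unfolding ridge_closure_def by (auto intro!: bexI[of _ E])

lemma ridge_closure_limit:
  assumes "\<And>e. e > 0 \<Longrightarrow> \<exists>G\<in>ridge_closure per R r. \<forall>z\<in>nbhd per R r. cmod (G z - F z) < e"
  shows "F \<in> ridge_closure per R r"
  unfolding ridge_closure_def
proof (intro CollectI allI impI)
  fix e :: real assume "e > 0"
  then have e: "e / 2 > 0" by simp
  obtain G where G: "G \<in> ridge_closure per R r" "\<forall>z\<in>nbhd per R r. cmod (G z - F z) < e / 2" using assms[OF e] by blast
  obtain E where E: "E \<in> lincomb (ridge_exp per)" "\<forall>z\<in>nbhd per R r. cmod (E z - G z) < e / 2"
    using G(1) e unfolding ridge_closure_def by blast
  have "cmod (E z - F z) < e" if "z \<in> nbhd per R r" for z
    using G(2)[rule_format, OF that] E(2)[rule_format, OF that] norm_triangle_ineq[of "E z - G z" "G z - F z"] by simp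
  then show "\<exists>E\<in>lincomb (ridge_exp per). \<forall>z\<in>nbhd per R r. cmod (E z - F z) < e"
    by (intro bexI[OF _ E(1)] ballI)
qed

lemma ridge_closure_bounded:
  assumes "F \<in> ridge_closure per R r"
  shows "\<exists>M>0. \<forall>z\<in>nbhd per R r. cmod (F z) \<le> M"
proof -
  obtain E where E: "E \<in> lincomb (ridge_exp per)" "\<forall>z\<in>nbhd per R r. cmod (E z - F z) < 1"
    using assms zero_less_one unfolding ridge_closure_def by blast
  obtain M where M: "M > 0" "\<forall>z\<in>nbhd per R r. cmod (E z) \<le> M" using lincomb_ridge_bounded[OF E(1)] by blast
  have "cmod (F z) \<le> M + 1" if "z \<in> nbhd per R r" for z
    using E(2)[rule_format, OF that] M(2)[rule_format, OF that] norm_triangle_ineq4[of "E z" "E z - F z"] by simp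
  then show ?thesis using M(1) by (intro exI[of _ "M + 1"]) auto
qed

lemma ridge_closure_add:
  assumes "F \<in> ridge_closure per R r" "G \<in> ridge_closure per R r"
  shows "(\<lambda>z. F z + G z) \<in> ridge_closure per R r"
  unfolding ridge_closure_def
proof (intro CollectI allI impI)
  fix e :: real assume "e > 0"
  then have e: "e / 2 > 0" by simp
  obtain E where E: "E \<in> lincomb (ridge_exp per)" "\<forall>z\<in>nbhd per R r. cmod (E z - F z) < e / 2"
    using assms(1) e unfolding ridge_closure_def by blast
  obtain E' where E': "E' \<in> lincomb (ridge_exp per)" "\<forall>z\<in>nbhd per R r. cmod (E' z - G z) < e / 2"
    using assms(2) e unfolding ridge_closure_def by blast
  have "cmod (E z + E' z - (F z + G z)) < e" if "z \<in> nbhd per R r" for z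
    using E(2)[rule_format, OF that] E'(2)[rule_format, OF that] norm_triangle_ineq[of "E z - F z" "E' z - G z"]
    by (simp add: algebra_simps)
  then show "\<exists>E\<in>lincomb (ridge_exp per). \<forall>z\<in>nbhd per R r. cmod (E z - (F z + G z)) < e"
    by (intro bexI[OF _ lincomb_add[OF E(1) E'(1)]] ballI)
qed

lemma ridge_closure_mult:
  assumes F: "F \<in> ridge_closure per R r" and G: "G \<in> ridge_closure per R r"
  shows "(\<lambda>z. F z * G z) \<in> ridge_closure per R r"
  unfolding ridge_closure_def
proof (intro CollectI allI impI)
  fix e :: real assume e: "e > 0"
  obtain M where M: "M > 0" "\<forall>z\<in>nbhd per R r. cmod (G z) \<le> M" using ridge_closure_bounded[OF G] by blast
  have "e / (2 * M) > 0" using e M by simp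
  then obtain E where E: "E \<in> lincomb (ridge_exp per)" "\<forall>z\<in>nbhd per R r. cmod (E z - F z) < e / (2 * M)"
    using F unfolding ridge_closure_def by blast
  \<comment> \<open>The bound \<open>N\<close> belongs to the approximant \<open>E\<close> already
    chosen, and it determines how accurate the second approximant must be.\<close>
  obtain N where N: "N > 0" "\<forall>z\<in>nbhd per R r. cmod (E z) \<le> N" using lincomb_ridge_bounded[OF E(1)] by blast
  have "e / (2 * N) > 0" using e N by simp
  then obtain E' where E': "E' \<in> lincomb (ridge_exp per)" "\<forall>z\<in>nbhd per R r. cmod (E' z - G z) < e / (2 * N)"
    using G unfolding ridge_closure_def by blast
  have "cmod (E z * E' z - F z * G z) < e" if z: "z \<in> nbhd per R r" for z
  proof -
    have "cmod (E z * (E' z - G z)) \<le> N * cmod (E' z - G z)"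
      using N(2) z by (simp add: norm_mult mult_right_mono)
    also have "\<dots> < N * (e / (2 * N))" using E'(2) z N(1) by (intro mult_strict_left_mono) auto
    finally have 1: "cmod (E z * (E' z - G z)) < e / 2" using N(1) by simp
    have "cmod ((E z - F z) * G z) \<le> cmod (E z - F z) * M"
      using M(2) z by (simp add: norm_mult mult_left_mono)
    also have "\<dots> < e / (2 * M) * M" using E(2) z M(1) by (intro mult_strict_right_mono) auto
    finally have 2: "cmod ((E z - F z) * G z) < e / 2" using M(1) by simp
    have "E z * E' z - F z * G z = E z * (E' z - G z) + (E z - F z) * G z" by (simp add: algebra_simps)
    then show ?thesis using 1 2 norm_triangle_ineq[of "E z * (E' z - G z)" "(E z - F z) * G z"] by simp
  qed
  then show "\<exists>E\<in>lincomb (ridge_exp per). \<forall>z\<in>nbhd per R r. cmod (E z - F z * G z) < e"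
    by (intro bexI[OF _ lincomb_ridge_mult[OF E(1) E'(1)]] ballI)
qed

lemma ridge_closure_const: "(\<lambda>z. c) \<in> ridge_closure per R r"
  using ridge_closure_lincomb[OF lincomb_base[OF ridge_exp_one, of c]] by simp

lemma ridge_closure_prod:
  "(\<And>i. i \<in> I \<Longrightarrow> F i \<in> ridge_closure per R r) \<Longrightarrow> (\<lambda>z. \<Prod>i\<in>I. F i z) \<in> ridge_closure per R r"
  by (induction I rule: infinite_finite_induct) (auto intro: ridge_closure_mult ridge_closure_const)

lemma ridge_closure_sum:
  "(\<And>i. i \<in> I \<Longrightarrow> F i \<in> ridge_closure per R r) \<Longrightarrow> (\<lambda>z. \<Sum>i\<in>I. F i z) \<in> ridge_closure per R r"
  by (induction I rule: infinite_finite_induct) (auto intro: ridge_closure_add ridge_closure_const)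

lemma ridge_closure_power: "F \<in> ridge_closure per R r \<Longrightarrow> (\<lambda>z. F z ^ n) \<in> ridge_closure per R r"
  by (induction n) (auto intro: ridge_closure_mult ridge_closure_const)

lemma frequency_single: "\<not> periodic_coord per j \<Longrightarrow> frequency per (\<lambda>i. if i = j then c else 0)"
  unfolding frequency_def periodic_coord_def
  by (cases j) (auto intro!: exI[of _ "\<lambda>_. 0"])

text \<open>The coordinate \<open>w\<close> is the limit of \<open>sin (\<epsilon> w) / \<epsilon>\<close>.\<close>

lemma ridge_closure_coord:
  assumes j: "\<not> periodic_coord per j" and R: "R > 0" "r > 0"
  shows "coord j \<in> ridge_closure per R r"
  unfolding ridge_closure_def
proof (intro CollectI allI impI)
  fix e :: real assume e: "e > 0"
  define \<delta> where "\<delta> = e / (R + r)"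
  have \<delta>: "\<delta> > 0" using e R by (simp add: \<delta>_def)
  have "(sin has_derivative (\<lambda>h. h)) (at (0::complex))"
    by (auto intro!: derivative_eq_intros)
  then obtain \<eta> where \<eta>: "\<eta> > 0" "\<And>w::complex. cmod w < \<eta> \<Longrightarrow> cmod (sin w - w) \<le> \<delta> * cmod w"
    unfolding has_derivative_at_alt using \<delta> by auto
  define \<epsilon> where "\<epsilon> = \<eta> / (R + r)"
  have \<epsilon>: "\<epsilon> > 0" using \<eta> R by (simp add: \<epsilon>_def)
  let ?b = "\<lambda>c (z :: 'a cpt). exp (\<i> * lin (\<lambda>i. if i = j then c else 0) z)"
  have b: "?b c \<in> ridge_exp per" for c
    unfolding ridge_exp_def using frequency_single[OF j] by blast
  let ?E = "\<lambda>z. (1 / (2 * \<i> * \<epsilon>)) * ?b \<epsilon> z + (- 1 / (2 * \<i> * \<epsilon>)) * ?b (- \<epsilon>) z"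
  have E: "?E \<in> lincomb (ridge_exp per)" by (intro lincomb_add lincomb_base b)
  have "cmod (?E z - coord j z) < e" if z: "z \<in> nbhd per R r" for z
  proof -
    let ?w = "of_real \<epsilon> * coord j z"
    have cz: "cmod (coord j z) < R + r" by (rule nbhd_cmod_bound[OF z j])
    have "?E z = sin ?w / of_real \<epsilon>"
      unfolding lin_single sin_exp_eq using \<epsilon> by (simp add: field_simps)
    then have eq: "?E z - coord j z = (sin ?w - ?w) / of_real \<epsilon>"
      using \<epsilon> by (simp add: field_simps)
    have "\<epsilon> * cmod (coord j z) < \<epsilon> * (R + r)" using cz \<epsilon> by (rule mult_strict_left_mono)
    moreover have "\<epsilon> * (R + r) = \<eta>" using R by (simp add: \<epsilon>_def)
    ultimately have "cmod ?w < \<eta>" using \<epsilon> by (simp add: norm_mult)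
    then have "cmod (sin ?w - ?w) \<le> \<delta> * cmod ?w" by (rule \<eta>(2))
    then have "cmod (?E z - coord j z) \<le> \<delta> * cmod (coord j z)"
      unfolding eq using \<epsilon> by (simp add: norm_divide norm_mult field_simps)
    also have "\<dots> < \<delta> * (R + r)" using cz \<delta> by (rule mult_strict_left_mono)
    also have "\<dots> = e" using R by (simp add: \<delta>_def)
    finally show ?thesis .
  qed
  then show "\<exists>E\<in>lincomb (ridge_exp per). \<forall>z\<in>nbhd per R r. cmod (E z - coord j z) < e"
    by (intro bexI[OF _ E] ballI)
qed

text \<open>A non-periodic coordinate takes values of modulus below \<open>R + r\<close> on the
  tube, where the Taylor series of \<open>f\<close> at 0 converges uniformly; its partial sums are
  polynomials in a coordinate that lies in the closure.\<close>

lemma ridge_closure_holomorphic: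
  assumes j: "\<not> periodic_coord per j" and R: "R > 0" "r > 0"
    and f: "f holomorphic_on ball 0 S" and S: "R + r < S"
  shows "(\<lambda>z. f (coord j z)) \<in> ridge_closure per R r"
proof (rule ridge_closure_limit)
  fix e :: real assume e: "e > 0"
  define a where "a n = (deriv ^^ n) f 0 / fact n" for n
  have sums: "(\<lambda>n. a n * w ^ n) sums f w" if "cmod w < S" for w
    using holomorphic_power_series[OF f, of w] that by (simp add: a_def)
  \<comment> \<open>A radius strictly between \<open>R + r\<close> and \<open>S\<close>: convergence
    there makes the radius of convergence strictly larger than \<open>R + r\<close>.\<close>
  define \<rho> where "\<rho> = (R + r + S) / 2"
  have \<rho>: "R + r < \<rho>" "\<rho> < S" "\<rho> > 0" using S R by (auto simp: \<rho>_def)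
  have "conv_radius a \<ge> norm (complex_of_real \<rho>)"
    by (rule conv_radius_geI, rule sums_summable, rule sums) (use \<rho> in auto)
  then have "ereal (R + r) < conv_radius a" using \<rho> by (metis abs_of_pos ereal_less(2) less_ereal.simps(1) less_le_trans norm_of_real)
  from powser_uniform_limit[OF this, of 0]
  have "uniform_limit (cball 0 (R + r)) (\<lambda>n w. \<Sum>i<n. a i * w ^ i) (\<lambda>w. \<Sum>i. a i * w ^ i) sequentially"
    by simp
  then obtain N where N: "\<forall>w\<in>cball 0 (R + r). dist (\<Sum>i<N. a i * w ^ i) (\<Sum>i. a i * w ^ i) < e"
    using e unfolding uniform_limit_iff eventually_sequentially by blast
  let ?G = "\<lambda>z. \<Sum>i<N. a i * coord j z ^ i"
  have "?G \<in> ridge_closure per R r"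
    by (intro ridge_closure_sum ridge_closure_mult ridge_closure_const ridge_closure_power ridge_closure_coord j R)
  moreover have "cmod (?G z - f (coord j z)) < e" if z: "z \<in> nbhd per R r" for z
  proof -
    have c: "cmod (coord j z) < R + r" by (rule nbhd_cmod_bound[OF z j])
    then have "(\<Sum>i. a i * coord j z ^ i) = f (coord j z)"
      using sums[of "coord j z"] S by (intro sums_unique[symmetric]) auto
    moreover have "coord j z \<in> cball 0 (R + r)" using c by simp
    ultimately show ?thesis using bspec[OF N, of "coord j z"] by (simp add: dist_norm)
  qed
  ultimately show "\<exists>G\<in>ridge_closure per R r. \<forall>z\<in>nbhd per R r. cmod (G z - f (coord j z)) < e"
    by (intro bexI[of _ ?G] ballI)
qed

section \<open>Passage to coordinates that are all periodic\<close>

lemma cmod_sin_diff_le: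
  assumes "\<bar>Im x\<bar> \<le> B" "\<bar>Im y\<bar> \<le> B"
  shows "cmod (sin x - sin y) \<le> exp B * cmod (x - y)"
proof (rule field_differentiable_bound[where f' = cos and S = "{z. \<bar>Im z\<bar> \<le> B}"])
  have eq: "{z. \<bar>Im z\<bar> \<le> B} = {z. Im z \<le> B} \<inter> {z. Im z \<ge> - B}" by auto
  show "convex {z. \<bar>Im z\<bar> \<le> B}"
    unfolding eq by (rule convex_Int[OF convex_halfspace_Im_le convex_halfspace_Im_ge])
  show "cmod (cos z) \<le> exp B" if "z \<in> {z. \<bar>Im z\<bar> \<le> B}" for z
  proof -
    have "cmod (cos z) \<le> exp \<bar>Im z\<bar>" using cmod_cos_le_exp[of 1 z] by simp
    also have "\<dots> \<le> exp B" using that by simp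
    finally show ?thesis .
  qed
qed (use assms in \<open>auto intro!: derivative_eq_intros\<close>)

lemma sin_add_int_multiple: "sin (2 * of_real pi * (w + of_int m)) = sin (2 * of_real pi * w :: complex)"
proof -
  have "exp (\<i> * (2 * of_real pi * (w + of_int m))) = exp (\<i> * (2 * of_real pi * w))"
    "exp (- (\<i> * (2 * of_real pi * (w + of_int m)))) = exp (- (\<i> * (2 * of_real pi * w)))"
    unfolding exp_eq by (rule exI[of _ m], simp add: algebra_simps, rule exI[of _ "- m"], simp add: algebra_simps)
  then show ?thesis by (simp only: sin_exp_eq)
qed

text \<open>
  The substitution \<open>w = R sin (2 \<pi> \<theta>)\<close> in the non-periodic coordinates makes a function near the
  box periodic in all coordinates.
\<close>

definition circle_coord :: "bool \<Rightarrow> real \<Rightarrow> 'n + 'n \<Rightarrow> complex \<Rightarrow> complex" where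
  "circle_coord per R j w = (if periodic_coord per j then w else of_real R * sin (2 * of_real pi * w))"

definition circle_chart :: "bool \<Rightarrow> real \<Rightarrow> complex ^ ('n + 'n) \<Rightarrow> ('n::finite) cpt" where
  "circle_chart per R \<theta> = of_coords (\<lambda>j. circle_coord per R j (\<theta> $ j))"

lemma cdiff_circle_chart: "cdiff (circle_chart per R) \<theta>"
proof -
  have "cdiff (\<lambda>\<theta>. circle_coord per R j (\<theta> $ j)) \<theta>" for j
    by (cases "periodic_coord per j") (auto simp: circle_coord_def intro!: cdiff_intros)
  then show ?thesis unfolding circle_chart_def by (intro cdiff_of_coords)
qed

text \<open>Integer translations of the angles are invisible through the sines and act as lattice
  translations on the periodic coordinates. Hence a lattice-periodic function pulls back to one that
  is periodic in every variable.\<close>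

lemma circle_chart_shift:
  fixes k :: "int ^ ('n::finite + 'n)"
  obtains l :: "int ^ 'n" where "l \<in> lattice per" "\<And>\<theta>. circle_chart per R (\<theta> + int_vec k) = circle_chart per R \<theta> + shift l"
proof
  let ?l = "(\<chi> i. if per then k $ Inl i else 0) :: int ^ 'n"
  show "?l \<in> lattice per" by (auto simp: lattice_def vec_eq_iff)
  show "circle_chart per R (\<theta> + int_vec k) = circle_chart per R \<theta> + shift ?l" for \<theta>
  proof (rule coord_eqI)
    show "coord j (circle_chart per R (\<theta> + int_vec k)) = coord j (circle_chart per R \<theta> + shift ?l)" for j
      by (cases j) (auto simp: circle_chart_def circle_coord_def periodic_coord_def int_vec_def shift_def
          sin_add_int_multiple, simp_all add: coord_def)
  qed
qed

text \<open>Real angles are mapped into the box modulo the lattice, and a complex angle is compared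
  with its real part. The condition \<open>R \<ge> 1\<close> lets the fractional parts of the
  periodic coordinates fit into the box.\<close>

lemma circle_chart_in_nbhd:
  assumes R: "R \<ge> 1" and r: "r > 0"
  shows "\<exists>s>0. \<forall>\<theta>\<in>strip s. circle_chart per R \<theta> \<in> (nbhd per R r :: ('n::finite) cpt set)"
proof -
  \<comment> \<open>A Lipschitz constant of \<open>R sin (2 pi w)\<close> for imaginary parts up to
    1. The error of a periodic coordinate is below \<open>s\<close> itself, and \<open>C + 1\<close>
    covers both kinds of coordinates.\<close>
  define C where "C = R * (exp (2 * pi) * (2 * pi))"
  define s where "s = min 1 (r / (2 * real CARD('n + 'n) * (C + 1)))"
  have C: "C > 0" using R by (simp add: C_def)
  have s: "s > 0" "s \<le> 1" using r C by (auto simp: s_def zero_less_mult_iff)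
  have sC: "real CARD('n + 'n) * ((C + 1) * s) < r"
  proof -
    have "(real CARD('n + 'n) * (C + 1)) * s \<le> (real CARD('n + 'n) * (C + 1)) * (r / (2 * real CARD('n + 'n) * (C + 1)))"
      using C by (intro mult_left_mono) (auto simp: s_def)
    also have "\<dots> = r / 2"
    proof -
      have eq: "c * d * (r / (2 * c * d)) = r / 2" if "c \<noteq> 0" "d \<noteq> 0" for c d :: real using that by simp
      show ?thesis by (rule eq) (use C in auto)
    qed
    also have "\<dots> < r" using r by simp
    finally show ?thesis by (simp add: mult.assoc)
  qed
  have "circle_chart per R \<theta> \<in> (nbhd per R r :: 'n cpt set)" if \<theta>: "\<theta> \<in> strip s" for \<theta>
  proof -
    define x :: "'n rpt" where "x = of_coords (\<lambda>j. if periodic_coord per j then frac (Re (\<theta> $ j)) else R * sin (2 * pi * Re (\<theta> $ j)))"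
    define k :: "int ^ 'n" where "k = (\<chi> i. if per then \<lfloor>Re (\<theta> $ Inl i)\<rfloor> else 0)"
    have k: "k \<in> lattice per" by (auto simp: k_def lattice_def vec_eq_iff)
    have x: "x \<in> phase_box R"
      unfolding phase_box_def
    proof (intro CollectI allI)
      fix j
      have "\<bar>frac (Re (\<theta> $ j))\<bar> \<le> R" using R frac_lt_1[of "Re (\<theta> $ j)"] by simp
      moreover have "\<bar>R * sin (2 * pi * Re (\<theta> $ j))\<bar> \<le> R * 1"
        unfolding abs_mult using R by (intro mult_mono) auto
      ultimately show "\<bar>coord j x\<bar> \<le> R" by (simp add: x_def)
    qed
    have "cmod (coord j (circle_chart per R \<theta> - (cv x + shift k))) \<le> (C + 1) * s" for j
    proof -
      have im: "\<bar>Im (\<theta> $ j)\<bar> < s" using \<theta> by (simp add: strip_def)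
      show ?thesis
      proof (cases "periodic_coord per j")
        case True
        then obtain i where i: "j = Inl i" "per" by (cases j) (auto simp: periodic_coord_def)
        have "coord j (shift k) = complex_of_int \<lfloor>Re (\<theta> $ j)\<rfloor>"
          using i by (simp add: coord_def shift_def int_vec_def k_def)
        then have "coord j (circle_chart per R \<theta> - (cv x + shift k)) = \<i> * of_real (Im (\<theta> $ j))"
          using True by (simp add: circle_chart_def circle_coord_def x_def complex_eq_iff frac_def)
        then have "cmod (coord j (circle_chart per R \<theta> - (cv x + shift k))) < s" using im by (simp add: norm_mult)
        also have "s \<le> (C + 1) * s" using C s by simp
        finally show ?thesis by simp
      next
        case False
        let ?a = "2 * of_real pi * \<theta> $ j" and ?b = "of_real (2 * pi * Re (\<theta> $ j)) :: complex"
        have "coord j (circle_chart per R \<theta> - (cv x + shift k)) = of_real R * (sin ?a - sin ?b)"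
          unfolding sin_of_real using False
          by (simp add: circle_chart_def circle_coord_def x_def coord_shift[OF k False] right_diff_distrib)
        then have "cmod (coord j (circle_chart per R \<theta> - (cv x + shift k))) = R * cmod (sin ?a - sin ?b)"
          using R by (simp add: norm_mult)
        also have "\<dots> \<le> R * (exp (2 * pi) * cmod (?a - ?b))"
          using R im s by (intro mult_left_mono cmod_sin_diff_le) (auto simp: abs_mult)
        also have "?a - ?b = 2 * of_real pi * (\<i> * of_real (Im (\<theta> $ j)))" by (simp add: complex_eq_iff)
        also have "R * (exp (2 * pi) * cmod (2 * of_real pi * (\<i> * of_real (Im (\<theta> $ j))))) = C * \<bar>Im (\<theta> $ j)\<bar>"
          by (simp add: C_def norm_mult)
        also have "\<dots> \<le> (C + 1) * s" using im C by (intro mult_mono) auto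
        finally show ?thesis .
      qed
    qed
    then have "norm (circle_chart per R \<theta> - (cv x + shift k)) \<le> real CARD('n + 'n) * ((C + 1) * s)"
      by (rule norm_le_card_coord)
    then show ?thesis using x k sC unfolding nbhd_def dist_norm by (blast intro: le_less_trans)
  qed
  then show ?thesis using s by blast
qed

text \<open>A right inverse of \<open>circle_chart\<close> through the principal branch of
  \<open>Arcsin\<close>, which is singular at the edge of the box. It is therefore used with
  parameter \<open>R + 1\<close> on a tube around the box of size \<open>R\<close>; this is where
  approximation loses one unit of box size.\<close>

definition circle_inv :: "bool \<Rightarrow> real \<Rightarrow> ('n::finite) cpt \<Rightarrow> complex ^ ('n + 'n)" where
  "circle_inv per R z = (\<chi> j. if periodic_coord per j then coord j z else Arcsin (coord j z / of_real R) / (2 * of_real pi))"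

lemma circle_chart_inv: "R \<noteq> 0 \<Longrightarrow> circle_chart per R (circle_inv per R z) = z"
  by (rule coord_eqI) (simp add: circle_chart_def circle_inv_def circle_coord_def)

lemma Arcsin_holomorphic_ball: "Arcsin holomorphic_on ball 0 1"
proof (rule holomorphic_on_Arcsin)
  fix z :: complex assume "z \<in> ball 0 1"
  then show "\<bar>Re z\<bar> < 1" using abs_Re_le_cmod[of z] by simp
qed

text \<open>Real points of the box are divided by \<open>R + 1\<close> and so land in a compact
  interval inside \<open>(-1, 1)\<close>, on which \<open>Arcsin\<close> is real. By compactness its
  imaginary part is small on a uniform neighborhood of the interval.\<close>

lemma circle_inv_in_strip:
  assumes R: "R > 0" and s: "s > 0"
  shows "\<exists>r>0. r < 1 \<and> (\<forall>z \<in> (nbhd per R r :: ('n::finite) cpt set). circle_inv per (R + 1) z \<in> strip s)"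
proof -
  note hol = Arcsin_holomorphic_ball
  have cont: "continuous_on (ball 0 1) (\<lambda>w. Im (Arcsin w))"
    by (intro continuous_intros holomorphic_on_imp_continuous_on[OF hol])
  define \<rho> where "\<rho> = R / (R + 1)"
  have \<rho>: "\<rho> < 1" "\<rho> > 0" using R by (auto simp: \<rho>_def)
  define U where "U = ball 0 1 \<inter> (\<lambda>w. Im (Arcsin w)) -` {- (2 * pi * s)<..<2 * pi * s}"
  have opU: "open U" unfolding U_def
    by (rule continuous_open_preimage[OF cont]) auto
  have sub: "complex_of_real ` {-\<rho>..\<rho>} \<subseteq> U"
  proof
    fix w assume "w \<in> complex_of_real ` {-\<rho>..\<rho>}"
    then obtain t where t: "w = of_real t" "\<bar>t\<bar> \<le> \<rho>" by auto
    have "Arcsin w = of_real (arcsin t)" using t \<rho> by (simp add: of_real_arcsin)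
    then show "w \<in> U" using t \<rho> s by (simp add: U_def)
  qed
  obtain \<epsilon> where \<epsilon>: "\<epsilon> > 0" "(\<Union>x\<in>complex_of_real ` {-\<rho>..\<rho>}. ball x \<epsilon>) \<subseteq> U"
    by (rule compact_subset_open_imp_ball_epsilon_subset[OF _ opU sub])
       (auto intro!: compact_continuous_image continuous_intros)
  define r where "r = min (1/2) (min s \<epsilon>)"
  have r: "r > 0" "r < 1" using s \<epsilon> by (auto simp: r_def)
  have "circle_inv per (R + 1) z \<in> strip s" if z: "z \<in> nbhd per R r" for z :: "'n cpt"
    unfolding strip_def
  proof (intro CollectI allI)
    fix j
    show "\<bar>Im (circle_inv per (R + 1) z $ j)\<bar> < s"
    proof (cases "periodic_coord per j")
      case True
      then show ?thesis using nbhd_Im_bound[OF z, of j] by (simp add: circle_inv_def r_def)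
    next
      case False
      then obtain x where x: "\<bar>x\<bar> \<le> R" "cmod (coord j z - of_real x) < r"
        using nbhd_coord_bound[OF z] by blast
      let ?w = "coord j z / of_real (R + 1)"
      have "cmod (?w - of_real (x / (R + 1))) = cmod (coord j z - of_real x) / (R + 1)"
        using R by (simp add: diff_divide_distrib[symmetric] norm_divide del: of_real_add)
      also have "\<dots> \<le> cmod (coord j z - of_real x)" using R by (simp add: field_simps)
      also have "\<dots> < \<epsilon>" using x by (simp add: r_def)
      finally have "?w \<in> ball (of_real (x / (R + 1))) \<epsilon>" by (simp add: dist_norm norm_minus_commute)
      moreover have "\<bar>x / (R + 1)\<bar> \<le> \<rho>" using x R by (simp add: \<rho>_def abs_divide divide_right_mono)
      then have "x / (R + 1) \<in> {-\<rho>..\<rho>}" unfolding abs_le_iff by auto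
      ultimately have "?w \<in> U" using \<epsilon>(2) by blast
      then have "\<bar>Im (Arcsin ?w)\<bar> < 2 * pi * s" by (auto simp: U_def abs_less_iff)
      moreover have "Im (circle_inv per (R + 1) z $ j) = Im (Arcsin ?w / of_real (2 * pi))"
        using False by (simp add: circle_inv_def)
      ultimately show ?thesis by (simp only: Im_divide_of_real) (simp add: field_simps)
    qed
  qed
  then show ?thesis using r by blast
qed

text \<open>A character is a product of functions of single coordinates. A periodic coordinate
  contributes a ridge exponential, any other one a function holomorphic on the disc of radius
  \<open>R + 1\<close>, which exceeds \<open>R + r\<close> since \<open>r < 1\<close>.\<close>

lemma chr_circle_inv_closure:
  assumes R: "R > 0" and r: "r > 0" "r < 1"
  shows "(\<lambda>z. chr k (circle_inv per (R + 1) z)) \<in> (ridge_closure per R r :: (('n::finite) cpt \<Rightarrow> complex) set)"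
proof -
  have "(\<lambda>z. \<Prod>j\<in>UNIV. exp (2 * of_real pi * \<i> * of_int (k j) * circle_inv per (R + 1) z $ j))
      \<in> (ridge_closure per R r :: ('n cpt \<Rightarrow> complex) set)"
  proof (rule ridge_closure_prod)
    fix j :: "'n + 'n"
    show "(\<lambda>z. exp (2 * of_real pi * \<i> * of_int (k j) * circle_inv per (R + 1) z $ j))
      \<in> (ridge_closure per R r :: ('n cpt \<Rightarrow> complex) set)"
    proof (cases "periodic_coord per j")
      case True
      let ?a = "\<lambda>i. if i = j then 2 * pi * of_int (k j) else 0"
      have f: "frequency per ?a"
        unfolding frequency_def by (intro impI exI[of _ "\<lambda>i. if Inl i = j then k j else 0"]) auto
      have "(\<lambda>z. 1 * exp (\<i> * lin ?a z)) \<in> (lincomb (ridge_exp per) :: ('n cpt \<Rightarrow> complex) set)"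
        by (rule lincomb_base) (use f in \<open>auto simp: ridge_exp_def\<close>)
      then show ?thesis using ridge_closure_lincomb True
        by (simp add: circle_inv_def lin_single mult_ac)
    next
      case False
      let ?f = "\<lambda>w. exp (\<i> * of_int (k j) * Arcsin (w / of_real (R + 1)))"
      have "(Arcsin \<circ> (\<lambda>w. w / of_real (R + 1))) holomorphic_on ball 0 (R + 1)"
      proof (rule holomorphic_on_compose_gen)
        show "(\<lambda>w. w / of_real (R + 1)) holomorphic_on ball 0 (R + 1)"
          using R by (intro holomorphic_intros) auto
        show "Arcsin holomorphic_on ball 0 1" by (rule Arcsin_holomorphic_ball)
        show "(\<lambda>w. w / of_real (R + 1) :: complex) ` ball 0 (R + 1) \<subseteq> ball 0 1"
          using R by (auto simp: dist_norm norm_divide simp del: of_real_add)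
      qed
      then have "?f holomorphic_on ball 0 (R + 1)" unfolding o_def by (intro holomorphic_intros)
      then have "(\<lambda>z. ?f (coord j z)) \<in> (ridge_closure per R r :: ('n cpt \<Rightarrow> complex) set)"
        by (rule ridge_closure_holomorphic[OF False R r(1)]) (use r in simp)
      then show ?thesis using False by (simp add: circle_inv_def mult_ac)
    qed
  qed
  then show ?thesis unfolding chr_def by (simp add: exp_sum)
qed

text \<open>Pull back by the chart, approximate by trigonometric polynomials, substitute the inverse
  chart. The radius \<open>r'\<close> comes only from the chart and its inverse, which explains why
  it is quantified before \<open>H\<close> and \<open>e\<close>.\<close>

theorem ridge_approx:
  assumes R: "R > 0" and r: "r > 0"
  shows "\<exists>r'>0. \<forall>H. cholomorphic_on H (nbhd per (R + 1) r :: ('n::finite) cpt set) \<longrightarrow>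
     (\<forall>z\<in>nbhd per (R + 1) r. \<forall>k\<in>lattice per. H (z + shift k) = H z) \<longrightarrow>
     (\<forall>e>0. \<exists>E\<in>lincomb (ridge_exp per). \<forall>z\<in>nbhd per R r'. cmod (E z - H z) < e)"
proof -
  obtain s where s: "s > 0" "\<And>\<theta>. \<theta> \<in> strip s \<Longrightarrow> circle_chart per (R + 1) (\<theta> :: complex ^ ('n + 'n)) \<in> nbhd per (R + 1) r"
    using circle_chart_in_nbhd[of "R + 1" r] R r by (metis add_increasing less_imp_le order_refl)
  obtain r' where r': "r' > 0" "r' < 1"
    "\<And>z. z \<in> nbhd per R r' \<Longrightarrow> circle_inv per (R + 1) (z :: 'n cpt) \<in> strip (s / 2)"
    using circle_inv_in_strip[OF R half_gt_zero[OF s(1)], of per] by blast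
  show ?thesis
  proof (intro exI[of _ r'] conjI allI impI r'(1))
    fix H :: "'n cpt \<Rightarrow> complex" and e :: real
    assume H: "cholomorphic_on H (nbhd per (R + 1) r)"
      and p: "\<forall>z\<in>nbhd per (R + 1) r. \<forall>k\<in>lattice per. H (z + shift k) = H z" and e: "e > 0"
    define g where "g \<theta> = H (circle_chart per (R + 1) \<theta>)" for \<theta> :: "complex ^ ('n + 'n)"
    have g: "cholomorphic_on g (strip s)"
      unfolding cholomorphic_on_cdiff
    proof
      fix \<theta> :: "complex ^ ('n + 'n)" assume "\<theta> \<in> strip s"
      then have "cdiff H (circle_chart per (R + 1) \<theta>)" using s(2) H by (auto simp: cholomorphic_on_cdiff)
      then show "cdiff g \<theta>" unfolding g_def by (rule cdiff_compose[OF _ cdiff_circle_chart])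
    qed
    have gp: "g (\<theta> + int_vec k) = g \<theta>" if \<theta>: "\<theta> \<in> strip s" for \<theta> :: "complex ^ ('n + 'n)" and k
    proof -
      obtain l :: "int ^ 'n" where "l \<in> lattice per" "circle_chart per (R + 1) (\<theta> + int_vec k) = circle_chart per (R + 1) \<theta> + shift l"
        using circle_chart_shift[where k = k and per = per and R = "R + 1"] by metis
      then show ?thesis using p s(2)[OF \<theta>] by (simp add: g_def)
    qed
    have "H \<in> ridge_closure per R r'"
    proof (rule ridge_closure_limit)
      fix e :: real assume "e > 0"
      then obtain T where T: "T \<in> lincomb (range chr)" "\<And>\<theta>. \<theta> \<in> strip (s/2) \<Longrightarrow> cmod (T \<theta> - g \<theta>) < e"
        using periodic_approx[OF s(1) g gp] by blast
      have "(\<lambda>z. T (circle_inv per (R + 1) z)) \<in> (ridge_closure per R r' :: ('n cpt \<Rightarrow> complex) set)"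
        using T(1)
      proof induction
        case lincomb_zero
        show ?case by (rule ridge_closure_const)
      next
        case (lincomb_step E b c)
        then obtain k where b: "b = chr k" by auto
        show ?case unfolding b
          by (intro ridge_closure_add ridge_closure_mult lincomb_step.IH ridge_closure_const chr_circle_inv_closure R r')
      qed
      moreover have "cmod (T (circle_inv per (R + 1) z) - H z) < e" if z: "z \<in> nbhd per R r'" for z
        using T(2)[OF r'(3)[OF z]] R by (simp add: g_def circle_chart_inv)
      ultimately show "\<exists>G\<in>ridge_closure per R r'. \<forall>z\<in>nbhd per R r'. cmod (G z - H z) < e"
        by (intro bexI[of _ "\<lambda>z. T (circle_inv per (R + 1) z)"] ballI)
    qed
    then show "\<exists>E\<in>lincomb (ridge_exp per). \<forall>z\<in>nbhd per R r'. cmod (E z - H z) < e"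
      using e unfolding ridge_closure_def by blast
  qed
qed

section \<open>Real ridge sums\<close>

definition conjv :: "('n::finite) cpt \<Rightarrow> 'n cpt" where
  "conjv z = of_coords (\<lambda>j. cnj (coord j z))"

lemma coord_conjv [simp]: "coord j (conjv z) = cnj (coord j z)"
  by (simp add: conjv_def)

lemma norm_conjv [simp]: "norm (conjv z) = norm z"
  by (simp add: conjv_def of_coords_def coord_def norm_prod_def norm_vec_def)

lemma conjv_cv [simp]: "conjv (cv x) = cv x"
  by (rule coord_eqI) simp

lemma conjv_simps: "conjv (z + w) = conjv z + conjv w" "conjv (z - w) = conjv z - conjv w"
  "conjv (c *\<^sub>C z) = cnj c *\<^sub>C conjv z"
  by (rule coord_eqI, simp)+

lemma lin_conjv: "lin a (conjv z) = cnj (lin a z)"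
  by (simp add: lin_def)

lemma cpt_decompose: obtains x y where "z = cv x + \<i> *\<^sub>C cv y"
proof
  show "z = cv (of_coords (\<lambda>j. Re (coord j z))) + \<i> *\<^sub>C cv (of_coords (\<lambda>j. Im (coord j z)))"
    by (rule coord_eqI) (simp add: complex_eq_iff)
qed

text \<open>Schwarz reflection on the complex line through \<open>z\<close> and its conjugate:
  \<open>\<psi> w\<close> and the conjugate of \<open>\<psi>\<close> at the conjugate of
  \<open>w\<close> are holomorphic and agree at real \<open>w\<close>, hence also at
  \<open>w = i\<close>.\<close>

lemma reflection_principle:
  assumes H: "cholomorphic_on H (nbhd per R r)"
    and real: "\<And>x. cv x \<in> nbhd per R r \<Longrightarrow> H (cv x) \<in> \<real>"
    and z: "z \<in> nbhd per R r"
  shows "H (conjv z) = cnj (H z)"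
proof -
  obtain x0 k where x0: "x0 \<in> phase_box R" "k \<in> lattice per" "dist z (cv x0 + shift k) < r"
    using z by (auto simp: nbhd_def)
  define p where "p = x0 + shift k"
  have cvp: "cv p = cv x0 + shift k" by (simp add: p_def cv_simps cv_shift)
  have sub: "ball (cv p) r \<subseteq> nbhd per R r"
  proof
    fix w assume "w \<in> ball (cv p) r"
    then have "dist w (cv x0 + shift k) < r" by (simp add: cvp dist_commute)
    then show "w \<in> nbhd per R r" using x0(1,2) unfolding nbhd_def by blast
  qed
  obtain x y where zxy: "z = cv x + \<i> *\<^sub>C cv y" by (rule cpt_decompose)
  have cz: "conjv z = cv x - \<i> *\<^sub>C cv y"
    by (rule coord_eqI) (simp add: zxy)
  \<comment> \<open>Convex as an affine preimage of a ball, and symmetric under conjugation because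
    the ball has a real centre. It contains \<open>i\<close>, hence \<open>-i\<close> and their
    midpoint 0, and so a real interval around 0.\<close>
  define U where "U = (\<lambda>w. cv x + w *\<^sub>C cv y) -` ball (cv p) r"
  have aff: "continuous_on UNIV (\<lambda>w. cv x + w *\<^sub>C cv y)"
    by (intro continuous_intros linear_continuous_on bounded_linear_scaleC_left)
  have opU: "open U" unfolding U_def using aff by (intro open_vimage) auto
  have cvU: "convex U"
  proof -
    have "U = (\<lambda>w. w *\<^sub>C cv y) -` ((+) (- cv x) ` ball (cv p) r)"
      by (force simp: U_def image_iff algebra_simps)
    moreover have "linear (\<lambda>w. w *\<^sub>C cv y)"
      using bounded_linear_scaleC_left bounded_linear.linear by blast
    ultimately show ?thesis using convex_linear_vimage convex_translation convex_ball by metis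
  qed
  have symU: "cnj w \<in> U" if "w \<in> U" for w
  proof -
    have "cv x + cnj w *\<^sub>C cv y - cv p = conjv (cv x + w *\<^sub>C cv y - cv p)"
      by (rule coord_eqI) simp
    then have "norm (cv x + cnj w *\<^sub>C cv y - cv p) = norm (cv x + w *\<^sub>C cv y - cv p)" by (simp only: norm_conjv)
    then show ?thesis using that by (simp add: U_def dist_norm norm_minus_commute)
  qed
  have i: "\<i> \<in> U" using x0(3) by (simp add: U_def zxy[symmetric] cvp dist_commute)
  have 0: "0 \<in> U"
  proof -
    have "(1/2) *\<^sub>R \<i> + (1/2) *\<^sub>R cnj \<i> \<in> U"
      by (rule convexD[OF cvU i symU[OF i]]) auto
    then show ?thesis by simp
  qed
  define \<psi> where "\<psi> w = H (cv x + w *\<^sub>C cv y)" for w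
  have hol: "\<psi> holomorphic_on U"
    unfolding \<psi>_def by (rule holomorphic_on_line[OF H]) (use sub in \<open>auto simp: U_def\<close>)
  have cU: "cnj ` U = U" 
  proof
    show "cnj ` U \<subseteq> U" using symU by blast
    show "U \<subseteq> cnj ` U"
    proof
      fix w assume "w \<in> U"
      then show "w \<in> cnj ` U" using symU by (intro image_eqI[of _ _ "cnj w"]) simp_all
    qed
  qed
  have hol': "(\<lambda>w. cnj (\<psi> (cnj w))) holomorphic_on U"
    using holomorphic_on_compose_cnj_cnj[of \<psi> U] hol opU cU by (simp add: o_def)
  obtain e where e: "e > 0" "ball 0 e \<subseteq> U" using opU 0 by (meson open_contains_ball)
  have "\<psi> \<i> - cnj (\<psi> (cnj \<i>)) = 0"
  proof (rule analytic_continuation[where f = "\<lambda>w. \<psi> w - cnj (\<psi> (cnj w))" and S = U and U = "of_real ` {-e<..<e}" and \<xi> = 0 and w = \<i>])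
    show "(\<lambda>w. \<psi> w - cnj (\<psi> (cnj w))) holomorphic_on U" by (intro holomorphic_intros hol hol')
    show "of_real ` {-e<..<e} \<subseteq> U"
    proof
      fix w assume "w \<in> complex_of_real ` {-e<..<e}"
      then have "w \<in> ball 0 e" by (auto simp: abs_less_iff)
      then show "w \<in> U" using e(2) by blast
    qed
    show "0 islimpt complex_of_real ` {-e<..<e}"
      unfolding islimpt_approachable
    proof (intro allI impI)
      fix d :: real assume "d > 0"
      then show "\<exists>x'\<in>complex_of_real ` {-e<..<e}. x' \<noteq> 0 \<and> dist x' 0 < d"
        using e(1) by (intro bexI[of _ "of_real (min d e / 2)"] imageI) (auto simp: min_def)
    qed
    show "\<psi> w - cnj (\<psi> (cnj w)) = 0" if w: "w \<in> of_real ` {-e<..<e}" for w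
    proof -
      obtain t where t: "w = of_real t" "w \<in> ball 0 e" using w by (auto simp: abs_less_iff)
      then have "w \<in> U" using e(2) by blast
      have eq: "cv x + w *\<^sub>C cv y = cv (x + t *\<^sub>R y)" by (simp add: t scaleC_of_real cv_simps)
      have "H (cv (x + t *\<^sub>R y)) \<in> \<real>"
        by (rule real) (use \<open>w \<in> U\<close> sub eq in \<open>auto simp: U_def\<close>)
      then have "\<psi> w \<in> \<real>" by (simp add: \<psi>_def eq)
      then show ?thesis by (simp add: t(1) Reals_cnj_iff)
    qed
  qed (use opU cvU convex_connected i 0 in auto)
  then have "\<psi> \<i> = cnj (\<psi> (- \<i>))" by simp
  moreover have "conjv z = cv x + (- \<i>) *\<^sub>C cv y" by (rule coord_eqI) (simp add: zxy)
  ultimately show ?thesis unfolding zxy[symmetric] \<psi>_def by (metis complex_cnj_cnj zxy)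
qed

text \<open>A list of triples amplitude, phase, frequency vector. The order is irrelevant for the
  sum, but the flows of the terms are later composed in the order of the list.\<close>

definition ridge_sum :: "(real \<times> real \<times> ('n + 'n \<Rightarrow> real)) list \<Rightarrow> ('n::finite) cpt \<Rightarrow> complex" where
  "ridge_sum L z = (\<Sum>(c, \<phi>, a)\<leftarrow>L. of_real c * cos (lin a z + of_real \<phi>))"

text \<open>Averaging with the reflected function makes each term real on real points: a coefficient
  \<open>c\<close> turns the exponential into \<open>cmod c\<close> times a cosine with phase
  \<open>Arg c\<close>.\<close>

lemma lincomb_symmetrize:
  assumes "E \<in> lincomb (ridge_exp per)"
  shows "\<exists>L. (\<forall>(c, \<phi>, a)\<in>set L. frequency per a) \<and> (\<forall>z. (E z + cnj (E (conjv z))) / 2 = ridge_sum L z)"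
  using assms
proof induction
  case lincomb_zero
  show ?case by (rule exI[of _ "[]"]) (simp add: ridge_sum_def)
next
  case (lincomb_step E b c)
  then obtain L a where L: "\<forall>(c, \<phi>, a)\<in>set L. frequency per a" "\<And>z. (E z + cnj (E (conjv z))) / 2 = ridge_sum L z"
    and a: "b = (\<lambda>z. exp (\<i> * lin a z))" "frequency per a" by (auto simp: ridge_exp_def)
  have "(c * b z + cnj (c * b (conjv z))) / 2 = of_real (cmod c) * cos (lin a z + of_real (Arg c))" for z
  proof (cases "c = 0")
    case False
    have c: "c = of_real (cmod c) * exp (\<i> * of_real (Arg c))"
      using rcis_cmod_Arg[of c] by (simp add: rcis_def cis_conv_exp)
    have cc: "cnj c = of_real (cmod c) * exp (- (\<i> * of_real (Arg c)))"
      by (subst c) (simp add: exp_cnj)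
    have "cnj (b (conjv z)) = exp (- (\<i> * lin a z))"
      by (simp add: a lin_conjv exp_cnj)
    then have "c * b z + cnj (c * b (conjv z)) = of_real (cmod c) * exp (\<i> * of_real (Arg c)) * exp (\<i> * lin a z)
       + of_real (cmod c) * exp (- (\<i> * of_real (Arg c))) * exp (- (\<i> * lin a z))"
      using c cc by (simp add: a(1))
    also have "\<dots> = of_real (cmod c) * (exp (\<i> * (lin a z + of_real (Arg c))) + exp (- (\<i> * (lin a z + of_real (Arg c)))))"
      by (simp add: exp_add[symmetric] distrib_left distrib_right mult.assoc add_ac)
    finally show ?thesis by (simp add: cos_exp_eq)
  qed simp
  then have "(E z + c * b z + cnj (E (conjv z) + c * b (conjv z))) / 2 = ridge_sum ((cmod c, Arg c, a) # L) z" for z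
  proof -
    have "(E z + c * b z + cnj (E (conjv z) + c * b (conjv z))) / 2 =
        (c * b z + cnj (c * b (conjv z))) / 2 + (E z + cnj (E (conjv z))) / 2"
      by (simp add: add_divide_distrib)
    also have "\<dots> = of_real (cmod c) * cos (lin a z + of_real (Arg c)) + ridge_sum L z"
      by (simp only: L(2) \<open>(c * b z + cnj (c * b (conjv z))) / 2 = _\<close>)
    finally show ?thesis by (simp add: ridge_sum_def)
  qed
  then show ?case using L(1) a(2) by (intro exI[of _ "(cmod c, Arg c, a) # L"]) auto
qed

text \<open>A Hamiltonian that is real on real points equals its own reflection, so averaging an
  approximant with its reflection keeps the error below \<open>e\<close>. The conjugation maps the
  tube to itself.\<close>

theorem ridge_sum_approx:
  assumes R: "R > 0" and r: "r > 0"
  shows "\<exists>r'>0. r' \<le> r \<and> (\<forall>H. cholomorphic_on H (nbhd per (R + 1) r :: ('n::finite) cpt set) \<longrightarrow>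
     (\<forall>z\<in>nbhd per (R + 1) r. \<forall>k\<in>lattice per. H (z + shift k) = H z) \<longrightarrow>
     (\<forall>x. cv x \<in> nbhd per (R + 1) r \<longrightarrow> H (cv x) \<in> \<real>) \<longrightarrow>
     (\<forall>e>0. \<exists>L. (\<forall>(c, \<phi>, a)\<in>set L. frequency per a) \<and> (\<forall>z\<in>nbhd per R r'. cmod (ridge_sum L z - H z) < e)))"
proof -
  from ridge_approx[OF R r, of per] obtain r0 where r0: "r0 > 0" and approx: "\<forall>H. cholomorphic_on H (nbhd per (R + 1) r :: ('n::finite) cpt set) \<longrightarrow>
     (\<forall>z\<in>nbhd per (R + 1) r. \<forall>k\<in>lattice per. H (z + shift k) = H z) \<longrightarrow>
     (\<forall>e>0. \<exists>E\<in>lincomb (ridge_exp per). \<forall>z\<in>nbhd per R r0. cmod (E z - H z) < e)"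
    by (elim exE conjE) (rule that)
  define r' where "r' = min r r0"
  show ?thesis
  proof (intro exI[of _ r'] conjI allI impI)
    show "r' > 0" "r' \<le> r" using r r0 by (auto simp: r'_def)
    fix H :: "'n cpt \<Rightarrow> complex" and e :: real
    assume H: "cholomorphic_on H (nbhd per (R + 1) r)"
      and p: "\<forall>z\<in>nbhd per (R + 1) r. \<forall>k\<in>lattice per. H (z + shift k) = H z"
      and real: "\<forall>x. cv x \<in> nbhd per (R + 1) r \<longrightarrow> H (cv x) \<in> \<real>" and e: "e > 0"
    obtain E where E: "E \<in> lincomb (ridge_exp per)" "\<And>z. z \<in> nbhd per R r0 \<Longrightarrow> cmod (E z - H z) < e"
      using approx[THEN spec, THEN mp, OF H, THEN mp, OF p] e by blast
    obtain L where L: "\<forall>(c, \<phi>, a)\<in>set L. frequency per a" "\<And>z. (E z + cnj (E (conjv z))) / 2 = ridge_sum L z"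
      using lincomb_symmetrize[OF E(1)] by blast
    have "cmod (ridge_sum L z - H z) < e" if z: "z \<in> nbhd per R r'" for z
    proof -
      have z0: "z \<in> nbhd per R r0" "z \<in> nbhd per (R + 1) r"
        using z nbhd_mono[of R R r' r0] nbhd_mono[of R "R + 1" r' r] by (auto simp: r'_def)
      have cz0: "conjv z \<in> nbhd per R r0"
      proof -
        obtain x k where x: "x \<in> phase_box R" "k \<in> lattice per" "dist z (cv x + shift k) < r0"
          using z0(1) by (auto simp: nbhd_def)
        have "conjv z - (cv x + shift k) = conjv (z - (cv x + cv (shift k)))" by (simp add: conjv_simps cv_shift[symmetric])
        then have "dist (conjv z) (cv x + shift k) = dist z (cv x + shift k)" by (simp add: dist_norm cv_shift)
        then show ?thesis using x by (intro nbhdI[of x R k]) simp_all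
      qed
      have "ridge_sum L z - H z = ((E z - H z) + cnj (E (conjv z) - H (conjv z))) / 2"
        using reflection_principle[OF H _ z0(2)] real by (simp add: L(2)[symmetric] field_simps)
      then have "cmod (ridge_sum L z - H z) = cmod ((E z - H z) + cnj (E (conjv z) - H (conjv z))) / 2"
        by (simp only: norm_divide norm_numeral)
      also have "\<dots> \<le> (cmod (E z - H z) + cmod (cnj (E (conjv z) - H (conjv z)))) / 2"
        by (intro divide_right_mono norm_triangle_ineq) simp
      also have "\<dots> < e" using E(2)[OF z0(1)] E(2)[OF cz0] by (simp only: complex_mod_cnj) simp
      finally show ?thesis .
    qed
    then show "\<exists>L. (\<forall>(c, \<phi>, a)\<in>set L. frequency per a) \<and> (\<forall>z\<in>nbhd per R r'. cmod (ridge_sum L z - H z) < e)"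
      using L(1) by blast
  qed
qed

section \<open>Convergence of one-step schemes\<close>

lemma norm_diff_le_interval:
  fixes g :: "real \<Rightarrow> 'a::real_normed_vector"
  assumes "a \<le> b" "\<And>t. t \<in> {a..b} \<Longrightarrow> (g has_vector_derivative g' t) (at t within {a..b})"
    and "\<And>t. t \<in> {a..b} \<Longrightarrow> norm (g' t) \<le> B"
  shows "norm (g b - g a) \<le> B * (b - a)"
proof -
  have "norm (g b - g a) \<le> B * norm (b - a)"
  proof (rule differentiable_bound[of "{a..b}" g "\<lambda>t h. h *\<^sub>R g' t"])
    fix t assume t: "t \<in> {a..b}"
    show "onorm (\<lambda>h. h *\<^sub>R g' t) \<le> B"
    proof (rule onorm_bound)
      show "0 \<le> B" using assms(3)[OF t] norm_ge_zero[of "g' t"] by linarith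
      show "norm (h *\<^sub>R g' t) \<le> B * norm h" for h
        using mult_right_mono[OF assms(3)[OF t], of "norm h"] by (simp add: mult.commute)
    qed
  qed (use assms in \<open>auto simp: has_vector_derivative_def\<close>)
  then show ?thesis using assms(1) by simp
qed

primrec run :: "(nat \<Rightarrow> 'a \<Rightarrow> 'a) \<Rightarrow> nat \<Rightarrow> 'a \<Rightarrow> 'a" where
  "run P 0 z = z"
| "run P (Suc i) z = P i (run P i z)"

text \<open>The Lipschitz condition is required only for pairs closer than \<open>r\<close>: the
  tube is not convex, and Cauchy's estimate gives such bounds on balls only. Nothing is assumed
  about solutions through points of \<Omega>.\<close>

locale tube_field =
  fixes X :: "real \<Rightarrow> 'a::real_normed_vector \<Rightarrow> 'a" and \<Omega> :: "'a set" and r \<Lambda> M :: real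
  assumes r: "r > 0" and \<Lambda>: "\<Lambda> \<ge> 0" and M: "M \<ge> 0"
    and lipschitz: "\<And>t z w. t \<in> {0..1} \<Longrightarrow> z \<in> \<Omega> \<Longrightarrow> w \<in> \<Omega> \<Longrightarrow> dist z w < r \<Longrightarrow> norm (X t z - X t w) \<le> \<Lambda> * dist z w"
    and bound: "\<And>t z. t \<in> {0..1} \<Longrightarrow> z \<in> \<Omega> \<Longrightarrow> norm (X t z) \<le> M"
    and time: "\<And>\<eta>. \<eta> > 0 \<Longrightarrow> \<exists>d>0. \<forall>s\<in>{0..1}. \<forall>t\<in>{0..1}. \<bar>s - t\<bar> < d \<longrightarrow> (\<forall>z\<in>\<Omega>. norm (X s z - X t z) \<le> \<eta>)"
begin

text \<open>An Euler polygon with \<open>m\<close> steps whose defect is at most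
  \<open>\<eta> / m\<close> per step, hence \<eta> in total. Samples of exact solutions, runs of
  schemes and thinned-out runs are all of this kind, so a single comparison estimate serves for
  them.\<close>

definition almost_orbit :: "nat \<Rightarrow> real \<Rightarrow> (nat \<Rightarrow> 'a) \<Rightarrow> bool" where
  "almost_orbit m \<eta> y \<longleftrightarrow> (\<forall>i<m. norm (y (Suc i) - y i - (1 / m) *\<^sub>R X (i / m) (y i)) \<le> \<eta> / m)"

definition consistent :: "nat \<Rightarrow> real \<Rightarrow> (nat \<Rightarrow> 'a \<Rightarrow> 'a) \<Rightarrow> bool" where
  "consistent m \<eta> P \<longleftrightarrow> (\<forall>i<m. \<forall>z\<in>\<Omega>. norm (P i z - z - (1 / m) *\<^sub>R X (i / m) z) \<le> \<eta> / m)"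

text \<open>A solution with a margin: the ball of radius \<open>r\<close> around each of its points
  stays in the tube, so that whatever remains \<open>r\<close>-close to it stays in the tube as
  well.\<close>

definition trajectory :: "(real \<Rightarrow> 'a) \<Rightarrow> bool" where
  "trajectory u \<longleftrightarrow> (\<forall>t\<in>{0..1}. ball (u t) r \<subseteq> \<Omega> \<and> (u has_vector_derivative X t (u t)) (at t within {0..1}))"

lemma trajectory_in: "trajectory u \<Longrightarrow> t \<in> {0..1} \<Longrightarrow> u t \<in> \<Omega>"
  using r unfolding trajectory_def by (auto simp: subset_iff)

text \<open>The induction step of the discrete Gronwall estimate. One step multiplies the distance
  by at most \<open>1 + \<Lambda> h\<close>, which is at most \<open>exp (\<Lambda> h)\<close>, and
  adds the two defects.\<close>

lemma gronwall_step:
  assumes t: "t \<in> {0..1}" and h: "h \<ge> 0" and xy: "x \<in> \<Omega>" "y \<in> \<Omega>" "dist x y < r"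
    and x': "norm (x' - x - h *\<^sub>R X t x) \<le> h * \<eta>" and y': "norm (y' - y - h *\<^sub>R X t y) \<le> h * \<eta>'"
    and A: "A \<ge> 0" and \<eta>: "\<eta> \<ge> 0" "\<eta>' \<ge> 0"
    and IH: "norm (x - y) \<le> exp (\<Lambda> * (real i * h)) * (A + real i * h * (\<eta> + \<eta>'))"
  shows "norm (x' - y') \<le> exp (\<Lambda> * (real (Suc i) * h)) * (A + real (Suc i) * h * (\<eta> + \<eta>'))"
proof -
  let ?a = "x' - x - h *\<^sub>R X t x" and ?b = "y' - y - h *\<^sub>R X t y" and ?d = "h *\<^sub>R (X t x - X t y)"
  have "x' - y' = ?a - ?b + (x - y) + ?d"
    by (simp add: algebra_simps)
  then have "norm (x' - y') = norm (?a - ?b + (x - y) + ?d)" by (rule arg_cong)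
  then have "norm (x' - y') \<le> norm ?a + norm ?b + norm (x - y) + norm ?d"
    using norm_triangle_ineq[of "?a - ?b + (x - y)" ?d] norm_triangle_ineq[of "?a - ?b" "x - y"]
      norm_triangle_ineq4[of ?a ?b] by linarith
  also have "norm (h *\<^sub>R (X t x - X t y)) \<le> h * (\<Lambda> * norm (x - y))"
    using lipschitz[OF t xy] h by (simp add: dist_norm mult_left_mono)
  finally have "norm (x' - y') \<le> (1 + \<Lambda> * h) * norm (x - y) + h * (\<eta> + \<eta>')"
    using x' y' by (simp add: algebra_simps)
  also have "\<dots> \<le> exp (\<Lambda> * h) * (exp (\<Lambda> * (real i * h)) * (A + real i * h * (\<eta> + \<eta>'))) + exp (\<Lambda> * (real (Suc i) * h)) * (h * (\<eta> + \<eta>'))"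
  proof (rule add_mono)
    show "(1 + \<Lambda> * h) * norm (x - y) \<le> exp (\<Lambda> * h) * (exp (\<Lambda> * (real i * h)) * (A + real i * h * (\<eta> + \<eta>')))"
      using IH exp_ge_add_one_self[of "\<Lambda> * h"] by (intro mult_mono) auto
    have "1 * (h * (\<eta> + \<eta>')) \<le> exp (\<Lambda> * (real (Suc i) * h)) * (h * (\<eta> + \<eta>'))"
      using h \<eta> \<Lambda> by (intro mult_right_mono) (auto intro!: mult_nonneg_nonneg)
    then show "h * (\<eta> + \<eta>') \<le> exp (\<Lambda> * (real (Suc i) * h)) * (h * (\<eta> + \<eta>'))" by simp
  qed
  also have "exp (\<Lambda> * h) * (exp (\<Lambda> * (real i * h)) * (A + real i * h * (\<eta> + \<eta>'))) = exp (\<Lambda> * (real (Suc i) * h)) * (A + real i * h * (\<eta> + \<eta>'))"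
  proof -
    have "exp (\<Lambda> * (real (Suc i) * h)) = exp (\<Lambda> * h) * exp (\<Lambda> * (real i * h))"
      by (subst exp_add[symmetric]) (simp add: algebra_simps)
    then show ?thesis by (simp only: mult.assoc)
  qed
  finally show ?thesis by (simp add: algebra_simps)
qed

lemma gronwall_bound:
  assumes "A \<ge> 0" "B \<ge> 0" "i \<le> m" "m > 0"
  shows "exp (\<Lambda> * (real i * (1 / real m))) * (A + real i * (1 / real m) * B) \<le> exp \<Lambda> * (A + B)"
proof -
  have i: "real i * (1 / real m) \<le> 1" "real i * (1 / real m) \<ge> 0" using assms by (auto simp: field_simps)
  have "\<Lambda> * (real i * (1 / real m)) \<le> \<Lambda>" using mult_left_mono[OF i(1) \<Lambda>] by simp
  moreover have "real i * (1 / real m) * B \<le> B" using mult_right_mono[OF i(1) assms(2)] by simp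
  ultimately show ?thesis using i assms by (intro mult_mono) auto
qed

lemma compare_orbits:
  assumes x: "almost_orbit m \<eta> x" and y: "almost_orbit m \<eta>' y" and m: "m > 0" and \<eta>: "\<eta> \<ge> 0" "\<eta>' \<ge> 0"
    and close: "\<And>i. i < m \<Longrightarrow> x i \<in> \<Omega> \<and> y i \<in> \<Omega> \<and> dist (x i) (y i) < r"
  shows "norm (x m - y m) \<le> exp \<Lambda> * (norm (x 0 - y 0) + (\<eta> + \<eta>'))"
proof -
  have "i \<le> m \<Longrightarrow> norm (x i - y i) \<le> exp (\<Lambda> * (real i * (1 / m))) * (norm (x 0 - y 0) + real i * (1 / m) * (\<eta> + \<eta>'))" for i
  proof (induction i)
    case (Suc i)
    show ?case
      by (rule gronwall_step[of "i / m" _ "x i" "y i"])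
         (use Suc close[of i] x y \<eta> m in \<open>auto simp: almost_orbit_def\<close>)
  qed simp
  from this[of m] gronwall_bound[of "norm (x 0 - y 0)" "\<eta> + \<eta>'" m m] m \<eta> show ?thesis by simp
qed

text \<open>A bootstrap: the estimate up to step \<open>i\<close> keeps the run within
  \<open>r\<close> of the trajectory, hence inside \<Omega>, and this permits step
  \<open>i + 1\<close>. The smallness condition on \<open>z\<close> is exactly what closes the
  argument.\<close>

lemma run_near_trajectory:
  assumes u: "trajectory u" and x: "almost_orbit m \<eta> (\<lambda>i. u (real i / m))" and P: "consistent m \<eta>' P"
    and m: "m > 0" and \<eta>: "\<eta> \<ge> 0" "\<eta>' \<ge> 0"
    and z: "exp \<Lambda> * (norm (u 0 - z) + (\<eta> + \<eta>')) < r" and i: "i \<le> m"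
  shows "norm (u (real i / m) - run P i z) \<le> exp \<Lambda> * (norm (u 0 - z) + (\<eta> + \<eta>'))" "run P i z \<in> \<Omega>"
proof -
  have b: "exp (\<Lambda> * (real i * (1 / m))) * (norm (u 0 - z) + real i * (1 / m) * (\<eta> + \<eta>')) \<le> exp \<Lambda> * (norm (u 0 - z) + (\<eta> + \<eta>'))"
    if "i \<le> m" for i using gronwall_bound[of "norm (u 0 - z)" "\<eta> + \<eta>'" i m] m that \<eta> by simp
  have in\<Omega>: "run P i z \<in> \<Omega> \<and> dist (u (real i / m)) (run P i z) < r"
    if "norm (u (real i / m) - run P i z) \<le> exp (\<Lambda> * (real i * (1 / m))) * (norm (u 0 - z) + real i * (1 / m) * (\<eta> + \<eta>'))"
      "i \<le> m" for i
  proof -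
    have d: "dist (u (real i / m)) (run P i z) < r" using that(1) b[OF that(2)] z by (simp add: dist_norm)
    moreover have "real i / m \<in> {0..1}" using that(2) m by auto
    ultimately show ?thesis using u unfolding trajectory_def by (auto simp: subset_iff)
  qed
  have *: "i \<le> m \<Longrightarrow> norm (u (real i / m) - run P i z) \<le> exp (\<Lambda> * (real i * (1 / m))) * (norm (u 0 - z) + real i * (1 / m) * (\<eta> + \<eta>'))" for i
  proof (induction i)
    case (Suc i)
    then have IH: "norm (u (real i / m) - run P i z) \<le> exp (\<Lambda> * (real i * (1 / m))) * (norm (u 0 - z) + real i * (1 / m) * (\<eta> + \<eta>'))"
      and i: "i < m" by auto
    note c = in\<Omega>[OF IH less_imp_le[OF i]]
    show ?case
      by (rule gronwall_step[of "i / m" _ "u (real i / m)" "run P i z"])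
         (use IH i c x P \<eta> m trajectory_in[OF u] in \<open>auto simp: almost_orbit_def consistent_def\<close>)
  qed simp
  show "norm (u (real i / m) - run P i z) \<le> exp \<Lambda> * (norm (u 0 - z) + (\<eta> + \<eta>'))"
    using *[OF i] b[OF i] by linarith
  show "run P i z \<in> \<Omega>" using in\<Omega>[OF *[OF i] i] by simp
qed

lemma run_almost_orbit:
  assumes "consistent m \<eta> P" "\<And>i. i < m \<Longrightarrow> run P i z \<in> \<Omega>"
  shows "almost_orbit m \<eta> (\<lambda>i. run P i z)"
  using assms by (simp add: almost_orbit_def consistent_def)

text \<open>A common modulus of continuity in time and space. The displacement
  \<open>(M + 1) / m\<close> is what an almost orbit with total defect at most 1 can travel during
  time \<open>1 / m\<close>.\<close>

lemma time_step:
  assumes "\<eta> > 0"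
  shows "\<exists>m0>0. \<forall>m\<ge>m0. \<forall>s\<in>{0..1}. \<forall>t\<in>{0..1}. \<forall>z\<in>\<Omega>. \<forall>w\<in>\<Omega>.
     \<bar>s - t\<bar> \<le> 1 / real m \<longrightarrow> dist z w \<le> (M + 1) / real m \<longrightarrow> norm (X s z - X t w) \<le> \<eta>"
proof -
  obtain d where d: "d > 0" "\<And>s t z. s \<in> {0..1} \<Longrightarrow> t \<in> {0..1} \<Longrightarrow> \<bar>s - t\<bar> < d \<Longrightarrow> z \<in> \<Omega> \<Longrightarrow> norm (X s z - X t z) \<le> \<eta> / 2"
    using time[of "\<eta> / 2"] assms by (metis half_gt_zero)
  \<comment> \<open>The three terms bound the time variation, keep the two points within the range
    \<open>r\<close> of the Lipschitz condition, and limit the Lipschitz contribution to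
    \<open>\<eta> / 2\<close>.\<close>
  define e where "e = min d (min (r / (M + 1)) (\<eta> / (2 * (\<Lambda> + 1) * (M + 1))))"
  have e: "e > 0" using d(1) r \<Lambda> M assms by (auto simp: e_def intro!: divide_pos_pos mult_pos_pos)
  obtain m0 :: nat where m0: "m0 > 0" "1 / real m0 < e" using nat_approx_posE[OF e] by (metis zero_less_Suc)
  have "norm (X s z - X t w) \<le> \<eta>"
    if m: "m \<ge> m0" and st: "s \<in> {0..1}" "t \<in> {0..1}" "\<bar>s - t\<bar> \<le> 1 / real m" and zw: "z \<in> \<Omega>" "w \<in> \<Omega>" "dist z w \<le> (M + 1) / real m" for m s t z w
  proof -
    have "1 / real m \<le> 1 / real m0" using m m0 by (simp add: frac_le)
    then have me: "1 / real m < e" using m0 by linarith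
    have dz: "dist z w \<le> (M + 1) * (1 / real m)" using zw by simp
    have "(M + 1) * (1 / real m) < (M + 1) * (r / (M + 1))"
      using me M by (intro mult_strict_left_mono) (auto simp: e_def)
    then have "dist z w < r" using dz M by simp
    then have "norm (X t z - X t w) \<le> \<Lambda> * dist z w" by (intro lipschitz st zw)
    also have "\<dots> \<le> (\<Lambda> + 1) * ((M + 1) * (1 / real m))" using dz \<Lambda> by (intro mult_mono) auto
    also have "\<dots> \<le> (\<Lambda> + 1) * ((M + 1) * (\<eta> / (2 * (\<Lambda> + 1) * (M + 1))))"
      using me M \<Lambda> by (intro mult_left_mono) (auto simp: e_def)
    also have "\<dots> = \<eta> / 2"
    proof -
      have eq: "a * (b * (\<eta> / (2 * a * b))) = \<eta> / 2" if "a > 0" "b > 0" for a b :: real using that by simp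
      show ?thesis by (rule eq) (use M \<Lambda> in auto)
    qed
    finally have "norm (X t z - X t w) \<le> \<eta> / 2" .
    moreover have "norm (X s z - X t z) \<le> \<eta> / 2" by (rule d(2)) (use st zw me in \<open>auto simp: e_def\<close>)
    ultimately show ?thesis using norm_triangle_ineq[of "X s z - X t z" "X t z - X t w"] by simp
  qed
  then show ?thesis using m0(1) by blast
qed

lemma trajectory_almost_orbit:
  assumes "\<eta> > 0"
  shows "\<exists>m0>0. \<forall>m\<ge>m0. \<forall>u. trajectory u \<longrightarrow> almost_orbit m \<eta> (\<lambda>i. u (real i / m))"
proof -
  obtain m0 where m0: "m0 > 0" and step: "\<And>m s t z w. m \<ge> m0 \<Longrightarrow> s \<in> {0..1} \<Longrightarrow> t \<in> {0..1} \<Longrightarrow> z \<in> \<Omega> \<Longrightarrow> w \<in> \<Omega> \<Longrightarrow>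
     \<bar>s - t\<bar> \<le> 1 / real m \<Longrightarrow> dist z w \<le> (M + 1) / real m \<Longrightarrow> norm (X s z - X t w) \<le> \<eta>"
    using time_step[OF assms] by metis
  have "almost_orbit m \<eta> (\<lambda>i. u (real i / m))" if m: "m \<ge> m0" and u: "trajectory u" for m u
    unfolding almost_orbit_def
  proof (intro allI impI)
    fix i assume i: "i < m"
    let ?a = "real i / m" and ?b = "real (Suc i) / m"
    have m': "m > 0" using m m0 by simp
    have ab: "?a \<le> ?b" "?b - ?a = 1 / m" using m' by (simp_all add: field_simps)
    have I: "{?a..?b} \<subseteq> {0..1}"
    proof -
      have "?b \<le> 1" using i m' by simp
      moreover have "?a \<ge> 0" by simp
      ultimately show ?thesis by (meson atLeastAtMost_iff order_trans subsetI)
    qed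
    have du: "(u has_vector_derivative X t (u t)) (at t within {?a..?b})" if "t \<in> {?a..?b}" for t
      using u I that unfolding trajectory_def by (meson has_vector_derivative_within_subset subsetD)
    have a: "?a \<in> {0..1}" using I ab(1) by auto
    have near: "norm (u t - u ?a) \<le> (M + 1) / real m" if t: "t \<in> {?a..?b}" for t
    proof -
      have "norm (u t - u ?a) \<le> M * (t - ?a)"
      proof (rule norm_diff_le_interval)
        fix s assume s: "s \<in> {?a..t}"
        then have s': "s \<in> {?a..?b}" using t by auto
        show "(u has_vector_derivative X s (u s)) (at s within {?a..t})"
          by (rule has_vector_derivative_within_subset[OF du[OF s']]) (use t in auto)
        show "norm (X s (u s)) \<le> M" using bound[of s "u s"] I s' trajectory_in[OF u] by blast
      qed (use t in auto)
      also have "\<dots> \<le> M * (1 / m)" using t ab(2) M by (intro mult_left_mono) (auto simp: )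
      also have "\<dots> \<le> (M + 1) / m" by (simp add: divide_right_mono)
      finally show ?thesis .
    qed
    \<comment> \<open>Subtracting the linear motion turns the defect of one step into an increment
      of \<open>?g\<close>, whose derivative is the variation of the field along the
      solution.\<close>
    let ?g = "\<lambda>t. u t - t *\<^sub>R X ?a (u ?a)"
    have "norm (?g ?b - ?g ?a) \<le> \<eta> * (?b - ?a)"
    proof (rule norm_diff_le_interval[OF ab(1)])
      fix t assume t: "t \<in> {?a..?b}"
      show "(?g has_vector_derivative (X t (u t) - X ?a (u ?a))) (at t within {?a..?b})"
        by (rule derivative_eq_intros du[OF t] refl | simp)+
      have t01: "t \<in> {0..1}" using t I by blast
      show "norm (X t (u t) - X ?a (u ?a)) \<le> \<eta>"
        by (rule step[OF m t01 a]) (use near[OF t] t ab(2) trajectory_in[OF u] t01 a in \<open>auto simp: dist_norm\<close>)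
    qed
    moreover have "a - s *\<^sub>R v - (b - t *\<^sub>R v) = a - b - (s - t) *\<^sub>R v" for a b v :: 'a and s t
      by (simp add: algebra_simps)
    ultimately have "norm (u ?b - u ?a - (1 / real m) *\<^sub>R X ?a (u ?a)) \<le> \<eta> * (1 / real m)"
      by (simp only: ab(2))
    then show "norm (u ?b - u ?a - (1 / real m) *\<^sub>R X ?a (u ?a)) \<le> \<eta> / real m" by simp
  qed
  then show ?thesis using m0 by blast
qed

text \<open>Every \<open>k\<close>-th point of a fine almost orbit is a coarse almost orbit, since
  the field hardly changes along the \<open>k\<close> small steps. This allows schemes of different
  step sizes to be compared without an exact solution through the complex starting point.\<close>

lemma sampled_almost_orbit:
  assumes "\<eta>' > 0"
  shows "\<exists>m0>0. \<forall>m\<ge>m0. \<forall>k>0. \<forall>\<eta>\<in>{0..1}. \<forall>y. almost_orbit (k * m) \<eta> y \<longrightarrow> (\<forall>i\<le>k * m. y i \<in> \<Omega>) \<longrightarrow>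
     almost_orbit m (\<eta> + \<eta>') (\<lambda>i. y (k * i))"
proof -
  obtain m0 where m0: "m0 > 0" and step: "\<And>m s t z w. m \<ge> m0 \<Longrightarrow> s \<in> {0..1} \<Longrightarrow> t \<in> {0..1} \<Longrightarrow> z \<in> \<Omega> \<Longrightarrow> w \<in> \<Omega> \<Longrightarrow>
     \<bar>s - t\<bar> \<le> 1 / real m \<Longrightarrow> dist z w \<le> (M + 1) / real m \<Longrightarrow> norm (X s z - X t w) \<le> \<eta>'"
    using time_step[OF assms] by metis
  have "almost_orbit m (\<eta> + \<eta>') (\<lambda>i. y (k * i))"
    if m: "m \<ge> m0" and k: "k > 0" and \<eta>: "\<eta> \<in> {0..1}" and y: "almost_orbit (k * m) \<eta> y" and y\<Omega>: "\<And>i. i \<le> k * m \<Longrightarrow> y i \<in> \<Omega>" for m k \<eta> y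
    unfolding almost_orbit_def
  proof (intro allI impI)
    fix i assume i: "i < m"
    have m': "m > 0" using m m0 by simp
    let ?h = "1 / real (k * m)"
    have h: "?h \<ge> 0" by simp
    have idx: "k * i + l < k * m" if "l < k" for l
    proof -
      have "k * i + l < k * Suc i" using that by simp
      also have "\<dots> \<le> k * m" using i by (intro mult_left_mono) auto
      finally show ?thesis .
    qed
    have t: "real (k * i + l) / real (k * m) \<in> {0..1}" if "l < k" for l
    proof -
      have "real (k * i + l) \<le> real (k * m)" using less_imp_le[OF idx[OF that]] by (simp only: of_nat_le_iff)
      then have "real (k * i + l) / real (k * m) \<le> 1" by (intro divide_le_eq_1[THEN iffD2]) (use k m' in auto)
      then show ?thesis by simp
    qed
    have step1: "norm (y (Suc (k * i + l)) - y (k * i + l) - ?h *\<^sub>R X (real (k * i + l) / real (k * m)) (y (k * i + l))) \<le> ?h * \<eta>" if "l < k" for l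
      using y[unfolded almost_orbit_def, rule_format, OF idx[OF that]]
      by (simp only: times_divide_eq_left mult_1)
    \<comment> \<open>Each small step moves the point by at most \<open>?h * (M + 1)\<close>; the
      bound \<open>\<eta> \<le> 1\<close> is used here.\<close>
    have drift: "l \<le> k \<Longrightarrow> norm (y (k * i + l) - y (k * i)) \<le> real l * (?h * (M + 1))" for l
    proof (induction l)
      case (Suc l)
      then have l: "l < k" by simp
      have "norm (X (real (k * i + l) / real (k * m)) (y (k * i + l))) \<le> M"
        by (rule bound[OF t[OF l]]) (use y\<Omega> idx[OF l] in simp)
      then have "norm (?h *\<^sub>R X (real (k * i + l) / real (k * m)) (y (k * i + l))) \<le> ?h * M"
        using h by (simp add: divide_right_mono)
      moreover have "?h * \<eta> \<le> ?h * 1" using \<eta> h by (intro mult_left_mono) auto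
      ultimately have "norm (y (Suc (k * i + l)) - y (k * i + l)) \<le> ?h * M + ?h * 1"
        using step1[OF l] norm_triangle_sub[of "y (Suc (k * i + l)) - y (k * i + l)" "?h *\<^sub>R X (real (k * i + l) / real (k * m)) (y (k * i + l))"]
        by linarith
      then have "norm (y (Suc (k * i + l)) - y (k * i + l)) \<le> ?h * (M + 1)" by (simp only: distrib_left)
      moreover have "norm (y (k * i + l) - y (k * i)) \<le> real l * (?h * (M + 1))" using Suc.IH l by simp
      moreover have "norm (y (Suc (k * i + l)) - y (k * i)) \<le> norm (y (Suc (k * i + l)) - y (k * i + l)) + norm (y (k * i + l) - y (k * i))"
        using norm_triangle_ineq[of "y (Suc (k * i + l)) - y (k * i + l)" "y (k * i + l) - y (k * i)"] by simp
      ultimately have "norm (y (Suc (k * i + l)) - y (k * i)) \<le> ?h * (M + 1) + real l * (?h * (M + 1))" by linarith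
      then show ?case by (simp only: of_nat_Suc distrib_right mult_1 add_Suc_right)
    qed simp
    have kh: "real k * ?h = 1 / m" using k by simp
    have Xd: "norm (X (real (k * i + l) / real (k * m)) (y (k * i + l)) - X (real i / m) (y (k * i))) \<le> \<eta>'" if l: "l < k" for l
    proof (rule step[OF m t[OF l]])
      show "real i / real m \<in> {0..1}" using i by auto
      show "y (k * i + l) \<in> \<Omega>" "y (k * i) \<in> \<Omega>" using y\<Omega> idx[OF l] idx[OF k] by auto
      have "real (k * i + l) / real (k * m) - real i / real m = real l * ?h"
        using k m' by (simp add: field_simps)
      moreover have "real l * ?h \<le> real k * ?h" using l h by (intro mult_right_mono) auto
      moreover have "real l * ?h \<ge> 0" by simp
      ultimately show "\<bar>real (k * i + l) / real (k * m) - real i / real m\<bar> \<le> 1 / real m" using kh by simp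
      have "norm (y (k * i + l) - y (k * i)) \<le> real l * (?h * (M + 1))" using drift l by simp
      also have "\<dots> \<le> real k * (?h * (M + 1))" using l h M by (intro mult_right_mono) auto
      also have "\<dots> = (M + 1) / m" using kh by (metis (no_types, lifting) mult.assoc mult.commute times_divide_eq_right mult.right_neutral)
      finally show "dist (y (k * i + l)) (y (k * i)) \<le> (M + 1) / real m" by (simp add: dist_norm)
    qed
    have *: "l \<le> k \<Longrightarrow> norm (y (k * i + l) - y (k * i) - (real l * ?h) *\<^sub>R X (real i / m) (y (k * i))) \<le> real l * (?h * (\<eta> + \<eta>'))" for l
    proof (induction l)
      case (Suc l)
      then have l: "l < k" by simp
      let ?A = "y (Suc (k * i + l)) - y (k * i + l) - ?h *\<^sub>R X (real (k * i + l) / real (k * m)) (y (k * i + l))"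
      let ?B = "?h *\<^sub>R (X (real (k * i + l) / real (k * m)) (y (k * i + l)) - X (real i / m) (y (k * i)))"
      let ?C = "y (k * i + l) - y (k * i) - (real l * ?h) *\<^sub>R X (real i / m) (y (k * i))"
      have "norm ?B \<le> ?h * \<eta>'"
        unfolding norm_scaleR using Xd[OF l] h by (intro mult_mono) auto
      then have "norm (?A + ?B + ?C) \<le> ?h * \<eta> + ?h * \<eta>' + real l * (?h * (\<eta> + \<eta>'))"
        using step1[OF l] Suc.IH l by (intro norm_triangle_le add_mono) (auto simp: less_imp_le)
      moreover have "?A + ?B + ?C = y (k * i + Suc l) - y (k * i) - (real (Suc l) * ?h) *\<^sub>R X (real i / m) (y (k * i))"
      proof -
        have "(real (Suc l) * ?h) = ?h + real l * ?h" by (simp add: add_divide_distrib)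
        then show ?thesis by (simp only: scaleR_left_distrib scaleR_right_diff_distrib) simp
      qed
      moreover have "?h * \<eta> + ?h * \<eta>' + real l * (?h * (\<eta> + \<eta>')) = real (Suc l) * (?h * (\<eta> + \<eta>'))"
        by (simp only: of_nat_Suc distrib_right mult_1 distrib_left[of ?h])
      ultimately show ?case by (simp only:)
    qed simp
    have "norm (y (k * i + k) - y (k * i) - (1 / m) *\<^sub>R X (real i / m) (y (k * i))) \<le> real k * (?h * (\<eta> + \<eta>'))"
      using *[of k] by (simp only: kh order_refl)
    moreover have "real k * (?h * (\<eta> + \<eta>')) = (\<eta> + \<eta>') / m" using k by simp
    ultimately show "norm (y (k * Suc i) - y (k * i) - (1 / real m) *\<^sub>R X (real i / real m) (y (k * i))) \<le> (\<eta> + \<eta>') / real m"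
      by (simp add: add.commute)
  qed
  then show ?thesis using m0 by blast
qed

text \<open>Two runs from the same complex point are compared on the coarser of their dyadic grids,
  after thinning out the finer one. The trajectory that starts at a nearby point of \<open>S\<close>
  keeps both runs in the tube and close enough together for the Lipschitz condition. The second
  claim compares a run with a trajectory from its own starting point.\<close>

theorem scheme_converges:
  fixes P :: "nat \<Rightarrow> nat \<Rightarrow> 'a \<Rightarrow> 'a" and k :: "nat \<Rightarrow> nat"
  assumes k: "strict_mono k" and P: "\<And>j. consistent (2 ^ k j) (1 / real (Suc j)) (P j)"
    and S: "\<And>x. x \<in> S \<Longrightarrow> \<exists>u. trajectory u \<and> u 0 = x"
    and W: "\<And>z. z \<in> W \<Longrightarrow> \<exists>x\<in>S. exp \<Lambda> * dist x z < r / 4"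
  shows "uniformly_Cauchy_on W (\<lambda>j. run (P j) (2 ^ k j))"
    and "\<And>u. trajectory u \<Longrightarrow> (\<lambda>j. run (P j) (2 ^ k j) (u 0)) \<longlonglongrightarrow> u 1"
proof -
  have large: "\<exists>J. \<forall>j\<ge>J. 2 ^ k j \<ge> (m0::nat) \<and> 1 / real (Suc j) \<le> e" if "e > 0" for m0 e
  proof -
    obtain J1 where J1: "1 / real (Suc J1) < e" using nat_approx_posE[OF \<open>e > 0\<close>] by blast
    have "2 ^ k j \<ge> m0" if "j \<ge> m0" for j
    proof -
      have "m0 \<le> j" by fact
      also have "j \<le> k j" by (rule strict_mono_imp_increasing[OF k])
      also have "k j \<le> 2 ^ k j" by (rule less_imp_le, rule less_exp)
      finally show ?thesis .
    qed
    moreover have "1 / real (Suc j) \<le> e" if "j \<ge> J1" for j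
    proof -
      have "1 / real (Suc j) \<le> 1 / real (Suc J1)" using that by (intro divide_left_mono) auto
      then show ?thesis using J1 by simp
    qed
    ultimately show ?thesis by (intro exI[of _ "max m0 J1"]) auto
  qed
  show "(\<lambda>j. run (P j) (2 ^ k j) (u 0)) \<longlonglongrightarrow> u 1" if u: "trajectory u" for u
  proof (rule LIMSEQ_I)
    fix e :: real assume e: "e > 0"
    define \<eta> where "\<eta> = min e r / (3 * exp \<Lambda>)"
    have \<eta>: "\<eta> > 0" using e r by (simp add: \<eta>_def)
    have ex: "exp \<Lambda> * (\<eta> + \<eta>) < min e r"
    proof -
      have "exp \<Lambda> * (\<eta> + \<eta>) = 2 / 3 * min e r" by (simp add: \<eta>_def)
      moreover have "min e r > 0" using e r by simp
      ultimately show ?thesis by linarith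
    qed
    obtain m0 where m0: "m0 > 0" "\<And>m. m \<ge> m0 \<Longrightarrow> almost_orbit m \<eta> (\<lambda>i. u (real i / m))"
      using trajectory_almost_orbit[OF \<eta>] u by blast
    obtain J where J: "\<forall>j\<ge>J. 2 ^ k j \<ge> m0 \<and> 1 / real (Suc j) \<le> \<eta>" using large[OF \<eta>] by blast
    have "norm (run (P j) (2 ^ k j) (u 0) - u 1) < e" if j: "j \<ge> J" for j
    proof -
      have jj: "m0 \<le> 2 ^ k j" "1 / real (Suc j) \<le> \<eta>" using J j by auto
      have le: "exp \<Lambda> * (0 + (\<eta> + 1 / real (Suc j))) < min e r"
      proof -
        have "exp \<Lambda> * (0 + (\<eta> + 1 / real (Suc j))) \<le> exp \<Lambda> * (\<eta> + \<eta>)"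
          using jj(2) by (intro mult_left_mono) auto
        then show ?thesis using ex by linarith
      qed
      have "norm (u (real (2 ^ k j) / real (2 ^ k j)) - run (P j) (2 ^ k j) (u 0)) \<le> exp \<Lambda> * (norm (u 0 - u 0) + (\<eta> + 1 / real (Suc j)))"
        by (rule run_near_trajectory(1)[OF u m0(2)[OF jj(1)] P]) (use \<eta> le in auto)
      then show ?thesis using le by (simp add: norm_minus_commute)
    qed
    then show "\<exists>J. \<forall>j\<ge>J. norm (run (P j) (2 ^ k j) (u 0) - u 1) < e" by blast
  qed
  show "uniformly_Cauchy_on W (\<lambda>j. run (P j) (2 ^ k j))"
  proof (rule uniformly_Cauchy_onI')
    fix e :: real assume e: "e > 0"
    \<comment> \<open>The final estimate collects three defects, those of the two schemes and that
      of thinning out, each at most \<eta>. The bound by \<open>r / 4\<close> is reserved for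
      confinement, next to the \<open>r / 4\<close> from the distance of \<open>z\<close> to
      \<open>S\<close>.\<close>
    define \<eta> where "\<eta> = min 1 (min e (r / 4) / (4 * exp \<Lambda>))"
    have \<eta>: "\<eta> > 0" "\<eta> \<le> 1" using e r by (auto simp: \<eta>_def)
    have ex: "exp \<Lambda> * (3 * \<eta>) < min e (r / 4)"
    proof -
      have "exp \<Lambda> * (3 * \<eta>) \<le> exp \<Lambda> * (3 * (min e (r / 4) / (4 * exp \<Lambda>)))"
        by (intro mult_left_mono) (auto simp: \<eta>_def)
      also have "\<dots> = 3 / 4 * min e (r / 4)" by simp
      also have "\<dots> < min e (r / 4)"
      proof -
        have "min e (r / 4) > 0" using e r by simp
        then show ?thesis by linarith
      qed
      finally show ?thesis .
    qed
    obtain m0 where m0: "\<And>m u. m \<ge> m0 \<Longrightarrow> trajectory u \<Longrightarrow> almost_orbit m \<eta> (\<lambda>i. u (real i / m))"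
      using trajectory_almost_orbit[OF \<eta>(1)] by blast
    from sampled_almost_orbit[OF \<eta>(1)] obtain m1 where m1: "\<forall>m\<ge>m1. \<forall>q>0. \<forall>\<eta>'\<in>{0..1}. \<forall>y. almost_orbit (q * m) \<eta>' y \<longrightarrow>
        (\<forall>i\<le>q * m. y i \<in> \<Omega>) \<longrightarrow> almost_orbit m (\<eta>' + \<eta>) (\<lambda>i. y (q * i))"
      by (elim exE conjE) (rule that)
    obtain J where J: "\<And>j. j \<ge> J \<Longrightarrow> 2 ^ k j \<ge> max m0 m1" "\<And>j. j \<ge> J \<Longrightarrow> 1 / real (Suc j) \<le> \<eta>"
      using large[OF \<eta>(1), of "max m0 m1"] by blast
    have "dist (run (P j) (2 ^ k j) z) (run (P j') (2 ^ k j') z) < e" if z: "z \<in> W" and j: "j \<ge> J" "j' > j" for z j j'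
    proof -
      obtain x where x: "x \<in> S" "exp \<Lambda> * dist x z < r / 4" using W[OF z] by blast
      obtain u where u: "trajectory u" "u 0 = x" using S[OF x(1)] by blast
      \<comment> \<open>Half of \<open>r\<close> for each run, so that two runs near the same
        trajectory are less than \<open>r\<close> apart.\<close>
      have near: "norm (u (real i / real (2 ^ k l)) - run (P l) i z) < r / 2 \<and> run (P l) i z \<in> \<Omega>" if l: "l \<ge> J" "i \<le> 2 ^ k l" for l i
      proof -
        have "exp \<Lambda> * (\<eta> + 1 / real (Suc l)) \<le> exp \<Lambda> * (3 * \<eta>)"
          using J(2)[OF l(1)] \<eta> by (intro mult_left_mono) auto
        moreover have "exp \<Lambda> * (3 * \<eta>) < r / 4" using ex by linarith
        moreover have "exp \<Lambda> * (norm (u 0 - z) + (\<eta> + 1 / real (Suc l))) = exp \<Lambda> * dist x z + exp \<Lambda> * (\<eta> + 1 / real (Suc l))"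
          by (simp only: u(2) dist_norm distrib_left)
        ultimately have le: "exp \<Lambda> * (norm (u 0 - z) + (\<eta> + 1 / real (Suc l))) < r / 2"
          using x(2) by linarith
        have o: "almost_orbit (2 ^ k l) \<eta> (\<lambda>i. u (real i / real (2 ^ k l)))"
          using m0[OF _ u(1), of "2 ^ k l"] J(1)[OF l(1)] by simp
        have prems: "(2 :: nat) ^ k l > 0" "\<eta> \<ge> 0" "1 / real (Suc l) \<ge> 0"
            "exp \<Lambda> * (norm (u 0 - z) + (\<eta> + 1 / real (Suc l))) < r"
          using \<eta> le r by (simp, simp, simp, linarith)
        note near = run_near_trajectory[OF u(1) o P[of l] prems l(2)]
        show ?thesis using near(1) le near(2) by (meson le_less_trans)
      qed
      have "k j < k j'" using k j(2) by (simp add: strict_mono_less)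
      then obtain d where d: "k j' = d + k j" by (metis add.commute less_imp_add_positive)
      have pw: "2 ^ k j' = 2 ^ d * (2 ^ k j :: nat)" by (simp add: d power_add)
      have oj: "almost_orbit (2 ^ k j) (1 / real (Suc j)) (\<lambda>i. run (P j) i z)"
        by (rule run_almost_orbit[OF P]) (use near[OF j(1)] in simp)
      have "almost_orbit (2 ^ k j') (1 / real (Suc j')) (\<lambda>i. run (P j') i z)"
        by (rule run_almost_orbit[OF P]) (use near[of j'] j in simp)
      then have o': "almost_orbit (2 ^ d * 2 ^ k j) (1 / real (Suc j')) (\<lambda>i. run (P j') i z)" by (simp only: pw)
      have in': "\<forall>i\<le>2 ^ d * 2 ^ k j. run (P j') i z \<in> \<Omega>"
        using near[of j'] j unfolding pw[symmetric] by simp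
      have oj': "almost_orbit (2 ^ k j) (1 / real (Suc j') + \<eta>) (\<lambda>i. run (P j') (2 ^ d * i) z)"
        by (rule m1[rule_format, OF _ _ _ o' in'[rule_format]]) (use J(1)[OF j(1)] in simp_all)
      have "norm ((\<lambda>i. run (P j) i z) (2 ^ k j) - (\<lambda>i. run (P j') (2 ^ d * i) z) (2 ^ k j)) \<le>
          exp \<Lambda> * (norm (run (P j) 0 z - run (P j') (2 ^ d * 0) z) + (1 / real (Suc j) + (1 / real (Suc j') + \<eta>)))"
      proof (rule compare_orbits[OF oj oj'])
        fix i :: nat assume i: "i < 2 ^ k j"
        have i': "2 ^ d * i \<le> 2 ^ k j'" using i by (simp add: pw less_imp_le)
        have eq: "real (2 ^ d * i) / real (2 ^ k j') = real i / real (2 ^ k j)" by (simp add: pw)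
        have n1: "norm (u (real i / real (2 ^ k j)) - run (P j) i z) < r / 2" "run (P j) i z \<in> \<Omega>"
          using near[OF j(1), of i] i by auto
        have n2: "norm (u (real i / real (2 ^ k j)) - run (P j') (2 ^ d * i) z) < r / 2" "run (P j') (2 ^ d * i) z \<in> \<Omega>"
          using near[of j' "2 ^ d * i"] i' j unfolding eq by auto
        have "dist (run (P j) i z) (run (P j') (2 ^ d * i) z) < r"
          using n1(1) n2(1) dist_triangle3[of "run (P j) i z" "run (P j') (2 ^ d * i) z" "u (real i / real (2 ^ k j))"]
          by (simp add: dist_norm)
        then show "run (P j) i z \<in> \<Omega> \<and> run (P j') (2 ^ d * i) z \<in> \<Omega> \<and> dist (run (P j) i z) (run (P j') (2 ^ d * i) z) < r"
          using n1 n2 by simp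
      qed (use \<eta> in auto)
      also have "\<dots> \<le> exp \<Lambda> * (3 * \<eta>)"
        using J(2)[of j] J(2)[of j'] j by (intro mult_left_mono) auto
      also have "\<dots> < e" using ex by simp
      finally show ?thesis by (simp add: dist_norm pw)
    qed
    then show "\<exists>J. \<forall>z\<in>W. \<forall>j\<ge>J. \<forall>j'>j. dist (run (P j) (2 ^ k j) z) (run (P j') (2 ^ k j') z) < e" by blast
  qed
qed

end

section \<open>Hamiltonian vector fields\<close>

definition unit_vec :: "'n + 'n \<Rightarrow> ('n::finite) cpt" where
  "unit_vec j = of_coords (\<lambda>i. if i = j then 1 else 0)"

text \<open>The standard symplectic matrix applied to a covector: \<open>(a_q, a_p)\<close> becomes
  \<open>(a_p, - a_q)\<close>, in agreement with the vector \<open>(b, - a)\<close> of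
  \<open>hamiltonian_solution\<close>.\<close>

definition symp :: "('n + 'n \<Rightarrow> 'a::ab_group_add) \<Rightarrow> ('a ^ 'n) \<times> ('a ^ 'n)" where
  "symp a = of_coords (\<lambda>j. case j of Inl i \<Rightarrow> a (Inr i) | Inr i \<Rightarrow> - a (Inl i))"

definition ham_field :: "(('n::finite) cpt \<Rightarrow> complex) \<Rightarrow> 'n cpt \<Rightarrow> 'n cpt" where
  "ham_field f z = symp (\<lambda>j. dd f z (unit_vec j))"

lemma norm_unit_vec_le: "norm (unit_vec j) \<le> 1"
proof -
  have "norm (unit_vec j) \<le> (\<Sum>i\<in>UNIV. norm (coord i (unit_vec j)))" by (rule norm_le_sum_coord)
  also have "\<dots> = (\<Sum>i\<in>UNIV. if i = j then 1 else 0)"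
    by (rule sum.cong) (auto simp: unit_vec_def)
  finally show ?thesis by simp
qed

lemma norm_symp_le:
  assumes "\<And>j. norm (a j) \<le> e"
  shows "norm (symp a :: ('a::real_normed_vector ^ 'n) \<times> ('a ^ 'n)) \<le> of_nat CARD('n + 'n) * e"
  by (rule norm_le_card_coord) (use assms in \<open>auto simp: symp_def split: sum.split\<close>)

lemma symp_diff: "symp a - symp b = symp (\<lambda>j. a j - (b j :: 'a::ring_1))"
  by (rule coord_eqI) (auto simp: symp_def split: sum.split)

lemma norm_ham_field_le:
  fixes f :: "('n::finite) cpt \<Rightarrow> complex"
  assumes "cholomorphic_on f (ball z \<rho>)" "\<rho> > 0" "\<And>x. x \<in> ball z \<rho> \<Longrightarrow> cmod (f x) \<le> B"
  shows "norm (ham_field f z) \<le> real CARD('n + 'n) * (B / \<rho>)"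
  unfolding ham_field_def
proof (rule norm_symp_le)
  fix j
  have B: "B \<ge> 0" using assms(2) order_trans[OF norm_ge_zero assms(3)[of z]] by simp
  have "cmod (dd f z (unit_vec j)) \<le> B * norm (unit_vec j) / \<rho>" by (rule dd_bound[OF assms])
  also have "\<dots> \<le> B * 1 / \<rho>" using B assms(2) norm_unit_vec_le[of j] by (intro divide_right_mono mult_left_mono) auto
  finally show "cmod (dd f z (unit_vec j)) \<le> B / \<rho>" by simp
qed

lemma ham_field_diff:
  assumes "cdiff f z" "cdiff g z"
  shows "ham_field (\<lambda>x. f x - g x) z = ham_field f z - ham_field g z"
  using assms by (simp add: ham_field_def symp_diff dd_diff)

lemma ham_field_lipschitz:
  fixes f :: "('n::finite) cpt \<Rightarrow> complex"
  assumes "cholomorphic_on f (ball z (4 * \<rho>))" "\<rho> > 0" "\<And>x. x \<in> ball z (4 * \<rho>) \<Longrightarrow> cmod (f x) \<le> B"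
    and "x \<in> ball z \<rho>" "y \<in> ball z \<rho>"
  shows "norm (ham_field f x - ham_field f y) \<le> real CARD('n + 'n) * (B / (2 * \<rho>^2)) * norm (x - y)"
proof -
  have "norm (symp (\<lambda>j. dd f x (unit_vec j) - dd f y (unit_vec j))) \<le> real CARD('n + 'n) * (B / (2 * \<rho>^2) * norm (x - y))"
  proof (rule norm_symp_le)
    fix j
    have B: "B \<ge> 0" using assms(2) order_trans[OF norm_ge_zero assms(3)[of z]] by simp
    have "cmod (dd f x (unit_vec j) - dd f y (unit_vec j)) \<le> B / (2 * \<rho>^2) * norm (x - y) * norm (unit_vec j)"
      by (rule dd_lipschitz[OF assms])
    also have "\<dots> \<le> B / (2 * \<rho>^2) * norm (x - y) * 1"
      using B norm_unit_vec_le[of j] by (intro mult_left_mono) auto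
    finally show "cmod (dd f x (unit_vec j) - dd f y (unit_vec j)) \<le> B / (2 * \<rho>^2) * norm (x - y)" by simp
  qed
  then show ?thesis by (simp add: ham_field_def symp_diff mult.assoc)
qed

section \<open>Splitting a ridge sum\<close>

definition ridge_field :: "(real \<times> real \<times> ('n + 'n \<Rightarrow> real)) list \<Rightarrow> ('n::finite) cpt \<Rightarrow> 'n cpt" where
  "ridge_field L z = (\<Sum>(c, \<phi>, a)\<leftarrow>L. (- of_real c * sin (lin a z + of_real \<phi>)) *\<^sub>C cv (symp a))"

lemma lin_add: "lin a (z + w) = lin a z + lin a w"
  and lin_diff: "lin a (z - w) = lin a z - lin a w"
  and lin_scaleC: "lin a (c *\<^sub>C z) = c * lin a z"
  by (simp_all add: lin_def algebra_simps sum.distrib sum_subtractf sum_distrib_left)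

lemma lin_unit_vec: "lin a (unit_vec j) = of_real (a j)"
proof -
  have "lin a (unit_vec j) = (\<Sum>i\<in>UNIV. if i = j then of_real (a i) else 0)"
    unfolding lin_def unit_vec_def by (rule sum.cong) auto
  then show ?thesis by simp
qed

lemma cdiff_lin [cdiff_intros]: "cdiff g z \<Longrightarrow> cdiff (\<lambda>x. lin a (g x)) z"
  unfolding lin_def by (intro cdiff_intros)

lemma cdiff_ridge_sum: "cdiff (ridge_sum L) z"
proof (induction L)
  case Nil
  show ?case by (simp add: ridge_sum_def[abs_def] cdiff_const)
next
  case (Cons x L)
  obtain c \<phi> a where x: "x = (c, \<phi>, a)" by (cases x)
  have "ridge_sum (x # L) = (\<lambda>z. of_real c * cos (lin a z + of_real \<phi>) + ridge_sum L z)"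
    by (simp add: fun_eq_iff ridge_sum_def x)
  then show ?case using Cons by (auto intro!: cdiff_intros)
qed

lemma dd_ridge_sum: "dd (ridge_sum L) z v = (\<Sum>(c, \<phi>, a)\<leftarrow>L. - of_real c * sin (lin a z + of_real \<phi>) * lin a v)"
proof -
  have "((\<lambda>w. ridge_sum L (z + w *\<^sub>C v)) has_field_derivative
      (\<Sum>(c, \<phi>, a)\<leftarrow>L. - of_real c * sin (lin a z + of_real \<phi>) * lin a v)) (at 0)"
  proof (induction L)
    case Nil
    show ?case by (simp add: ridge_sum_def)
  next
    case (Cons x L)
    obtain c \<phi> a where x: "x = (c, \<phi>, a)" by (cases x)
    have "((\<lambda>w. of_real c * cos (lin a z + w * lin a v + of_real \<phi>) + ridge_sum L (z + w *\<^sub>C v)) has_field_derivative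
        (- of_real c * sin (lin a z + of_real \<phi>) * lin a v + (\<Sum>(c, \<phi>, a)\<leftarrow>L. - of_real c * sin (lin a z + of_real \<phi>) * lin a v))) (at 0)"
      by (rule DERIV_add[OF _ Cons.IH]) (auto intro!: derivative_eq_intros)
    then show ?case by (simp add: ridge_sum_def x lin_add lin_scaleC)
  qed
  then show ?thesis unfolding dd_def by (rule DERIV_imp_deriv)
qed

lemma ham_field_ridge_sum: "ham_field (ridge_sum L) z = ridge_field L z"
proof (rule coord_eqI)
  fix j
  have "coord j (ridge_field L z) = (\<Sum>(c, \<phi>, a)\<leftarrow>L. - of_real c * sin (lin a z + of_real \<phi>) * of_real (coord j (symp a)))"
    unfolding ridge_field_def by (induction L) (auto simp: )
  then show "coord j (ham_field (ridge_sum L) z) = coord j (ridge_field L z)"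
    by (cases j) (simp_all add: ham_field_def dd_ridge_sum lin_unit_vec symp_def uminus_sum_list_map o_def case_prod_unfold)
qed

text \<open>The exact time-\<open>h\<close> flow of a single ridge function. Its field has the
  constant direction \<open>symp a\<close>, on which \<open>lin a\<close> vanishes by antisymmetry,
  so the argument of the sine is conserved and orbits are straight lines run at constant
  speed.\<close>

definition ridge_map :: "real \<Rightarrow> real \<times> real \<times> ('n + 'n \<Rightarrow> real) \<Rightarrow> ('n::finite) cpt \<Rightarrow> 'n cpt" where
  "ridge_map h x z = (case x of (c, \<phi>, a) \<Rightarrow> z - (of_real (h * c) * sin (lin a z + of_real \<phi>)) *\<^sub>C cv (symp a))"

primrec ridge_step :: "real \<Rightarrow> (real \<times> real \<times> ('n + 'n \<Rightarrow> real)) list \<Rightarrow> ('n::finite) cpt \<Rightarrow> 'n cpt" where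
  "ridge_step h [] z = z"
| "ridge_step h (x # L) z = ridge_step h L (ridge_map h x z)"

text \<open>Sines of real linear forms are bounded and Lipschitz wherever the imaginary parts are
  bounded; real parts, unbounded on the tube, may be ignored.\<close>

definition im_strip :: "real \<Rightarrow> ('n::finite) cpt set" where
  "im_strip \<rho> = {z. \<forall>j. \<bar>Im (coord j z)\<bar> \<le> \<rho>}"

lemma cmod_lin_le: "cmod (lin a z) \<le> (\<Sum>j\<in>UNIV. \<bar>a j\<bar>) * norm z"
proof -
  have "cmod (lin a z) \<le> (\<Sum>j\<in>UNIV. \<bar>a j\<bar> * norm z)"
    unfolding lin_def by (rule order_trans[OF norm_sum sum_mono]) (auto simp: norm_mult intro!: mult_left_mono norm_coord_le)
  then show ?thesis by (simp add: sum_distrib_right)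
qed

lemma Im_lin_le: "z \<in> im_strip \<rho> \<Longrightarrow> \<bar>Im (lin a z)\<bar> \<le> (\<Sum>j\<in>UNIV. \<bar>a j\<bar>) * \<rho>"
  unfolding lin_def Im_sum sum_distrib_right
  by (rule order_trans[OF sum_abs sum_mono]) (auto simp: im_strip_def abs_mult intro!: mult_left_mono)

lemma sin_lin_lipschitz:
  assumes "z \<in> im_strip \<rho>" "w \<in> im_strip \<rho>"
  shows "cmod (sin (lin a z + of_real \<phi>) - sin (lin a w + of_real \<phi>)) \<le>
     exp ((\<Sum>j\<in>UNIV. \<bar>a j\<bar>) * \<rho>) * ((\<Sum>j\<in>UNIV. \<bar>a j\<bar>) * norm (z - w))"
proof -
  have "cmod (sin (lin a z + of_real \<phi>) - sin (lin a w + of_real \<phi>)) \<le>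
     exp ((\<Sum>j\<in>UNIV. \<bar>a j\<bar>) * \<rho>) * cmod ((lin a z + of_real \<phi>) - (lin a w + of_real \<phi>))"
    by (rule cmod_sin_diff_le) (use Im_lin_le[OF assms(1), of a] Im_lin_le[OF assms(2), of a] in auto)
  also have "(lin a z + of_real \<phi>) - (lin a w + of_real \<phi>) = lin a (z - w)" by (simp add: lin_diff)
  also have "exp ((\<Sum>j\<in>UNIV. \<bar>a j\<bar>) * \<rho>) * cmod (lin a (z - w)) \<le> exp ((\<Sum>j\<in>UNIV. \<bar>a j\<bar>) * \<rho>) * ((\<Sum>j\<in>UNIV. \<bar>a j\<bar>) * norm (z - w))"
    by (intro mult_left_mono cmod_lin_le) auto
  finally show ?thesis .
qed

lemma ridge_field_lipschitz:
  "\<exists>\<Lambda>\<ge>0. \<forall>z\<in>im_strip \<rho>. \<forall>w\<in>im_strip \<rho>. norm (ridge_field L z - ridge_field L w) \<le> \<Lambda> * norm (z - w)"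
proof (induction L)
  case Nil
  show ?case by (rule exI[of _ 0]) (simp add: ridge_field_def)
next
  case (Cons x L)
  obtain \<Lambda> where \<Lambda>: "\<Lambda> \<ge> 0" "\<And>z w. z \<in> im_strip \<rho> \<Longrightarrow> w \<in> im_strip \<rho> \<Longrightarrow> norm (ridge_field L z - ridge_field L w) \<le> \<Lambda> * norm (z - w)"
    using Cons by blast
  obtain c \<phi> a where x: "x = (c, \<phi>, a)" by (cases x)
  let ?A = "\<Sum>j\<in>UNIV. \<bar>a j\<bar>"
  define D where "D = \<bar>c\<bar> * (exp (?A * \<rho>) * ?A) * norm (symp a)"
  have "norm (ridge_field (x # L) z - ridge_field (x # L) w) \<le> (D + \<Lambda>) * norm (z - w)"
    if zw: "z \<in> im_strip \<rho>" "w \<in> im_strip \<rho>" for z w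
  proof -
    let ?s = "\<lambda>z. sin (lin a z + of_real \<phi>)"
    have "ridge_field (x # L) z - ridge_field (x # L) w =
        (of_real (- c) * (?s z - ?s w)) *\<^sub>C cv (symp a) + (ridge_field L z - ridge_field L w)"
      by (rule coord_eqI) (simp add: ridge_field_def x algebra_simps)
    then have "norm (ridge_field (x # L) z - ridge_field (x # L) w) \<le>
        norm ((of_real (- c) * (?s z - ?s w)) *\<^sub>C cv (symp a)) + norm (ridge_field L z - ridge_field L w)"
      using norm_triangle_ineq by metis
    also have "norm ((of_real (- c) * (?s z - ?s w)) *\<^sub>C cv (symp a)) = \<bar>c\<bar> * cmod (?s z - ?s w) * norm (symp a)"
      by (simp add: norm_scaleC norm_mult)
    also have "\<bar>c\<bar> * cmod (?s z - ?s w) * norm (symp a) \<le> \<bar>c\<bar> * (exp (?A * \<rho>) * (?A * norm (z - w))) * norm (symp a)"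
      by (intro mult_right_mono mult_left_mono sin_lin_lipschitz zw) auto
    finally show ?thesis using \<Lambda>(2)[OF zw] by (simp add: D_def algebra_simps)
  qed
  moreover have "D \<ge> 0" by (auto simp: D_def intro!: mult_nonneg_nonneg sum_nonneg)
  ultimately show ?case using \<Lambda>(1) by (intro exI[of _ "D + \<Lambda>"]) auto
qed

text \<open>First-order consistency of the Lie splitting. After the first ridge flow the rest of the
  list acts at a displaced point \<open>w\<close>; as \<open>w - z\<close> is of order
  \<open>h\<close>, evaluating the remaining field at \<open>w\<close> costs order
  \<open>h^2\<close>. The width \<rho> is generalized because \<open>w\<close> may leave the
  strip.\<close>

lemma ridge_step_expansion:
  assumes "\<rho> \<ge> 0"
  shows "\<exists>C\<ge>0. \<exists>h0>0. \<forall>h\<in>{0..h0}. \<forall>z\<in>im_strip \<rho>. norm (ridge_step h L z - z - h *\<^sub>R ridge_field L z) \<le> C * h^2"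
  using assms
proof (induction L arbitrary: \<rho>)
  case Nil
  show ?case by (rule exI[of _ 0]) (auto simp: ridge_field_def intro: exI[of _ 1])
next
  case (Cons x L)
  obtain c \<phi> a where x: "x = (c, \<phi>, a)" by (cases x)
  have "\<rho> + 1 \<ge> 0" using Cons.prems by simp
  from Cons.IH[OF this] obtain C h0 where C: "C \<ge> 0" and h0: "h0 > 0" and
    step: "\<And>h z. h \<in> {0..h0} \<Longrightarrow> z \<in> im_strip (\<rho> + 1) \<Longrightarrow> norm (ridge_step h L z - z - h *\<^sub>R ridge_field L z) \<le> C * h^2"
    by blast
  obtain \<Lambda> where \<Lambda>: "\<Lambda> \<ge> 0" "\<And>z w. z \<in> im_strip (\<rho> + 1) \<Longrightarrow> w \<in> im_strip (\<rho> + 1) \<Longrightarrow> norm (ridge_field L z - ridge_field L w) \<le> \<Lambda> * norm (z - w)"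
    using ridge_field_lipschitz[of "\<rho> + 1" L] by blast
  let ?A = "\<Sum>j\<in>UNIV. \<bar>a j\<bar>"
  define D where "D = \<bar>c\<bar> * exp (?A * \<rho>) * norm (symp a)"
  have D: "D \<ge> 0" by (simp add: D_def)
  \<comment> \<open>The displacement is at most \<open>h * D\<close>, so this bound on
    \<open>h\<close> keeps \<open>w\<close> within the strip widened by 1.\<close>
  define h1 where "h1 = min h0 (1 / (D + 1))"
  have h1: "h1 > 0" using h0 D by (simp add: h1_def)
  have "norm (ridge_step h (x # L) z - z - h *\<^sub>R ridge_field (x # L) z) \<le> (C + \<Lambda> * D) * h^2"
    if h: "h \<in> {0..h1}" and z: "z \<in> im_strip \<rho>" for h z
  proof -
    let ?s = "sin (lin a z + of_real \<phi>)"
    define w where "w = ridge_map h x z"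
    have w: "w = z - (of_real (h * c) * ?s) *\<^sub>C cv (symp a)" by (simp add: w_def ridge_map_def x)
    have s: "cmod ?s \<le> exp (?A * \<rho>)"
    proof -
      have "cmod ?s \<le> exp \<bar>Im (lin a z + of_real \<phi>)\<bar>" using cmod_sin_le_exp[of 1 "lin a z + of_real \<phi>"] by simp
      also have "\<dots> \<le> exp (?A * \<rho>)" using Im_lin_le[OF z] by simp
      finally show ?thesis .
    qed
    have "norm (w - z) = h * (\<bar>c\<bar> * cmod ?s * norm (symp a))"
      using h by (simp add: w norm_scaleC norm_mult abs_mult)
    also have "\<dots> \<le> h * D" unfolding D_def using h s by (intro mult_left_mono mult_right_mono) auto
    finally have wz: "norm (w - z) \<le> h * D" .
    have "h * D \<le> 1 / (D + 1) * D" using h D by (intro mult_right_mono) (auto simp: h1_def)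
    also have "\<dots> \<le> 1" using D by (simp add: field_simps)
    finally have hD: "h * D \<le> 1" .
    have z1: "z \<in> im_strip (\<rho> + 1)" using z by (auto simp: im_strip_def intro: order_trans)
    have w1: "w \<in> im_strip (\<rho> + 1)"
      unfolding im_strip_def
    proof (intro CollectI allI)
      fix j
      have "\<bar>Im (coord j w)\<bar> \<le> \<bar>Im (coord j z)\<bar> + \<bar>Im (coord j (w - z))\<bar>" by simp
      also have "\<bar>Im (coord j (w - z))\<bar> \<le> norm (w - z)"
        using abs_Im_le_cmod norm_coord_le order_trans by blast
      finally show "\<bar>Im (coord j w)\<bar> \<le> \<rho> + 1" using z wz hD by (auto simp: im_strip_def dest!: spec[of _ j])
    qed
    have hh: "h \<in> {0..h0}" using h by (simp add: h1_def)
    have eq: "ridge_step h (x # L) z - z - h *\<^sub>R ridge_field (x # L) z =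
       (ridge_step h L w - w - h *\<^sub>R ridge_field L w) + h *\<^sub>R (ridge_field L w - ridge_field L z)"
    proof -
      have "h *\<^sub>R ridge_field (x # L) z = w - z + h *\<^sub>R ridge_field L z"
        unfolding w ridge_field_def x
        by (rule coord_eqI) (simp add: scaleC_of_real[symmetric] algebra_simps scaleR_conv_of_real)
      then show ?thesis by (simp add: w_def algebra_simps)
    qed
    have "norm (h *\<^sub>R (ridge_field L w - ridge_field L z)) \<le> h * (\<Lambda> * (h * D))"
    proof -
      have "norm (ridge_field L w - ridge_field L z) \<le> \<Lambda> * norm (w - z)" by (rule \<Lambda>(2)[OF w1 z1])
      also have "\<dots> \<le> \<Lambda> * (h * D)" using wz \<Lambda>(1) by (rule mult_left_mono)
      finally show ?thesis using h by (simp add: mult_left_mono)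
    qed
    then have "norm (ridge_step h (x # L) z - z - h *\<^sub>R ridge_field (x # L) z) \<le> C * h^2 + h * (\<Lambda> * (h * D))"
      unfolding eq using step[OF hh w1] by (intro norm_triangle_le add_mono)
    also have "\<dots> = (C + \<Lambda> * D) * h^2" by (simp add: power2_eq_square algebra_simps)
    finally show ?thesis .
  qed
  moreover have "C + \<Lambda> * D \<ge> 0" using C \<Lambda> D by simp
  ultimately show ?case using h1 by blast
qed

section \<open>Generators of shears\<close>

lemma real_analyticI:
  assumes "\<And>z. cdiff \<Phi> z" "\<And>y. \<Phi> (cvec y) = complex_of_real (\<phi> y)"
  shows "real_analytic \<phi>"
  unfolding real_analytic_def cholomorphic_on_cdiff
  by (intro allI exI[of _ UNIV] exI[of _ \<Phi>]) (use assms in auto)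

definition clinear_form :: "real ^ 'n \<Rightarrow> complex ^ 'n \<Rightarrow> complex" where
  "clinear_form a z = (\<Sum>i\<in>UNIV. of_real (a $ i) * z $ i)"

lemma cdiff_clinear_form [cdiff_intros]: "cdiff g z \<Longrightarrow> cdiff (\<lambda>x. clinear_form a (g x)) z"
  unfolding clinear_form_def by (intro cdiff_intros)

lemma clinear_form_cvec: "clinear_form a (cvec x) = of_real (a \<bullet> x)"
  by (simp add: clinear_form_def inner_vec_def)

lemma GDERIV_ridge: "GDERIV (\<lambda>q. C * cos (a \<bullet> q + \<phi>)) q :> (- C * sin (a \<bullet> q + \<phi>)) *\<^sub>R (a :: real ^ 'n)"
  unfolding gderiv_def
  by (auto intro!: derivative_eq_intros simp: inner_commute)

lemma real_analytic_ridge: "real_analytic (\<lambda>q. C * cos (a \<bullet> q + \<phi>))"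
  by (rule real_analyticI[of "\<lambda>z. of_real C * cos (clinear_form a z + of_real \<phi>)"])
     (auto intro!: cdiff_intros simp: clinear_form_cvec cos_of_real[symmetric])

text \<open>
  For \<open>a \<noteq> 0\<close> the map \<open>S = swap_map a b\<close> is symmetric, with potential \<open>swap_form a b\<close>, and \<open>S a = b\<close>,
  so conjugation with \<open>q \<mapsto> q + S p\<close> turns the vertical shear of a function of \<open>a \<bullet> q\<close> into the flow of the same function of \<open>a \<bullet> q + b \<bullet> p\<close>.
\<close>

definition swap_form :: "real ^ 'n \<Rightarrow> real ^ 'n \<Rightarrow> real ^ 'n \<Rightarrow> real" where
  "swap_form a b p = (let k = inverse (a \<bullet> a) in
     k * ((a \<bullet> p) * (b \<bullet> p)) - k\<^sup>2 / 2 * (a \<bullet> b) * ((a \<bullet> p) * (a \<bullet> p)))"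

text \<open>The symmetric matrix \<open>k (a b^T + b a^T) - k^2 (a . b) a a^T\<close> with
  \<open>k = 1 / |a|^2\<close>. The first term sends \<open>a\<close> to \<open>b\<close> plus a
  multiple of \<open>a\<close>, which the last term removes.\<close>

definition swap_map :: "real ^ 'n \<Rightarrow> real ^ 'n \<Rightarrow> real ^ 'n \<Rightarrow> real ^ 'n" where
  "swap_map a b p = (let k = inverse (a \<bullet> a) in
     (k * (b \<bullet> p)) *\<^sub>R a + (k * (a \<bullet> p)) *\<^sub>R b - (k\<^sup>2 * (a \<bullet> b) * (a \<bullet> p)) *\<^sub>R a)"

lemma GDERIV_swap_form: "GDERIV (\<lambda>p. c * swap_form a b p) p :> c *\<^sub>R swap_map a b p"
  unfolding gderiv_def swap_form_def swap_map_def Let_def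
  by (auto intro!: derivative_eq_intros simp: fun_eq_iff inner_add_left inner_diff_left inner_add_right inner_diff_right
      inner_commute algebra_simps)

lemma real_analytic_swap_form: "real_analytic (\<lambda>p. c * swap_form a b p)"
proof -
  define k where "k = inverse (a \<bullet> a)"
  show ?thesis
  proof (rule real_analyticI)
    let ?\<Phi> = "\<lambda>z. of_real c * (of_real k * (clinear_form a z * clinear_form b z) -
          of_real (k\<^sup>2 / 2 * (a \<bullet> b)) * (clinear_form a z * clinear_form a z))"
    show "cdiff ?\<Phi> z" for z by (intro cdiff_intros)
    show "?\<Phi> (cvec y) = of_real (c * swap_form a b y)" for y
      by (simp add: clinear_form_cvec swap_form_def Let_def k_def)
  qed
qed

lemma swap_map_a: "a \<noteq> 0 \<Longrightarrow> swap_map a b a = b"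
  by (simp add: swap_map_def Let_def power2_eq_square inner_commute)

lemma inner_swap_map: "a \<noteq> 0 \<Longrightarrow> a \<bullet> swap_map a b p = b \<bullet> p"
  by (simp add: swap_map_def Let_def inner_add_right inner_diff_right power2_eq_square inverse_eq_divide)

lemma swap_map_add: "swap_map a b (p + s *\<^sub>R p') = swap_map a b p + s *\<^sub>R swap_map a b p'"
  by (simp add: swap_map_def Let_def inner_add_right algebra_simps)

definition real_ridge_map :: "real \<Rightarrow> real \<times> real \<times> ('n + 'n \<Rightarrow> real) \<Rightarrow> ('n::finite) rpt \<Rightarrow> 'n rpt" where
  "real_ridge_map h x z = (case x of (c, \<phi>, a) \<Rightarrow>
     z - (h * c * sin ((\<Sum>j\<in>UNIV. a j * coord j z) + \<phi>)) *\<^sub>R symp a)"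

lemma ridge_map_cv: "ridge_map h x (cv z) = cv (real_ridge_map h x z)"
proof -
  obtain c \<phi> a where x: "x = (c, \<phi>, a)" by (cases x)
  have "lin a (cv z) + of_real \<phi> = of_real ((\<Sum>j\<in>UNIV. a j * coord j z) + \<phi>)" by (simp add: lin_def)
  then have "(of_real (h * c) * sin (lin a (cv z) + of_real \<phi>)) = complex_of_real (h * c * sin ((\<Sum>j\<in>UNIV. a j * coord j z) + \<phi>))"
    by (simp only: sin_of_real of_real_mult)
  then show ?thesis by (simp add: ridge_map_def real_ridge_map_def x cv_simps scaleC_of_real del: of_real_mult)
qed

section \<open>Phase space as a quotient\<close>

text \<open>The properties shared by the two bases: both are quotients by
  \<open>lattice per\<close>, with projections that do not increase distances. Openness of the
  complex projection makes images of tubes open, and \<open>compact_base\<close> provides bounded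
  lifts of compact sets.\<close>

locale covered_base =
  fixes B :: "('n::finite, 'b::metric_space, 'c::metric_space) base_space" and per :: bool
  assumes base_proj_eq: "base_proj B q = base_proj B q' \<longleftrightarrow> (\<exists>k\<in>lattice per. q' = q + int_vec k)"
    and base_cproj_eq: "base_cproj B w = base_cproj B w' \<longleftrightarrow> (\<exists>k\<in>lattice per. w' = w + int_vec k)"
    and surj_base_proj: "surj (base_proj B)"
    and base_incl: "base_incl B (base_proj B q) = base_cproj B (cvec q)"
    and dist_base_proj: "dist (base_proj B q) (base_proj B q') \<le> dist q q'"
    and dist_base_cproj: "dist (base_cproj B w) (base_cproj B w') \<le> dist w w'"
    and open_base_cproj: "open U \<Longrightarrow> open (base_cproj B ` U)"
    and compact_base: "compact K \<Longrightarrow> \<exists>R. K \<subseteq> base_proj B ` {q. \<forall>i. \<bar>q $ i\<bar> \<le> R}"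
begin

lemma proj_eq: "proj B x = proj B y \<longleftrightarrow> (\<exists>k\<in>lattice per. y = x + shift k)"
  by (cases x; cases y) (auto simp: proj_def base_proj_eq shift_def)

lemma cproj_eq: "cproj B z = cproj B w \<longleftrightarrow> (\<exists>k\<in>lattice per. w = z + shift k)"
  by (cases z; cases w) (auto simp: cproj_def base_cproj_eq shift_def)

lemma proj_shift: "k \<in> lattice per \<Longrightarrow> proj B (x + shift k) = proj B x"
  using proj_eq[of x "x + shift k"] by auto

lemma cproj_shift: "k \<in> lattice per \<Longrightarrow> cproj B (z + shift k) = cproj B z"
  using cproj_eq[of z "z + shift k"] by auto

lemma base_proj_shift: "k \<in> lattice per \<Longrightarrow> base_proj B (q + int_vec k) = base_proj B q"
  using base_proj_eq[of q "q + int_vec k"] by auto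

lemma proj_surj: obtains x where "y = proj B x"
proof -
  obtain q where "fst y = base_proj B q" using surj_base_proj by (metis surjD)
  then have "y = proj B (q, snd y)" by (cases y) (simp add: proj_def)
  then show thesis by (rule that)
qed

lemma incl_proj: "incl B (proj B x) = cproj B (cv x)"
  by (cases x) (simp add: incl_def proj_def cproj_def cv_def base_incl)

lemma dist_cproj: "dist (cproj B z) (cproj B w) \<le> dist z w"
  by (cases z; cases w) (auto simp: cproj_def dist_Pair_Pair intro!: real_sqrt_le_mono add_mono power_mono dist_base_cproj)

lemma dist_proj: "dist (proj B x) (proj B y) \<le> dist x y"
  by (cases x; cases y) (auto simp: proj_def dist_Pair_Pair intro!: real_sqrt_le_mono add_mono power_mono dist_base_proj)

lemma continuous_on_cproj: "continuous_on S (cproj B)"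
  unfolding continuous_on_iff using dist_cproj by (meson le_less_trans)

lemma continuous_on_proj: "continuous_on S (proj B)"
  unfolding continuous_on_iff using dist_proj by (meson le_less_trans)

lemma open_cproj:
  assumes "open U"
  shows "open (cproj B ` U)"
  unfolding open_prod_def
proof
  fix y assume "y \<in> cproj B ` U"
  then obtain q p where qp: "(q, p) \<in> U" "y = (base_cproj B q, p)" unfolding cproj_def by auto
  obtain A C where AC0: "open A" "open C" "(q, p) \<in> A \<times> C" "A \<times> C \<subseteq> U"
    using open_prod_elim[OF assms qp(1)] .
  then have AC: "open A" "open C" "q \<in> A" "p \<in> C" "A \<times> C \<subseteq> U" by simp_all
  have sub: "base_cproj B ` A \<times> C \<subseteq> cproj B ` U"
  proof
    fix w assume "w \<in> base_cproj B ` A \<times> C"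
    then obtain q' p' where "w = cproj B (q', p')" "(q', p') \<in> A \<times> C" by (auto simp: cproj_def)
    then show "w \<in> cproj B ` U" using AC(5) by blast
  qed
  then show "\<exists>A C. open A \<and> open C \<and> y \<in> A \<times> C \<and> A \<times> C \<subseteq> cproj B ` U"
  proof (intro exI conjI)
    show "open (base_cproj B ` A)" by (rule open_base_cproj[OF AC(1)])
    show "y \<in> base_cproj B ` A \<times> C" using AC(3,4) by (simp add: qp(2))
    show "open C" by (rule AC(2))
    show "base_cproj B ` A \<times> C \<subseteq> cproj B ` U" by (rule sub)
  qed
qed

lemma compact_proj_box:
  assumes "compact K"
  shows "\<exists>R>0. K \<subseteq> proj B ` phase_box R"
proof -
  obtain R1 where R1: "fst ` K \<subseteq> base_proj B ` {q. \<forall>i. \<bar>q $ i\<bar> \<le> R1}"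
    using compact_base[OF compact_continuous_image[OF _ assms]] continuous_on_fst[OF continuous_on_id] by metis
  have "compact (snd ` K)" by (intro compact_continuous_image assms continuous_intros)
  then obtain R2 where R2: "\<And>p. p \<in> snd ` K \<Longrightarrow> norm p \<le> R2" by (meson bounded_iff compact_imp_bounded)
  define R where "R = max 1 (max R1 R2)"
  have "K \<subseteq> proj B ` phase_box R"
  proof
    fix y assume y: "y \<in> K"
    then obtain q :: "real ^ 'n" where q: "fst y = base_proj B q" "\<And>i. \<bar>q $ i\<bar> \<le> R1" using R1 by blast
    have p: "\<bar>snd y $ i\<bar> \<le> R2" for i using R2[of "snd y"] y component_le_norm_cart[of "snd y" i] by fastforce
    have "(q, snd y) \<in> phase_box R"
      unfolding phase_box_def
    proof (intro CollectI allI)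
      fix j show "\<bar>coord j (q, snd y)\<bar> \<le> R"
        using q(2) p by (cases j) (auto simp: coord_def R_def le_max_iff_disj)
    qed
    moreover have "y = proj B (q, snd y)" using q(1) by (cases y) (simp add: proj_def)
    ultimately show "y \<in> proj B ` phase_box R" by blast
  qed
  then show ?thesis by (intro exI[of _ R]) (simp add: R_def)
qed

section \<open>Ridge maps are compositions of shears\<close>

text \<open>An entire map of the covering that commutes with the lattice, bundled with the actual
  composition of shears that it covers on real points. The bundle is stable under composition, so
  whole schemes inherit all three properties at once.\<close>

definition shear_lift :: "('n cpt \<Rightarrow> 'n cpt) \<Rightarrow> bool" where
  "shear_lift P \<longleftrightarrow> cholomorphic_on P UNIV \<and> (\<forall>z. \<forall>k\<in>lattice per. P (z + shift k) = P z + shift k) \<and>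
     (\<exists>G g. (\<forall>x. P (cv x) = cv (G x)) \<and> shear_composition B g \<and> (\<forall>x. g (proj B x) = proj B (G x)))"

lemma fold_comp_id:
  fixes f :: "'d \<Rightarrow> 'd"
  shows "fold (\<circ>) Ss f = fold (\<circ>) Ss id \<circ> f"
proof (induction Ss arbitrary: f)
  case (Cons S Ss)
  show ?case using Cons[of "S \<circ> f"] Cons[of S] by (simp add: o_assoc)
qed simp

lemma shear_composition_id: "shear_composition B id"
  unfolding shear_composition_def by (intro exI[of _ "[]"]) simp

lemma shear_composition_comp:
  assumes "shear_composition B g" "shear_composition B g'"
  shows "shear_composition B (g \<circ> g')"
proof -
  obtain Ss Ss' where *: "\<forall>S\<in>set Ss. vertical_shear B S \<or> horizontal_shear B S" "g = fold (\<circ>) Ss id"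
    "\<forall>S\<in>set Ss'. vertical_shear B S \<or> horizontal_shear B S" "g' = fold (\<circ>) Ss' id"
    using assms by (auto simp: shear_composition_def)
  have "g \<circ> g' = fold (\<circ>) (Ss' @ Ss) id" using fold_comp_id[of Ss "fold (\<circ>) Ss' id"] * by simp
  then show ?thesis unfolding shear_composition_def using * by (intro exI[of _ "Ss' @ Ss"]) auto
qed

lemma shear_composition_single: "vertical_shear B S \<or> horizontal_shear B S \<Longrightarrow> shear_composition B S"
  unfolding shear_composition_def by (intro exI[of _ "[S]"]) simp

lemma shear_lift_id: "shear_lift (\<lambda>z. z)"
  unfolding shear_lift_def cholomorphic_on_cdiff
  by (intro conjI ballI allI exI[of _ "\<lambda>x. x"] exI[of _ id] cdiff_id shear_composition_id) auto

lemma shear_lift_comp: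
  assumes "shear_lift P" "shear_lift Q"
  shows "shear_lift (\<lambda>z. P (Q z))"
proof -
  obtain G g G' g' where P: "\<And>x. P (cv x) = cv (G x)" "shear_composition B g" "\<And>x. g (proj B x) = proj B (G x)"
    and Q: "\<And>x. Q (cv x) = cv (G' x)" "shear_composition B g'" "\<And>x. g' (proj B x) = proj B (G' x)"
    using assms unfolding shear_lift_def by metis
  have "cholomorphic_on P UNIV" "cholomorphic_on Q UNIV" using assms unfolding shear_lift_def by blast+
  then have "cdiff P w" "cdiff Q w" for w unfolding cholomorphic_on_cdiff by blast+
  then have "cdiff (\<lambda>z. P (Q z)) w" for w by (rule cdiff_compose)
  then have "cholomorphic_on (\<lambda>z. P (Q z)) UNIV" unfolding cholomorphic_on_cdiff by blast
  moreover have "P (z + shift k) = P z + shift k" "Q (z + shift k) = Q z + shift k" if "k \<in> lattice per" for z k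
    using assms that unfolding shear_lift_def by blast+
  then have "\<forall>z. \<forall>k\<in>lattice per. P (Q (z + shift k)) = P (Q z) + shift k" by simp
  moreover have "shear_composition B (g \<circ> g')" by (rule shear_composition_comp[OF P(2) Q(2)])
  ultimately show ?thesis unfolding shear_lift_def
    using P Q by (intro conjI exI[of _ "\<lambda>x. G (G' x)"] exI[of _ "g \<circ> g'"]) auto
qed

lemma shear_lift_run:
  assumes "\<And>i. i < m \<Longrightarrow> shear_lift (P i)"
  shows "shear_lift (run P m)"
  using assms
proof (induction m)
  case 0
  then show ?case using shear_lift_id by (simp add: run.simps(1)[abs_def])
next
  case (Suc m)
  then show ?case using shear_lift_comp[of "P m" "run P m"] by (simp add: run.simps(2)[abs_def])
qed

text \<open>The shear is first given on the covering and descends through an arbitrary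
  representative: the translation of \<open>q\<close> by \<open>D p\<close> commutes with the
  lattice.\<close>

lemma horizontal_shear_exists:
  assumes "real_analytic \<tau>" "\<And>p. GDERIV \<tau> p :> D p"
  shows "\<exists>S. shear_composition B S \<and> (\<forall>x. S (proj B x) = proj B (fst x + D (snd x), snd x))"
proof -
  define rep where "rep y = (SOME q. base_proj B q = y)" for y
  have rep: "\<exists>k\<in>lattice per. rep (base_proj B q) = q + int_vec k" for q
    using someI[of "\<lambda>q'. base_proj B q' = base_proj B q" q] base_proj_eq[of q "rep (base_proj B q)"] by (simp add: rep_def)
  define S where "S y = (base_proj B (rep (fst y) + D (snd y)), snd y)" for y
  have S: "S (base_proj B q, p) = (base_proj B (q + D p), p)" for q p
  proof -
    obtain k where k: "k \<in> lattice per" "rep (base_proj B q) = q + int_vec k" using rep[of q] by blast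
    then have "rep (base_proj B q) + D p = (q + D p) + int_vec k" by (simp add: algebra_simps)
    then show ?thesis using base_proj_shift[OF k(1), of "q + D p"] by (simp only: S_def fst_conv snd_conv)
  qed
  then have "horizontal_shear B S" unfolding horizontal_shear_def using assms by blast
  then show ?thesis using S by (intro exI[of _ S]) (auto simp: proj_def shear_composition_single)
qed

lemma vertical_shear_exists:
  assumes "real_analytic v" "\<And>q. GDERIV v q :> D q" and p: "\<And>q k. k \<in> lattice per \<Longrightarrow> v (q + int_vec k) = v q"
    and Dp: "\<And>q k. k \<in> lattice per \<Longrightarrow> D (q + int_vec k) = D q"
  shows "\<exists>S. shear_composition B S \<and> (\<forall>x. S (proj B x) = proj B (fst x, snd x - D (fst x)))"
proof -
  define rep where "rep y = (SOME q. base_proj B q = y)" for y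
  have rep: "\<exists>k\<in>lattice per. rep (base_proj B q) = q + int_vec k" for q
    using someI[of "\<lambda>q'. base_proj B q' = base_proj B q" q] base_proj_eq[of q "rep (base_proj B q)"] by (simp add: rep_def)
  define S where "S y = (fst y, snd y - D (rep (fst y)))" for y
  have vrep: "v (rep (base_proj B q)) = v q" for q using rep[of q] p by auto
  have Drep: "D (rep (base_proj B q)) = D q" for q using rep[of q] Dp by auto
  have v: "(\<lambda>y. v (rep y)) \<circ> base_proj B = v" by (auto simp: vrep)
  have S: "S (base_proj B q, p) = (base_proj B q, p - D q)" for q p
    by (simp add: S_def Drep)
  have "vertical_shear B S" unfolding vertical_shear_def
    by (rule exI[of _ "\<lambda>y. v (rep y)"], rule exI[of _ D], simp only: v) (use assms S in auto)
  then show ?thesis using S by (intro exI[of _ S]) (auto simp: proj_def shear_composition_single)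
qed

text \<open>Let \<open>a1\<close>, \<open>a2\<close> be the position and momentum parts of
  \<open>a\<close>, and let \<open>S\<close> be the symmetric map with \<open>S a1 = a2\<close>.
  After \<open>q + S p\<close> the form \<open>a1 . q\<close> reads \<open>a1 . q + a2 . p\<close>;
  the vertical shear then adds \<open>s a1\<close> to \<open>p\<close>, and subtracting
  \<open>S\<close> of the new momentum leaves \<open>q - s a2\<close>. Only the vertical shear needs
  a periodic potential, and its frequency \<open>a1\<close> is admissible.\<close>

lemma real_ridge_map_shears:
  assumes "frequency per a"
  shows "\<exists>g. shear_composition B g \<and> (\<forall>x. g (proj B x) = proj B (real_ridge_map h (c, \<phi>, a) x))"
proof -
  define a1 where "a1 = (\<chi> i. a (Inl i))"
  define a2 where "a2 = (\<chi> i. a (Inr i))"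
  have sum: "(\<Sum>j\<in>UNIV. a j * coord j x) = a1 \<bullet> fst x + a2 \<bullet> snd x" for x
    by (simp add: sum_coord coord_def inner_vec_def a1_def a2_def)
  have symp: "symp a = (a2, - a1)"
    by (simp add: symp_def of_coords_def a1_def a2_def vec_eq_iff)
  let ?C = "h * c"
  have ridge: "real_ridge_map h (c, \<phi>, a) (q, p) =
      (q - (?C * sin (a1 \<bullet> q + a2 \<bullet> p + \<phi>)) *\<^sub>R a2, p + (?C * sin (a1 \<bullet> q + a2 \<bullet> p + \<phi>)) *\<^sub>R a1)" for q p
    by (simp add: real_ridge_map_def sum symp)
  show ?thesis
  proof (cases "a1 = 0")
    case True
    obtain S where "shear_composition B S" "\<And>x. S (proj B x) = proj B (fst x + (- ?C * sin (a2 \<bullet> snd x + \<phi>)) *\<^sub>R a2, snd x)"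
      using horizontal_shear_exists[OF real_analytic_ridge[of ?C a2 \<phi>] GDERIV_ridge[of ?C a2 \<phi>]] by blast
    then show ?thesis by (intro exI[of _ S]) (auto simp: ridge True)
  next
    case False
    have per_a1: "sin (a1 \<bullet> (q + int_vec k) + \<phi>) = sin (a1 \<bullet> q + \<phi>) \<and> cos (a1 \<bullet> (q + int_vec k) + \<phi>) = cos (a1 \<bullet> q + \<phi>)"
      if k: "k \<in> lattice per" for q k
    proof -
      obtain N :: int where N: "a1 \<bullet> int_vec k = 2 * pi * of_int N"
      proof (cases per)
        case True
        then obtain l :: "'n \<Rightarrow> int" where "\<And>i. a (Inl i) = 2 * pi * of_int (l i)" using assms by (auto simp: frequency_def)
        then have "a1 \<bullet> int_vec k = 2 * pi * of_int (\<Sum>i\<in>UNIV. l i * k $ i)"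
          by (simp add: inner_vec_def a1_def int_vec_def sum_distrib_left mult.assoc)
        then show ?thesis by (rule that)
      next
        case False
        then have "a1 \<bullet> int_vec k = 2 * pi * of_int 0" using k by (simp add: lattice_def)
        then show ?thesis by (rule that)
      qed
      have "a1 \<bullet> (q + int_vec k) + \<phi> = (a1 \<bullet> q + \<phi>) + 2 * pi * of_int N" by (simp add: inner_add_right N)
      then show ?thesis by (simp add: sin_add cos_add sin_int_2pin cos_int_2pin)
    qed
    obtain S1 where S1: "shear_composition B S1" "\<And>x. S1 (proj B x) = proj B (fst x + 1 *\<^sub>R swap_map a1 a2 (snd x), snd x)"
      using horizontal_shear_exists[OF real_analytic_swap_form[of 1 a1 a2] GDERIV_swap_form[of 1 a1 a2]] by blast
    obtain S3 where S3: "shear_composition B S3" "\<And>x. S3 (proj B x) = proj B (fst x + (-1) *\<^sub>R swap_map a1 a2 (snd x), snd x)"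
      using horizontal_shear_exists[OF real_analytic_swap_form[of "-1" a1 a2] GDERIV_swap_form[of "-1" a1 a2]] by blast
    obtain S2 where S2: "shear_composition B S2" "\<And>x. S2 (proj B x) = proj B (fst x, snd x - (- ?C * sin (a1 \<bullet> fst x + \<phi>)) *\<^sub>R a1)"
      using vertical_shear_exists[OF real_analytic_ridge[of ?C a1 \<phi>] GDERIV_ridge[of ?C a1 \<phi>]] per_a1 by auto
    have "S3 (S2 (S1 (proj B (q, p)))) = proj B (real_ridge_map h (c, \<phi>, a) (q, p))" for q p
    proof -
      let ?q = "q + swap_map a1 a2 p"
      have l: "a1 \<bullet> ?q = a1 \<bullet> q + a2 \<bullet> p" by (simp add: inner_add_right inner_swap_map[OF False])
      let ?s = "?C * sin (a1 \<bullet> q + a2 \<bullet> p + \<phi>)"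
      have "S2 (S1 (proj B (q, p))) = proj B (?q, p + ?s *\<^sub>R a1)" by (simp add: S1 S2 l)
      then show ?thesis by (simp add: S3 swap_map_add swap_map_a[OF False] ridge)
    qed
    then show ?thesis using S1 S2 S3
      by (intro exI[of _ "S3 \<circ> (S2 \<circ> S1)"]) (auto intro!: shear_composition_comp)
  qed
qed

lemma shear_lift_ridge_map:
  assumes "frequency per a"
  shows "shear_lift (ridge_map h (c, \<phi>, a))"
proof -
  have "cdiff (\<lambda>z. of_coords (\<lambda>j. coord j z - of_real (h * c) * sin (lin a z + of_real \<phi>) * coord j (cv (symp a))) :: 'n cpt) z" for z
    by (intro cdiff_intros)
  moreover have "(\<lambda>z. of_coords (\<lambda>j. coord j z - of_real (h * c) * sin (lin a z + of_real \<phi>) * coord j (cv (symp a))) :: 'n cpt)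
      = ridge_map h (c, \<phi>, a)"
    by (rule ext, rule coord_eqI) (simp add: ridge_map_def)
  ultimately have hol: "cholomorphic_on (ridge_map h (c, \<phi>, a)) UNIV" by (simp add: cholomorphic_on_cdiff)
  have eq: "ridge_map h (c, \<phi>, a) (z + shift k) = ridge_map h (c, \<phi>, a) z + shift k" if k: "k \<in> lattice per" for z k
  proof -
    have "\<exists>N::int. lin a (shift k) = of_int N * (2 * of_real pi)"
    proof (cases per)
      case True
      then obtain l :: "'n \<Rightarrow> int" where "\<And>i. a (Inl i) = 2 * pi * of_int (l i)" using assms by (auto simp: frequency_def)
      then have "lin a (shift k) = of_int (\<Sum>i\<in>UNIV. l i * k $ i) * (2 * of_real pi)"
        by (simp add: lin_def sum_coord coord_def shift_def int_vec_def sum_distrib_left sum_distrib_right mult_ac)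
      then show ?thesis by blast
    next
      case False
      then have "lin a (shift k) = of_int 0 * (2 * of_real pi)" using k by (simp add: lattice_def shift_simps lin_def)
      then show ?thesis by blast
    qed
    then obtain N :: int where N: "lin a (shift k) = of_int N * (2 * of_real pi)" ..
    have "sin (lin a (z + shift k) + of_real \<phi>) = sin (lin a z + of_real \<phi>)"
    proof -
      have "lin a (z + shift k) + of_real \<phi> = 2 * of_real pi * ((lin a z + of_real \<phi>) / (2 * of_real pi) + of_int N)"
        by (simp add: lin_add N field_simps)
      then have "sin (lin a (z + shift k) + of_real \<phi>) = sin (2 * of_real pi * ((lin a z + of_real \<phi>) / (2 * of_real pi)))"
        by (simp only: sin_add_int_multiple)
      then show ?thesis by simp
    qed
    then show ?thesis by (simp add: ridge_map_def)
  qed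
  obtain g where "shear_composition B g" "\<And>x. g (proj B x) = proj B (real_ridge_map h (c, \<phi>, a) x)"
    using real_ridge_map_shears[OF assms] by blast
  then show ?thesis unfolding shear_lift_def using hol eq ridge_map_cv
    by (intro conjI exI[of _ "real_ridge_map h (c, \<phi>, a)"] exI[of _ g]) auto
qed

lemma shear_lift_ridge_step:
  assumes "\<forall>(c, \<phi>, a)\<in>set L. frequency per a"
  shows "shear_lift (ridge_step h L)"
  using assms
proof (induction L)
  case Nil
  show ?case using shear_lift_id by (simp add: ridge_step.simps(1)[abs_def])
next
  case (Cons x L)
  obtain c \<phi> a where x: "x = (c, \<phi>, a)" by (cases x)
  have "shear_lift (ridge_map h x)" unfolding x by (rule shear_lift_ridge_map) (use Cons.prems x in auto)
  then show ?case using shear_lift_comp[of "ridge_step h L" "ridge_map h x"] Cons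
    by (simp add: ridge_step.simps(2)[abs_def])
qed

end

section \<open>Real solutions\<close>

text \<open>Gronwall up to the first time \<open>s\<close> at which the distance reaches \<delta>.
  Before \<open>s\<close> the Lipschitz bound holds, so \<open>exp (- \<Lambda> t)\<close> times the
  distance does not increase, which contradicts the initial condition.\<close>

lemma differential_inequality_stay:
  fixes y u :: "real \<Rightarrow> 'a::real_inner"
  assumes y: "\<And>t. t \<in> {0..1} \<Longrightarrow> (y has_vector_derivative y' t) (at t within {0..1})"
    and u: "\<And>t. t \<in> {0..1} \<Longrightarrow> (u has_vector_derivative u' t) (at t within {0..1})"
    and lip: "\<And>t. t \<in> {0..1} \<Longrightarrow> dist (y t) (u t) < \<delta> \<Longrightarrow> norm (y' t - u' t) \<le> \<Lambda> * dist (y t) (u t)"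
    and \<Lambda>: "\<Lambda> \<ge> 0" and init: "exp \<Lambda> * dist (y 0) (u 0) < \<delta>"
    and t: "t \<in> {0..1}"
  shows "dist (y t) (u t) < \<delta>"
proof (rule ccontr)
  assume neg: "\<not> dist (y t) (u t) < \<delta>"
  have cy: "continuous_on {0..1} y" "continuous_on {0..1} u"
    using has_vector_derivative_continuous[OF y] has_vector_derivative_continuous[OF u]
    unfolding continuous_on_eq_continuous_within by blast+
  define T where "T = {s \<in> {0..1}. \<delta> \<le> dist (y s) (u s)}"
  have "closed T" unfolding T_def
    by (intro continuous_on_closed_Collect_le continuous_intros cy closed_atLeastAtMost)
  moreover have "T \<subseteq> {0..1}" by (auto simp: T_def)
  ultimately have cT: "compact T" by (metis compact_Icc compact_Int_closed inf.absorb_iff2)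
  have "t \<in> T" using t neg by (simp add: T_def)
  then obtain s where s: "s \<in> T" "\<And>r. r \<in> T \<Longrightarrow> s \<le> r" using compact_attains_inf[OF cT] by blast
  have s01: "0 \<le> s" "s \<le> 1" "\<delta> \<le> dist (y s) (u s)" using s(1) by (auto simp: T_def)
  have "dist (y 0) (u 0) \<le> exp \<Lambda> * dist (y 0) (u 0)"
    using mult_right_mono[of 1 "exp \<Lambda>" "dist (y 0) (u 0)"] \<Lambda> by simp
  then have "s \<noteq> 0" using s01(3) init by auto
  then have s0: "0 < s" using s01 by simp
  \<comment> \<open>The square of the weighted distance, since the norm itself is not differentiable
    where the two curves meet.\<close>
  define g where "g r = exp (- 2 * \<Lambda> * r) * ((y r - u r) \<bullet> (y r - u r))" for r
  have "g s \<le> g 0"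
  proof (rule DERIV_nonpos_imp_decreasing_open[OF s0[THEN less_imp_le]])
    show "continuous_on {0..s} g"
      unfolding g_def by (intro continuous_intros continuous_on_subset[OF cy(1)] continuous_on_subset[OF cy(2)]) (use s01 in auto)
    fix r assume r: "0 < r" "r < s"
    then have r01: "r \<in> {0..1}" using s01 by simp
    have at: "at r within {0..1} = at r" using r s01 by (intro at_within_interior) auto
    have "\<not> r \<in> T" using s(2)[of r] r by auto
    then have close: "dist (y r) (u r) < \<delta>" using r01 by (auto simp: T_def)
    have dy: "(y has_derivative (\<lambda>h. h *\<^sub>R y' r)) (at r)" "(u has_derivative (\<lambda>h. h *\<^sub>R u' r)) (at r)"
      using y[OF r01] u[OF r01] by (auto simp: at has_vector_derivative_def)
    let ?d = "exp (- 2 * \<Lambda> * r) * (2 * ((y r - u r) \<bullet> (y' r - u' r)) - 2 * \<Lambda> * ((y r - u r) \<bullet> (y r - u r)))"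
    have "(g has_derivative (\<lambda>h. h * ?d)) (at r)"
      unfolding g_def
      by (rule derivative_eq_intros dy refl | simp)+
         (simp add: fun_eq_iff algebra_simps inner_commute)
    moreover have "(\<lambda>h. h * ?d) = (*) ?d" by (rule ext, rule mult.commute)
    ultimately have "(g has_real_derivative ?d) (at r)"
      unfolding has_field_derivative_def by (simp only:)
    moreover have "?d \<le> 0"
    proof -
      have "(y r - u r) \<bullet> (y' r - u' r) \<le> norm (y r - u r) * norm (y' r - u' r)" by (rule norm_cauchy_schwarz)
      also have "\<dots> \<le> norm (y r - u r) * (\<Lambda> * dist (y r) (u r))" using lip[OF r01 close] by (intro mult_left_mono) auto
      also have "\<dots> = \<Lambda> * ((y r - u r) \<bullet> (y r - u r))" by (simp add: dist_norm power2_norm_eq_inner[symmetric] power2_eq_square)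
      finally show ?thesis by (intro mult_nonneg_nonpos) auto
    qed
    ultimately show "\<exists>d. (g has_real_derivative d) (at r) \<and> d \<le> 0" by blast
  qed
  moreover have g: "g r = (exp (- \<Lambda> * r) * dist (y r) (u r))\<^sup>2" for r
    by (simp add: g_def power_mult_distrib dist_norm power2_norm_eq_inner exp_double[symmetric] mult.assoc)
  ultimately have "exp (- \<Lambda> * s) * dist (y s) (u s) \<le> exp (- \<Lambda> * 0) * dist (y 0) (u 0)"
    by (simp only: g) (rule power2_le_imp_le, auto)
  moreover have "exp (- \<Lambda>) * \<delta> \<le> exp (- \<Lambda> * s) * dist (y s) (u s)"
  proof (rule mult_mono)
    show "exp (- \<Lambda>) \<le> exp (- \<Lambda> * s)" using mult_left_mono[OF s01(2) \<Lambda>] by simp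
    show "0 \<le> \<delta>" using init by (smt (verit) exp_ge_zero mult_nonneg_nonneg zero_le_dist)
  qed (use s01 in auto)
  ultimately have "exp (- \<Lambda>) * \<delta> \<le> dist (y 0) (u 0)" by simp
  then have "exp \<Lambda> * (exp (- \<Lambda>) * \<delta>) \<le> exp \<Lambda> * dist (y 0) (u 0)" by (rule mult_left_mono) simp
  moreover have "exp \<Lambda> * (exp (- \<Lambda>) * \<delta>) = \<delta>" by (simp add: exp_minus)
  ultimately show False using init by linarith
qed

lemma compact_phase_box: "compact (phase_box R :: ('n::finite) rpt set)"
proof -
  have "phase_box R = (\<Inter>j. {x :: 'n rpt. \<bar>coord j x\<bar> \<le> R})" by (auto simp: phase_box_def)
  moreover have "closed {x :: 'n rpt. \<bar>coord j x\<bar> \<le> R}" for j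
    by (cases j) (auto simp: coord_def intro!: closed_Collect_le continuous_intros)
  ultimately have "closed (phase_box R :: 'n rpt set)" by (simp add: closed_INT)
  moreover have "bounded (phase_box R :: 'n rpt set)"
    unfolding bounded_iff
  proof (intro exI[of _ "real CARD('n + 'n) * R"] ballI)
    fix x :: "'n rpt" assume "x \<in> phase_box R"
    then show "norm x \<le> real CARD('n + 'n) * R" by (intro norm_le_card_coord) (simp add: phase_box_def)
  qed
  ultimately show ?thesis by (simp add: compact_eq_bounded_closed)
qed

lemma phase_box_mono: "R \<le> R' \<Longrightarrow> phase_box R \<subseteq> phase_box R'"
  unfolding phase_box_def by (blast intro: order_trans)

lemma phase_box_dist:
  assumes "x \<in> phase_box R" "dist y x \<le> d"
  shows "y \<in> phase_box (R + d)"
  unfolding phase_box_def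
proof (intro CollectI allI)
  fix j
  have "\<bar>coord j (y - x)\<bar> \<le> d" using norm_coord_le[of j "y - x"] assms(2) by (simp add: dist_norm)
  moreover have "\<bar>coord j x\<bar> \<le> R" using assms(1) by (simp add: phase_box_def)
  ultimately show "\<bar>coord j y\<bar> \<le> R + d" by simp
qed

lemma bounded_subset_phase_box:
  assumes "bounded (S :: ('n::finite) rpt set)"
  shows "\<exists>R>0. S \<subseteq> phase_box R"
proof -
  obtain R where R: "R > 0" "\<And>x. x \<in> S \<Longrightarrow> norm x \<le> R" using assms by (auto simp: bounded_pos)
  have "x \<in> phase_box R" if "x \<in> S" for x
    unfolding phase_box_def using norm_coord_le[of _ x] R(2)[OF that] by (auto intro: order_trans)
  then show ?thesis using R(1) by blast
qed

text \<open>At a real point the complex directional derivatives along real unit vectors are the real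
  partial derivatives, so the complex field extends the field that governs the given
  solutions.\<close>

lemma ham_field_real:
  fixes \<Phi> :: "('n::finite) cpt \<Rightarrow> complex"
  assumes hol: "cdiff \<Phi> (cv x)" and U: "open U" "cv x \<in> U"
    and real: "\<And>y. cv y \<in> U \<Longrightarrow> \<Phi> (cv y) = of_real (\<phi> y)"
    and gd: "GDERIV \<phi> x :> (a, b)"
  shows "ham_field \<Phi> (cv x) = cv (b, - a)"
proof -
  obtain D where D: "(\<Phi> has_derivative D) (at (cv x))" "\<And>c v. D (c *\<^sub>C v) = c *\<^sub>C D v"
    using hol by (auto simp: cdiff_def)
  have cvD: "(cv has_derivative cv) (at x)" by (rule bounded_linear_imp_has_derivative[OF bounded_linear_cv])
  have 1: "((\<lambda>y. \<Phi> (cv y)) has_derivative (\<lambda>v. D (cv v))) (at x)"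
    by (rule has_derivative_compose[OF cvD D(1)])
  have "((\<lambda>y. complex_of_real (\<phi> y)) has_derivative (\<lambda>v. of_real (v \<bullet> (a, b)))) (at x)"
    using gd unfolding gderiv_def by (intro has_derivative_of_real)
  moreover have "open (cv -` U)"
    by (rule open_vimage[OF U(1) linear_continuous_on[OF bounded_linear_cv]])
  ultimately have "((\<lambda>y. \<Phi> (cv y)) has_derivative (\<lambda>v. of_real (v \<bullet> (a, b)))) (at x)"
    by (rule has_derivative_transform_within_open) (use U real in auto)
  from has_derivative_unique[OF 1 this] have DD: "D (cv v) = of_real (v \<bullet> (a, b))" for v by (rule fun_cong)
  have "dd \<Phi> (cv x) (unit_vec j) = of_real (coord j (a, b))" for j
  proof -
    let ?e = "of_coords (\<lambda>i. if i = j then 1 else 0) :: 'n rpt"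
    have e: "unit_vec j = cv ?e" by (rule coord_eqI) (simp add: unit_vec_def)
    have "?e \<bullet> (a, b) = (\<Sum>i\<in>UNIV. coord i ?e * coord i (a, b))"
      by (simp add: sum_coord coord_def inner_vec_def inner_prod_def)
    also have "\<dots> = (\<Sum>i\<in>UNIV. if i = j then coord i (a, b) else 0)" by (rule sum.cong) auto
    finally have "?e \<bullet> (a, b) = coord j (a, b)" by simp
    then show ?thesis using has_derivative_dd(2)[OF D] DD e by simp
  qed
  then have *: "ham_field \<Phi> (cv x) = symp (\<lambda>j. of_real (coord j (a, b)))" by (simp add: ham_field_def)
  show ?thesis unfolding *
  proof (rule coord_eqI)
    show "coord j (symp (\<lambda>j. complex_of_real (coord j (a, b)))) = coord j (cv (b, - a))" for j
      by (cases j) (simp_all add: symp_def, simp_all add: coord_def)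
  qed
qed

section \<open>Lifts of the Hamiltonians and of their solutions\<close>

locale lifted_family =
  fixes per :: bool and R r M :: real and Hh :: "real \<Rightarrow> ('n::finite) cpt \<Rightarrow> complex"
  assumes R: "R > 0" and r: "r > 0"
    and hol: "\<And>t. t \<in> {0..1} \<Longrightarrow> cholomorphic_on (Hh t) (nbhd per R r)"
    and periodic: "\<And>t z k. k \<in> lattice per \<Longrightarrow> Hh t (z + shift k) = Hh t z"
    and bounded: "\<And>t z. t \<in> {0..1} \<Longrightarrow> z \<in> nbhd per R r \<Longrightarrow> cmod (Hh t z) \<le> M"
    and time_cont: "\<And>\<eta>. \<eta> > 0 \<Longrightarrow> \<exists>d>0. \<forall>s\<in>{0..1}. \<forall>t\<in>{0..1}. \<bar>s - t\<bar> < d \<longrightarrow>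
        (\<forall>z\<in>nbhd per R r. cmod (Hh s z - Hh t z) \<le> \<eta>)"
begin

text \<open>The constants given by Cauchy's estimates on balls of radius \<open>r / 2\<close>: the
  Lipschitz estimate for \<open>ham_field\<close> needs four times its own radius, hence
  \<open>r / 8\<close>.\<close>

definition Lip :: real where "Lip = real CARD('n + 'n) * (M / (2 * (r / 8)\<^sup>2))"
definition Bnd :: real where "Bnd = real CARD('n + 'n) * (M / (r / 2))"

lemma M_nonneg: "M \<ge> 0"
proof -
  have "(0 :: 'n cpt) \<in> nbhd per R r"
    by (rule nbhdI[of 0 _ 0]) (use R r in \<open>auto simp: phase_box_def cv_simps shift_simps\<close>)
  then have "cmod (Hh 0 0) \<le> M" by (intro bounded) auto
  then show ?thesis using norm_ge_zero[of "Hh 0 0"] by linarith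
qed

lemma ball_nbhd:
  assumes "z \<in> nbhd per R (r / 2)"
  shows "ball z (r / 2) \<subseteq> nbhd per R r"
  using ball_subset_nbhd[OF assms, of "r / 2"] by simp

lemma field_difference:
  fixes f g :: "'n cpt \<Rightarrow> complex"
  assumes "\<rho> > 0" "ball z \<rho> \<subseteq> U" "cholomorphic_on f U" "cholomorphic_on g U" "\<And>w. w \<in> U \<Longrightarrow> cmod (f w - g w) \<le> e"
  shows "norm (ham_field f z - ham_field g z) \<le> real CARD('n + 'n) * (e / \<rho>)"
proof -
  have cd: "cdiff f w" "cdiff g w" if "w \<in> ball z \<rho>" for w
    using assms that by (auto simp: cholomorphic_on_cdiff)
  have "norm (ham_field (\<lambda>x. f x - g x) z) \<le> real CARD('n + 'n) * (e / \<rho>)"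
  proof (rule norm_ham_field_le[OF _ assms(1)])
    show "cholomorphic_on (\<lambda>x. f x - g x) (ball z \<rho>)"
      unfolding cholomorphic_on_cdiff by (intro ballI cdiff_diff cd)
  qed (use assms in auto)
  then show ?thesis using ham_field_diff[of f z g] cd[of z] assms(1) by simp
qed

lemma tube_field:
  assumes \<rho>: "\<rho> \<le> r / 2" and r0: "0 < r0" "r0 \<le> r / 8"
  shows "tube_field (\<lambda>t. ham_field (Hh t)) (nbhd per R \<rho>) r0 Lip Bnd"
proof
  show "0 < r0" by fact
  show "0 \<le> Lip" "0 \<le> Bnd" using M_nonneg r by (auto simp: Lip_def Bnd_def)
  have sub: "z \<in> nbhd per R (r / 2)" if "z \<in> nbhd per R \<rho>" for z :: "'n cpt"
    using nbhd_mono[OF order_refl \<rho>] that by blast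
  fix t :: real and z :: "'n cpt" assume t: "t \<in> {0..1}" and z: "z \<in> nbhd per R \<rho>"
  note b = ball_nbhd[OF sub[OF z]]
  show "norm (ham_field (Hh t) z) \<le> Bnd"
    unfolding Bnd_def by (rule norm_ham_field_le) (use b bounded[OF t] hol[OF t] r in \<open>auto intro: cholomorphic_on_subset\<close>)
  fix w assume w: "dist z w < r0"
  have "norm (ham_field (Hh t) z - ham_field (Hh t) w) \<le> real CARD('n + 'n) * (M / (2 * (r / 8)\<^sup>2)) * norm (z - w)"
    by (rule ham_field_lipschitz[of _ z])
       (use b bounded[OF t] hol[OF t] r w r0 in \<open>auto intro: cholomorphic_on_subset\<close>)
  then show "norm (ham_field (Hh t) z - ham_field (Hh t) w) \<le> Lip * dist z w"
    by (simp add: Lip_def dist_norm)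
next
  fix \<eta> :: real assume \<eta>: "\<eta> > 0"
  define c where "c = real CARD('n + 'n)"
  have c: "c > 0" by (simp add: c_def)
  define e where "e = \<eta> * (r / 2) / c"
  have e: "e > 0" using \<eta> r c by (simp add: e_def)
  obtain d where d: "d > 0" "\<And>s t z. s \<in> {0..1} \<Longrightarrow> t \<in> {0..1} \<Longrightarrow> \<bar>s - t\<bar> < d \<Longrightarrow> z \<in> nbhd per R r \<Longrightarrow> cmod (Hh s z - Hh t z) \<le> e"
    using time_cont[OF e] by metis
  have "norm (ham_field (Hh s) z - ham_field (Hh t) z) \<le> \<eta>"
    if st: "s \<in> {0..1}" "t \<in> {0..1}" "\<bar>s - t\<bar> < d" and z: "z \<in> nbhd per R \<rho>" for s t z
  proof -
    have z': "z \<in> nbhd per R (r / 2)" using nbhd_mono[OF order_refl \<rho>] z by blast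
    have "norm (ham_field (Hh s) z - ham_field (Hh t) z) \<le> real CARD('n + 'n) * (e / (r / 2))"
      by (rule field_difference[OF _ ball_nbhd[OF z'] hol hol d(2)]) (use st r in auto)
    also have "\<dots> = c * (e / (r / 2))" by (simp only: c_def)
    also have "\<dots> = \<eta>" using r c by (simp add: e_def)
    finally show ?thesis .
  qed
  then show "\<exists>d>0. \<forall>s\<in>{0..1}. \<forall>t\<in>{0..1}. \<bar>s - t\<bar> < d \<longrightarrow> (\<forall>z\<in>nbhd per R \<rho>. norm (ham_field (Hh s) z - ham_field (Hh t) z) \<le> \<eta>)"
    using d(1) by blast
qed

end

context covered_base
begin

text \<open>The definition of an analytic family gives continuity in time at each \<open>t\<close>,
  in the sup norm. Joint continuity on a compact set of representatives modulo the lattice upgrades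
  this to a common bound and to uniform continuity in time, and periodicity carries both to the
  whole tube.\<close>

lemma lifted_family_exists:
  assumes R: "R > 0" and H: "analytic_family B H"
  shows "\<exists>r M Hh. lifted_family per R r M Hh \<and>
     (\<forall>t\<in>{0..1}. \<forall>x. cv x \<in> nbhd per R r \<longrightarrow> Hh t (cv x) = complex_of_real (H t (proj B x)))"
proof -
  have "compact (proj B ` phase_box R)"
    by (intro compact_continuous_image continuous_on_proj compact_phase_box)
  then obtain W \<H> where W: "complex_nbhd B W (proj B ` phase_box R)"
    and hol: "\<And>t. t \<in> {0..1} \<Longrightarrow> cholomorphic_on (\<H> t \<circ> cproj B) (cproj B -` W)"
    and real: "\<And>t x. t \<in> {0..1} \<Longrightarrow> incl B x \<in> W \<Longrightarrow> \<H> t (incl B x) = complex_of_real (H t x)"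
    and lim: "\<And>t. t \<in> {0..1} \<Longrightarrow> uniform_limit W \<H> (\<H> t) (at t within {0..1})"
    using H unfolding analytic_family_def by metis
  define D where "D = cproj B -` W"
  have opD: "open D" unfolding D_def
    using W by (intro open_vimage continuous_on_cproj) (simp add: complex_nbhd_def)
  have cvD: "cv ` phase_box R \<subseteq> D"
    using W by (auto simp: D_def complex_nbhd_def image_subset_iff simp flip: incl_proj)
  have cK: "compact (cv ` phase_box R :: 'n cpt set)"
    by (intro compact_continuous_image linear_continuous_on bounded_linear_cv compact_phase_box)
  obtain r where r: "r > 0" and rD: "(\<Union>x\<in>cv ` phase_box R. cball x r) \<subseteq> D"
    by (rule compact_subset_open_imp_cball_epsilon_subset[OF cK opD cvD])
  \<comment> \<open>The closed tube around the box itself, without its translates. It is compact,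
    and it meets every lattice orbit in \<open>nbhd per R r\<close>.\<close>
  define C where "C = {x + y | x y. x \<in> cv ` phase_box R \<and> y \<in> cball (0 :: 'n cpt) r}"
  have cC: "compact C" unfolding C_def by (intro compact_sums cK compact_cball)
  have CD: "C \<subseteq> D"
  proof
    fix z assume "z \<in> C"
    then obtain x y where xy: "z = x + y" "x \<in> cv ` phase_box R" "norm y \<le> r" by (auto simp: C_def)
    then have "z \<in> cball x r" by (simp add: dist_norm)
    then show "z \<in> D" using rD xy(2) by blast
  qed
  define Hh where "Hh t z = \<H> t (cproj B z)" for t z
  have per: "Hh t (z + shift k) = Hh t z" if "k \<in> lattice per" for t z k
    using cproj_shift[OF that] by (simp add: Hh_def)
  have rep: "\<exists>k\<in>lattice per. z + shift k \<in> C" if z: "z \<in> nbhd per R r" for z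
  proof -
    obtain x k where x: "x \<in> phase_box R" "k \<in> lattice per" "dist z (cv x + shift k) < r"
      using z by (auto simp: nbhd_def)
    have "z + shift (- k) = cv x + (z - (cv x + shift k))" by (simp add: shift_simps)
    moreover have "z - (cv x + shift k) \<in> cball 0 r" using x(3) by (simp add: dist_norm norm_minus_commute)
    ultimately have "z + shift (- k) \<in> C" unfolding C_def using x(1) by blast
    then show ?thesis using lattice_minus[OF x(2)] by blast
  qed
  have nD: "nbhd per R r \<subseteq> D"
  proof
    fix z :: "'n cpt" assume "z \<in> nbhd per R r"
    then obtain k where "k \<in> lattice per" "z + shift k \<in> D" using rep CD by blast
    then show "z \<in> D" using cproj_shift by (simp add: D_def)
  qed
  have holD: "cholomorphic_on (Hh t) D" if "t \<in> {0..1}" for t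
    using hol[OF that] by (simp add: Hh_def[abs_def] D_def o_def)
  have cont: "continuous_on ({0..1} \<times> C) (\<lambda>p. Hh (fst p) (snd p))"
    unfolding continuous_on_iff
  proof (intro ballI allI impI)
    fix p :: "real \<times> 'n cpt" and e :: real assume p: "p \<in> {0..1} \<times> C" and e: "e > 0"
    obtain t z where tz: "p = (t, z)" "t \<in> {0..1}" "z \<in> C" using p by auto
    have "\<forall>\<^sub>F s in at t within {0..1}. \<forall>w\<in>W. dist (\<H> s w) (\<H> t w) < e / 2"
      using lim[OF tz(2), unfolded uniform_limit_iff, rule_format, OF half_gt_zero[OF e]] .
    then obtain d1 where d1: "d1 > 0" "\<And>s w. s \<in> {0..1} \<Longrightarrow> s \<noteq> t \<Longrightarrow> dist s t < d1 \<Longrightarrow> w \<in> W \<Longrightarrow> dist (\<H> s w) (\<H> t w) < e / 2"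
      unfolding eventually_at by blast
    have d1': "dist (Hh s w) (Hh t w) < e / 2" if "s \<in> {0..1}" "dist s t < d1" "w \<in> D" for s w
      using d1(2)[OF that(1) _ that(2), of "cproj B w"] that(3) e by (cases "s = t") (auto simp: Hh_def D_def)
    have "continuous_on C (Hh t)"
      by (rule continuous_on_subset[OF cholomorphic_on_continuous[OF holD[OF tz(2)]] CD])
    then obtain d2 where d2: "d2 > 0" "\<And>w. w \<in> C \<Longrightarrow> dist w z < d2 \<Longrightarrow> dist (Hh t w) (Hh t z) < e / 2"
      using tz(3) half_gt_zero[OF e] unfolding continuous_on_iff by meson
    have "dist (Hh (fst p') (snd p')) (Hh (fst p) (snd p)) < e"
      if p': "p' \<in> {0..1} \<times> C" "dist p' p < min d1 d2" for p'
    proof -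
      have "dist (fst p') t < d1" "dist (snd p') z < d2"
        using p'(2) dist_fst_le[of p' p] dist_snd_le[of p' p] by (auto simp: tz)
      then have "dist (Hh (fst p') (snd p')) (Hh t (snd p')) < e / 2" "dist (Hh t (snd p')) (Hh t z) < e / 2"
        using d1' d2(2) p'(1) CD by auto
      then show ?thesis using dist_triangle[of "Hh (fst p') (snd p')" "Hh t z" "Hh t (snd p')"] by (simp add: tz)
    qed
    then show "\<exists>d>0. \<forall>p'\<in>{0..1} \<times> C. dist p' p < d \<longrightarrow> dist (Hh (fst p') (snd p')) (Hh (fst p) (snd p)) < e"
      using d1(1) d2(1) by (intro exI[of _ "min d1 d2"]) auto
  qed
  have cTC: "compact ({0..1::real} \<times> C)" by (intro compact_Times cC compact_Icc)
  obtain M where "\<forall>y\<in>(\<lambda>p. Hh (fst p) (snd p)) ` ({0..1} \<times> C). cmod y \<le> M"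
    using compact_imp_bounded[OF compact_continuous_image[OF cont cTC]] unfolding bounded_iff by blast
  then have M: "cmod (Hh (fst p) (snd p)) \<le> M" if "p \<in> {0..1} \<times> C" for p using that by blast
  have "lifted_family per R r M Hh"
  proof
    fix t :: real assume t: "t \<in> {0..1}"
    show "cholomorphic_on (Hh t) (nbhd per R r)" by (rule cholomorphic_on_subset[OF holD[OF t] nD])
    fix z :: "'n cpt" assume "z \<in> nbhd per R r"
    then obtain k where k: "k \<in> lattice per" "z + shift k \<in> C" using rep by blast
    then show "cmod (Hh t z) \<le> M" using M[of "(t, z + shift k)"] t per[OF k(1)] by simp
  next
    fix \<eta> :: real assume \<eta>: "\<eta> > 0"
    then obtain d where d: "d > 0" "\<And>p p'. p \<in> {0..1} \<times> C \<Longrightarrow> p' \<in> {0..1} \<times> C \<Longrightarrow> dist p' p < d \<Longrightarrow>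
        dist (Hh (fst p') (snd p')) (Hh (fst p) (snd p)) < \<eta>"
      using compact_uniformly_continuous[OF cont cTC] unfolding uniformly_continuous_on_def by meson
    have "cmod (Hh s z - Hh t z) \<le> \<eta>" if st: "s \<in> {0..1}" "t \<in> {0..1}" "\<bar>s - t\<bar> < d" and z: "z \<in> nbhd per R r" for s t z
    proof -
      obtain k where k: "k \<in> lattice per" "z + shift k \<in> C" using rep[OF z] by blast
      have "dist (Hh s (z + shift k)) (Hh t (z + shift k)) < \<eta>"
        using d(2)[of "(t, z + shift k)" "(s, z + shift k)"] st k by (simp add: dist_Pair_Pair dist_real_def)
      then show ?thesis using per[OF k(1)] by (simp add: dist_norm)
    qed
    then show "\<exists>d>0. \<forall>s\<in>{0..1}. \<forall>t\<in>{0..1}. \<bar>s - t\<bar> < d \<longrightarrow> (\<forall>z\<in>nbhd per R r. cmod (Hh s z - Hh t z) \<le> \<eta>)"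
      using d(1) by blast
  qed (use R r per in auto)
  moreover have "Hh t (cv x) = complex_of_real (H t (proj B x))" if t: "t \<in> {0..1}" and x: "cv x \<in> nbhd per R r" for t x
  proof -
    have "incl B (proj B x) \<in> W" using nD x by (auto simp: D_def incl_proj)
    then show ?thesis using real[OF t] by (simp add: Hh_def flip: incl_proj)
  qed
  ultimately show ?thesis by blast
qed

definition lifted_solution :: "(real \<Rightarrow> 'b \<times> (real ^ 'n) \<Rightarrow> real) \<Rightarrow> (real \<Rightarrow> 'n rpt) \<Rightarrow> bool" where
  "lifted_solution H u \<longleftrightarrow> (\<forall>t\<in>{0..1}. \<exists>a b. GDERIV (H t \<circ> proj B) (u t) :> (a, b) \<and>
     (u has_vector_derivative (b, - a)) (at t within {0..1}))"

text \<open>Allows a solution to be lifted through any prescribed lift of its initial point.\<close>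

lemma lifted_solution_shift:
  assumes k: "k \<in> lattice per" and u: "lifted_solution H u"
  shows "lifted_solution H (\<lambda>t. u t + shift k)"
  unfolding lifted_solution_def
proof
  fix t :: real assume "t \<in> {0..1}"
  then obtain a b where ab: "GDERIV (H t \<circ> proj B) (u t) :> (a, b)" "(u has_vector_derivative (b, - a)) (at t within {0..1})"
    using u unfolding lifted_solution_def by blast
  have "((\<lambda>x. x - shift k) has_derivative (\<lambda>h. h)) (at (u t + shift k))" by (auto intro!: derivative_eq_intros)
  moreover have "(H t \<circ> proj B has_derivative (\<lambda>h. h \<bullet> (a, b))) (at ((u t + shift k) - shift k))"
    using ab(1) by (simp only: gderiv_def add_diff_cancel_right')
  ultimately have "((\<lambda>x. (H t \<circ> proj B) (x - shift k)) has_derivative (\<lambda>h. h \<bullet> (a, b))) (at (u t + shift k))"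
    by (rule has_derivative_compose)
  moreover have "(\<lambda>x. (H t \<circ> proj B) (x - shift k)) = H t \<circ> proj B"
    using proj_shift[OF lattice_minus[OF k]] by (simp add: fun_eq_iff shift_simps)
  ultimately have "GDERIV (H t \<circ> proj B) (u t + shift k) :> (a, b)" by (simp add: gderiv_def)
  moreover have "((\<lambda>t. u t + shift k) has_vector_derivative (b, - a)) (at t within {0..1})"
    using has_vector_derivative_add_const ab(2) by blast
  ultimately show "\<exists>a b. GDERIV (H t \<circ> proj B) (u t + shift k) :> (a, b) \<and>
     ((\<lambda>t. u t + shift k) has_vector_derivative (b, - a)) (at t within {0..1})" by blast
qed

lemma lifted_solution_ham_field:
  assumes u: "lifted_solution H u" and t: "t \<in> {0..1}" and lf: "lifted_family per R r M Hh"
    and real: "\<forall>t\<in>{0..1}. \<forall>x. cv x \<in> nbhd per R r \<longrightarrow> Hh t (cv x) = complex_of_real (H t (proj B x))"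
    and nb: "cv (u t) \<in> nbhd per R r"
  shows "\<exists>u'. (u has_vector_derivative u') (at t within {0..1}) \<and> cv u' = ham_field (Hh t) (cv (u t))"
proof -
  interpret lifted_family per R r M Hh by fact
  obtain a b where ab: "GDERIV (H t \<circ> proj B) (u t) :> (a, b)" "(u has_vector_derivative (b, - a)) (at t within {0..1})"
    using u t unfolding lifted_solution_def by blast
  have "ham_field (Hh t) (cv (u t)) = cv (b, - a)"
    by (rule ham_field_real[OF _ open_nbhd nb _ ab(1)])
       (use hol[OF t] nb real t in \<open>auto simp: cholomorphic_on_cdiff\<close>)
  then show ?thesis using ab(2) by metis
qed

lemma lifted_solution_continuous:
  assumes "lifted_solution H u"
  shows "continuous_on {0..1} u"
  using assms unfolding lifted_solution_def continuous_on_eq_continuous_within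
  by (meson has_vector_derivative_continuous)

text \<open>The lifted family is chosen around the given solution \<open>u\<close>, and the Gronwall
  argument traps in its neighborhood every solution that starts nearby.\<close>

lemma solutions_locally_bounded:
  assumes H: "analytic_family B H" and u: "lifted_solution H u"
  shows "\<exists>e>0. \<exists>R>0. \<forall>y. lifted_solution H y \<longrightarrow> dist (y 0) (u 0) < e \<longrightarrow> (\<forall>t\<in>{0..1}. y t \<in> phase_box R)"
proof -
  have "bounded (u ` {0..1})"
    by (intro compact_imp_bounded compact_continuous_image lifted_solution_continuous[OF u] compact_Icc)
  then obtain R where R: "R > 0" "u ` {0..1} \<subseteq> phase_box R" using bounded_subset_phase_box by blast
  note R_pos = R(1) and R_sub = R(2)
  obtain r M Hh where lf: "lifted_family per R r M Hh"
    and real: "\<forall>t\<in>{0..1}. \<forall>x. cv x \<in> nbhd per R r \<longrightarrow> Hh t (cv x) = complex_of_real (H t (proj B x))"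
    using lifted_family_exists[OF R(1) H] by blast
  interpret lifted_family per R r M Hh by fact
  define r0 where "r0 = min 1 (r / 8)"
  have r0: "r0 > 0" "r0 \<le> r / 8" "r0 \<le> r / 2" "r0 \<le> 1" "r > 0" using r by (auto simp: r0_def)
  interpret tube_field "\<lambda>t. ham_field (Hh t)" "nbhd per R (r / 2)" r0 Lip Bnd
    by (rule tube_field) (use r0 in auto)
  \<comment> \<open>Chosen so that the growth factor \<open>exp Lip\<close> brings an initial
    distance below \<open>e\<close> to less than \<open>r0\<close>.\<close>
  define e where "e = exp (- Lip) * r0"
  have e: "e > 0" using r0 by (simp add: e_def)
  have "y t \<in> phase_box (R + 1)" if y: "lifted_solution H y" and y0: "dist (y 0) (u 0) < e" and t: "t \<in> {0..1}" for y t
  proof -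
    have near: "cv x \<in> nbhd per R (r / 2)" if "dist x (u s) < r0" "s \<in> {0..1}" for x s
      by (rule nbhdI[of "u s" _ 0]) (use that \<open>u ` {0..1} \<subseteq> phase_box R\<close> r0 in \<open>auto simp: shift_simps\<close>)
    have inner: "nbhd per R (r / 2) \<subseteq> nbhd per R r" using r0(5) by (intro nbhd_mono) auto
    have u': "\<exists>u'. (u has_vector_derivative u') (at s within {0..1}) \<and> cv u' = ham_field (Hh s) (cv (u s))" if "s \<in> {0..1}" for s
      by (rule lifted_solution_ham_field[OF u that lf real]) (use subsetD[OF inner near[of "u s" s]] that r0 in simp)
    define ud where "ud s = vector_derivative u (at s within {0..1})" for s
    define yd where "yd s = vector_derivative y (at s within {0..1})" for s
    have vd: "vector_derivative w (at s within {0..1}) = w'"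
      if "(w has_vector_derivative w') (at s within {0..1})" "s \<in> {0..1}" for s and w :: "real \<Rightarrow> 'n rpt" and w'
      using vector_derivative_within_closed_interval[OF zero_less_one _ that(1)] that(2) by simp
    have ydv: "(y has_vector_derivative yd s) (at s within {0..1})" if s: "s \<in> {0..1}" for s
    proof -
      obtain w' where "(y has_vector_derivative w') (at s within {0..1})" using y s unfolding lifted_solution_def by blast
      then show ?thesis using vd s unfolding yd_def by simp
    qed
    have udv: "(u has_vector_derivative ud s) (at s within {0..1})" if s: "s \<in> {0..1}" for s
    proof -
      obtain w' where "(u has_vector_derivative w') (at s within {0..1})" using u s unfolding lifted_solution_def by blast
      then show ?thesis using vd s unfolding ud_def by simp
    qed
    have "dist (y t) (u t) < r0"
    proof (rule differential_inequality_stay[OF ydv udv _ \<Lambda> _ t])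
      show "exp Lip * dist (y 0) (u 0) < r0"
      proof -
        have "exp Lip * dist (y 0) (u 0) < exp Lip * e" using y0 by simp
        also have "\<dots> = r0" by (simp add: e_def exp_minus)
        finally show ?thesis .
      qed
      fix s :: real assume s: "s \<in> {0..1}" and close: "dist (y s) (u s) < r0"
      have nby: "cv (y s) \<in> nbhd per R (r / 2)" by (rule near[OF close s])
      have nbu: "cv (u s) \<in> nbhd per R (r / 2)" by (rule near[OF _ s]) (use r0 in simp)
      obtain y' where y': "(y has_vector_derivative y') (at s within {0..1})" "cv y' = ham_field (Hh s) (cv (y s))"
        using lifted_solution_ham_field[OF y s lf real] nby inner by blast
      obtain u' where u': "(u has_vector_derivative u') (at s within {0..1})" "cv u' = ham_field (Hh s) (cv (u s))"
        using u'[OF s] by blast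
      have eq: "yd s = y'" "ud s = u'"
        using vd[OF y'(1) s] vd[OF u'(1) s] by (simp_all add: yd_def ud_def)
      have "norm (yd s - ud s) = norm (cv y' - cv u')" by (simp add: eq flip: cv_simps)
      also have "\<dots> \<le> Lip * dist (cv (y s)) (cv (u s))"
        unfolding y'(2) u'(2) by (rule lipschitz[OF s nby nbu]) (use close in simp)
      finally show "norm (yd s - ud s) \<le> Lip * dist (y s) (u s)" by simp
    qed
    then show ?thesis using phase_box_dist[of "u t" R "y t" 1] R_sub t r0 by fastforce
  qed
  then show ?thesis using e R_pos by (intro exI[of _ e] conjI exI[of _ "R + 1"]) auto
qed

text \<open>The local bounds are made uniform over a compact box of initial values by a finite
  cover. The box thus obtained determines the tube on which the rest of the argument takes
  place.\<close>

lemma solutions_bounded: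
  assumes H: "analytic_family B H" and ex: "\<And>x. \<exists>u. lifted_solution H u \<and> u 0 = x"
  shows "\<exists>R>0. \<forall>y. lifted_solution H y \<longrightarrow> y 0 \<in> phase_box R0 \<longrightarrow> (\<forall>t\<in>{0..1}. y t \<in> phase_box R)"
proof -
  have "\<forall>x. \<exists>e R. e > 0 \<and> R > 0 \<and> (\<forall>y. lifted_solution H y \<longrightarrow> dist (y 0) x < e \<longrightarrow> (\<forall>t\<in>{0..1}. y t \<in> phase_box R))"
  proof
    fix x
    obtain u where u: "lifted_solution H u" "u 0 = x" using ex by blast
    obtain e R where "e > 0" "R > 0" "\<forall>y. lifted_solution H y \<longrightarrow> dist (y 0) (u 0) < e \<longrightarrow> (\<forall>t\<in>{0..1}. y t \<in> phase_box R)"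
      using solutions_locally_bounded[OF H u(1)] by blast
    then show "\<exists>e R. e > 0 \<and> R > 0 \<and> (\<forall>y. lifted_solution H y \<longrightarrow> dist (y 0) x < e \<longrightarrow> (\<forall>t\<in>{0..1}. y t \<in> phase_box R))"
      unfolding u(2) by blast
  qed
  then obtain e \<rho> where e: "\<And>x. e x > 0" "\<And>x. \<rho> x > (0::real)"
    "\<And>x y t. lifted_solution H y \<Longrightarrow> dist (y 0) x < e x \<Longrightarrow> t \<in> {0..1} \<Longrightarrow> y t \<in> phase_box (\<rho> x)"
    by metis
  have cover: "phase_box R0 \<subseteq> (\<Union>x\<in>phase_box R0. ball x (e x))" using e(1) by force
  obtain X where X: "X \<subseteq> phase_box R0" "finite X" "phase_box R0 \<subseteq> (\<Union>x\<in>X. ball x (e x))"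
    by (rule compactE_image[OF compact_phase_box _ cover]) auto
  define R where "R = (\<Sum>x\<in>X. \<rho> x) + 1"
  have le: "\<rho> x \<le> R" if "x \<in> X" for x
    using member_le_sum[OF that, of \<rho>] e(2) X(2) by (simp add: R_def less_imp_le add_increasing2)
  have Rpos: "R > 0" unfolding R_def using e(2) by (intro add_nonneg_pos sum_nonneg) (auto simp: less_imp_le)
  have "y t \<in> phase_box R" if y: "lifted_solution H y" "y 0 \<in> phase_box R0" "t \<in> {0..1}" for y t
  proof -
    obtain x where x: "x \<in> X" "dist (y 0) x < e x" using X(3) y(2) by (auto simp: dist_commute)
    show ?thesis using e(3)[OF y(1) x(2) y(3)] phase_box_mono[OF le[OF x(1)]] by blast
  qed
  then show ?thesis using Rpos by blast
qed

end

section \<open>The approximation theorem\<close>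

context covered_base
begin

text \<open>The step bound \<open>h0\<close> must serve all times at once. Ridge sums are therefore
  chosen only at finitely many grid times, and a general \<open>t\<close> uses the one at the
  preceding grid point. The radius \<rho> stems from \<open>ridge_sum_approx\<close> and precedes
  \<eta>.\<close>

lemma step_exists:
  assumes lf: "lifted_family per (R + 1) r M Hh" and R: "R > 0"
    and real: "\<And>t x. t \<in> {0..1} \<Longrightarrow> cv x \<in> nbhd per (R + 1) r \<Longrightarrow> Hh t (cv x) \<in> \<real>"
  shows "\<exists>\<rho>>0. \<rho> \<le> r / 2 \<and> (\<forall>\<eta>>0. \<exists>h0>0. \<forall>t\<in>{0..1}. \<forall>h. 0 < h \<longrightarrow> h < h0 \<longrightarrow>
     (\<exists>P. shear_lift P \<and> (\<forall>z\<in>nbhd per R \<rho>. norm (P z - z - h *\<^sub>R ham_field (Hh t) z) \<le> h * \<eta>)))"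
proof -
  interpret lifted_family per "R + 1" r M Hh by fact
  from ridge_sum_approx[OF \<open>R > 0\<close> r, of per] obtain r1 where r1: "r1 > 0" "r1 \<le> r" and approx:
    "\<forall>H. cholomorphic_on H (nbhd per (R + 1) r :: 'n cpt set) \<longrightarrow>
     (\<forall>z\<in>nbhd per (R + 1) r. \<forall>k\<in>lattice per. H (z + shift k) = H z) \<longrightarrow>
     (\<forall>x. cv x \<in> nbhd per (R + 1) r \<longrightarrow> H (cv x) \<in> \<real>) \<longrightarrow>
     (\<forall>e>0. \<exists>L. (\<forall>(c, \<phi>, a)\<in>set L. frequency per a) \<and> (\<forall>z\<in>nbhd per R r1. cmod (ridge_sum L z - H z) < e))"
    by (elim exE conjE) (rule that)
  have sub: "nbhd per R r1 \<subseteq> nbhd per (R + 1) r" using r1 by (intro nbhd_mono) auto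
  have main: "\<exists>h0>0. \<forall>t\<in>{0..1}. \<forall>h. 0 < h \<longrightarrow> h < h0 \<longrightarrow>
     (\<exists>P. shear_lift P \<and> (\<forall>z\<in>nbhd per R (r1 / 2). norm (P z - z - h *\<^sub>R ham_field (Hh t) z) \<le> h * \<eta>))"
    if \<eta>: "\<eta> > 0" for \<eta>
  proof -
    define c where "c = real CARD('n + 'n)"
    have c: "c > 0" by (simp add: c_def)
    \<comment> \<open>Ridge approximation and time freezing cost \<open>e\<close> each; Cauchy's
      estimate with radius \<open>r1 / 2\<close> turns \<open>2 * e\<close> into a field error of
      \<open>\<eta> / 2\<close>. The splitting error takes the other half.\<close>
    define e where "e = \<eta> * r1 / (8 * c)"
    have e: "e > 0" using \<eta> r1 c by (simp add: e_def)
    obtain d where d: "d > 0" "\<And>s t z. s \<in> {0..1} \<Longrightarrow> t \<in> {0..1} \<Longrightarrow> \<bar>s - t\<bar> < d \<Longrightarrow> z \<in> nbhd per (R + 1) r \<Longrightarrow> cmod (Hh s z - Hh t z) \<le> e"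
      using time_cont[OF e] by metis
    obtain m where m: "m > 0" "1 / real m < d" using nat_approx_posE[OF d(1)] by (metis zero_less_Suc)
    have grid: "real i / real m \<in> {0..1}" if "i \<le> m" for i using that m by auto
    have "\<exists>L. (\<forall>(c, \<phi>, a)\<in>set L. frequency per a) \<and> (\<forall>z\<in>nbhd per R r1. cmod (ridge_sum L z - Hh (real i / real m) z) < e)"
      if "i \<le> m" for i
    proof -
      note g = grid[OF that]
      show ?thesis
        by (rule approx[THEN spec, THEN mp, OF hol[OF g], THEN mp, THEN mp, rule_format, OF _ _ e])
           (use periodic real g in blast)+
    qed
    then obtain L where L: "\<And>i. i \<le> m \<Longrightarrow> \<forall>(c, \<phi>, a)\<in>set (L i). frequency per a"
      "\<And>i z. i \<le> m \<Longrightarrow> z \<in> nbhd per R r1 \<Longrightarrow> cmod (ridge_sum (L i) z - Hh (real i / real m) z) < e"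
      by metis
    have "\<forall>i. \<exists>C h0. C \<ge> 0 \<and> h0 > 0 \<and> (\<forall>h\<in>{0..h0}. \<forall>z\<in>im_strip r1. norm (ridge_step h (L i) z - z - h *\<^sub>R ridge_field (L i) z) \<le> C * h^2)"
      using ridge_step_expansion[OF less_imp_le[OF r1(1)]] by meson
    then obtain C hh where C: "\<And>i. C i \<ge> 0" "\<And>i. hh i > (0::real)"
      "\<And>i h z. h \<in> {0..hh i} \<Longrightarrow> z \<in> im_strip r1 \<Longrightarrow> norm (ridge_step h (L i) z - z - h *\<^sub>R ridge_field (L i) z) \<le> C i * h^2"
      by metis
    define h0 where "h0 = Min ((\<lambda>i. min (hh i) (\<eta> / (2 * (C i + 1)))) ` {..m})"
    have h0: "h0 > 0" unfolding h0_def
      using C \<eta> by (subst Min_gr_iff) (auto intro!: divide_pos_pos simp: add_nonneg_pos)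
    have h0_le: "h0 \<le> hh i" "h0 \<le> \<eta> / (2 * (C i + 1))" if "i \<le> m" for i
    proof -
      have "h0 \<le> min (hh i) (\<eta> / (2 * (C i + 1)))" unfolding h0_def using that by (intro Min_le) auto
      then show "h0 \<le> hh i" "h0 \<le> \<eta> / (2 * (C i + 1))" by auto
    qed
    have "\<exists>P. shear_lift P \<and> (\<forall>z\<in>nbhd per R (r1 / 2). norm (P z - z - h *\<^sub>R ham_field (Hh t) z) \<le> h * \<eta>)"
      if t: "t \<in> {0..1}" and h: "0 < h" "h < h0" for t h
    proof -
      \<comment> \<open>The grid point at or before \<open>t\<close>. The time \<open>t = 1\<close>
        gives \<open>i = m\<close>, so the grid includes both ends.\<close>
      define i where "i = nat \<lfloor>t * real m\<rfloor>"
      have i: "real i \<le> t * real m" "t * real m < real i + 1"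
        using t by (auto simp: i_def of_nat_nat)
      have "t * real m \<le> real m" using t by (simp add: mult_left_le_one_le)
      then have im: "i \<le> m" using i by linarith
      have "\<bar>real i / real m - t\<bar> = (t * real m - real i) / real m"
        using i m by (simp add: abs_if field_simps)
      also have "\<dots> \<le> 1 / real m" using i by (intro divide_right_mono) auto
      finally have ti: "\<bar>real i / real m - t\<bar> < d" using m by simp
      have diff: "cmod (ridge_sum (L i) z - Hh t z) \<le> 2 * e" if z: "z \<in> nbhd per R r1" for z
      proof -
        have "cmod (ridge_sum (L i) z - Hh (real i / real m) z) < e" by (rule L(2)[OF im z])
        moreover have "cmod (Hh (real i / real m) z - Hh t z) \<le> e"
          by (rule d(2)[OF grid[OF im] t ti]) (use z sub in blast)
        ultimately show ?thesis
          using norm_triangle_ineq[of "ridge_sum (L i) z - Hh (real i / real m) z" "Hh (real i / real m) z - Hh t z"] by simp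
      qed
      have "norm (ridge_step h (L i) z - z - h *\<^sub>R ham_field (Hh t) z) \<le> h * \<eta>" if z: "z \<in> nbhd per R (r1 / 2)" for z
      proof -
        have ball: "ball z (r1 / 2) \<subseteq> nbhd per R r1" using ball_subset_nbhd[OF z, of "r1 / 2"] by simp
        have "norm (ham_field (ridge_sum (L i)) z - ham_field (Hh t) z) \<le> real CARD('n + 'n) * (2 * e / (r1 / 2))"
        proof (rule field_difference[OF _ ball _ _ diff])
          show "cholomorphic_on (ridge_sum (L i)) (nbhd per R r1)" by (simp add: cholomorphic_on_cdiff cdiff_ridge_sum)
          show "cholomorphic_on (Hh t) (nbhd per R r1)" by (rule cholomorphic_on_subset[OF hol[OF t] sub])
        qed (use r1 in auto)
        also have "\<dots> = c * (2 * e / (r1 / 2))" by (simp only: c_def)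
        also have "\<dots> = \<eta> / 2" using r1 c by (simp add: e_def)
        finally have 1: "norm (ridge_field (L i) z - ham_field (Hh t) z) \<le> \<eta> / 2" by (simp only: ham_field_ridge_sum)
        have strip: "z \<in> im_strip r1" unfolding im_strip_def
        proof (intro CollectI allI)
          show "\<bar>Im (coord j z)\<bar> \<le> r1" for j using nbhd_Im_bound[OF z, of j] r1 by linarith
        qed
        have hi: "h \<in> {0..hh i}" using h h0_le(1)[OF im] by simp
        have "C i * h \<le> (C i + 1) * (\<eta> / (2 * (C i + 1)))"
          using h h0_le(2)[OF im] C(1)[of i] by (intro mult_mono) auto
        also have "\<dots> = \<eta> / 2"
        proof -
          have eq: "x * (\<eta> / (2 * x)) = \<eta> / 2" if "x > 0" for x using that by simp
          show ?thesis by (rule eq) (use C(1)[of i] in simp)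
        qed
        finally have "h * (C i * h) \<le> h * (\<eta> / 2)" using h by (intro mult_left_mono) auto
        then have 2: "norm (ridge_step h (L i) z - z - h *\<^sub>R ridge_field (L i) z) \<le> h * (\<eta> / 2)"
          using C(3)[OF hi strip] by (simp add: power2_eq_square mult_ac)
        have 3: "norm (h *\<^sub>R (ridge_field (L i) z - ham_field (Hh t) z)) \<le> h * (\<eta> / 2)"
          unfolding norm_scaleR using 1 h by (intro mult_mono) auto
        have eq: "ridge_step h (L i) z - z - h *\<^sub>R ham_field (Hh t) z =
            (ridge_step h (L i) z - z - h *\<^sub>R ridge_field (L i) z) + h *\<^sub>R (ridge_field (L i) z - ham_field (Hh t) z)"
          by (simp add: scaleR_diff_right)
        have "norm (ridge_step h (L i) z - z - h *\<^sub>R ham_field (Hh t) z) \<le> h * (\<eta> / 2) + h * (\<eta> / 2)"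
          unfolding eq by (rule norm_triangle_mono[OF 2 3])
        also have "\<dots> = h * \<eta>" by simp
        finally show ?thesis .
      qed
      then show ?thesis using shear_lift_ridge_step[OF L(1)[OF im]] by blast
    qed
    then show ?thesis using h0 by blast
  qed
  show ?thesis
    by (intro exI[of _ "r1 / 2"] conjI allI impI main) (use r1 in auto)
qed

lemma cproj_vimage_nbhd: "cproj B z \<in> cproj B ` nbhd per R r \<longleftrightarrow> z \<in> nbhd per R r"
proof
  assume "cproj B z \<in> cproj B ` nbhd per R r"
  then obtain w where w: "w \<in> nbhd per R r" "cproj B z = cproj B w" by auto
  then obtain k where "k \<in> lattice per" "w = z + shift k" by (auto simp: cproj_eq)
  then show "z \<in> nbhd per R r" using w(1) nbhd_shift by blast
qed simp

text \<open>Equivariance makes the value independent of the representative selected by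
  \<open>SOME\<close>, and \<Phi> itself serves as the local lift near every point. It is applied
  both to the limit map and to the approximating compositions.\<close>

lemma descend_holomorphic:
  assumes hol: "cholomorphic_on \<Phi> (nbhd per R r)"
    and equi: "\<And>z k. z \<in> nbhd per R r \<Longrightarrow> k \<in> lattice per \<Longrightarrow> \<Phi> (z + shift k) = \<Phi> z + shift k"
    and real: "\<And>x. cv x \<in> nbhd per R r \<Longrightarrow> cproj B (\<Phi> (cv x)) = incl B (f (proj B x))"
  shows "\<exists>F. (\<forall>z\<in>nbhd per R r. F (cproj B z) = cproj B (\<Phi> z)) \<and>
     holomorphic_extension B (cproj B ` nbhd per R r) f F"
proof -
  define F where "F w = cproj B (\<Phi> (SOME z. cproj B z = w))" for w
  have F: "F (cproj B z) = cproj B (\<Phi> z)" if z: "z \<in> nbhd per R r" for z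
  proof -
    define z' where "z' = (SOME z'. cproj B z' = cproj B z)"
    have "cproj B z' = cproj B z" unfolding z'_def by (rule someI) (rule refl)
    then obtain k where k: "k \<in> lattice per" "z' = z + shift k" by (metis cproj_eq)
    have "\<Phi> z' = \<Phi> z + shift k" using equi[OF z k(1)] k(2) by simp
    then show ?thesis using cproj_shift[OF k(1)] by (simp add: F_def z'_def)
  qed
  have "locally_lifts cholomorphic_on (cproj B) F (cproj B ` nbhd per R r)"
    unfolding locally_lifts_def
  proof
    fix z assume "z \<in> cproj B -` cproj B ` nbhd per R r"
    then have z: "z \<in> nbhd per R r" by (simp add: cproj_vimage_nbhd)
    show "\<exists>U G. open U \<and> z \<in> U \<and> U \<subseteq> cproj B -` cproj B ` nbhd per R r \<and> cholomorphic_on G U \<and> (\<forall>y\<in>U. F (cproj B y) = cproj B (G y))"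
      by (rule exI[of _ "nbhd per R r"], rule exI[of _ \<Phi>]) (use z hol F open_nbhd in auto)
  qed
  moreover have "F (incl B y) = incl B (f y)" if y: "incl B y \<in> cproj B ` nbhd per R r" for y
  proof -
    obtain x where x: "y = proj B x" by (rule proj_surj)
    then have "cv x \<in> nbhd per R r" using y by (simp add: incl_proj cproj_vimage_nbhd)
    then show ?thesis using F[of "cv x"] real by (simp add: x incl_proj)
  qed
  ultimately show ?thesis using F unfolding holomorphic_extension_def by blast
qed

theorem hamiltonian_map_approximation:
  assumes f: "hamiltonian_map B f" and K: "compact K"
  shows "\<exists>W F. complex_nbhd B W K \<and> holomorphic_extension B W f F \<and>
     (\<forall>\<delta>>0. \<exists>g G. shear_composition B g \<and> holomorphic_extension B W g G \<and>
        (SUP z\<in>W. ereal (dist (F z) (G z))) < ereal \<delta>)"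
proof -
  obtain H where H: "analytic_family B H"
    and sol: "\<And>y. \<exists>c. hamiltonian_solution B H c \<and> c 0 = y \<and> c 1 = f y"
    using f unfolding hamiltonian_map_def by blast
  have ex: "\<exists>u. lifted_solution H u \<and> u 0 = x \<and> f (proj B x) = proj B (u 1)" for x
  proof -
    obtain c where c: "hamiltonian_solution B H c" "c 0 = proj B x" "c 1 = f (proj B x)" using sol by blast
    then obtain u where u: "\<forall>t\<in>{0..1}. c t = proj B (u t)" "lifted_solution H u"
      unfolding hamiltonian_solution_def lifted_solution_def by blast
    have "proj B (u 0) = proj B x" using u(1) c(2) by simp
    then obtain k where k: "k \<in> lattice per" "x = u 0 + shift k" by (auto simp: proj_eq)
    have "f (proj B x) = proj B (u 1 + shift k)" using u(1) c(3) proj_shift[OF k(1)] by simp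
    then show ?thesis using lifted_solution_shift[OF k(1) u(2)] k(2) by blast
  qed
  obtain R0 where R0: "R0 > 0" "K \<subseteq> proj B ` phase_box R0" using compact_proj_box[OF K] by blast
  have "\<exists>u. lifted_solution H u \<and> u 0 = x" for x using ex by blast
  from solutions_bounded[OF H this] obtain R where R: "R > 0"
    \<comment> \<open>The margin 1 in \<open>R0 + 1\<close> is for real points of the neighborhood
      outside the box: the extension must agree with \<open>f\<close> at all of them and not only on
      \<open>K\<close>.\<close>
    and Rb: "\<And>y t. lifted_solution H y \<Longrightarrow> y 0 \<in> phase_box (R0 + 1) \<Longrightarrow> t \<in> {0..1} \<Longrightarrow> y t \<in> phase_box R"
    by blast
  have "R + 1 > 0" using R by simp
  from lifted_family_exists[OF this H] obtain r M Hh where lf: "lifted_family per (R + 1) r M Hh"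
    and real: "\<forall>t\<in>{0..1}. \<forall>x. cv x \<in> nbhd per (R + 1) r \<longrightarrow> Hh t (cv x) = complex_of_real (H t (proj B x))"
    by blast
  have realH: "Hh t (cv x) \<in> \<real>" if "t \<in> {0..1}" "cv x \<in> nbhd per (R + 1) r" for t x
  proof -
    have "Hh t (cv x) = of_real (H t (proj B x))" using real that by blast
    then show ?thesis by simp
  qed
  from step_exists[OF lf R realH] obtain \<rho> where \<rho>: "\<rho> > 0" "\<rho> \<le> r / 2"
    and step: "\<And>\<eta>. \<eta> > 0 \<Longrightarrow> \<exists>h0>0. \<forall>t\<in>{0..1}. \<forall>h. 0 < h \<longrightarrow> h < h0 \<longrightarrow>
     (\<exists>P. shear_lift P \<and> (\<forall>z\<in>nbhd per R \<rho>. norm (P z - z - h *\<^sub>R ham_field (Hh t) z) \<le> h * \<eta>))"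
    by blast
  \<comment> \<open>The step estimates hold around the box of size \<open>R\<close>, whereas the
    Hamiltonians are controlled around the box of size \<open>R + 1\<close>; hence the field is
    restricted to this smaller tube.\<close>
  define \<Omega> :: "'n cpt set" where "\<Omega> = nbhd per R \<rho>"
  have \<Omega>sub: "\<Omega> \<subseteq> nbhd per (R + 1) \<rho>" "\<Omega> \<subseteq> nbhd per (R + 1) r" unfolding \<Omega>_def using \<rho> by (intro nbhd_mono; simp)+
  define r0 where "r0 = min 1 (min \<rho> (r / 8))"
  have r0: "r0 > 0" "r0 \<le> 1" "r0 \<le> \<rho>" "r0 \<le> r / 8" using \<rho> by (auto simp: r0_def)
  define \<Lambda> where "\<Lambda> = lifted_family.Lip TYPE('n) r M"
  define Bd where "Bd = lifted_family.Bnd TYPE('n) r M"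
  have tf0: "tube_field (\<lambda>t. ham_field (Hh t)) (nbhd per (R + 1) \<rho>) r0 \<Lambda> Bd"
    unfolding \<Lambda>_def Bd_def by (rule lifted_family.tube_field[OF lf \<rho>(2) r0(1) r0(4)])
  interpret tf: tube_field "\<lambda>t. ham_field (Hh t)" \<Omega> r0 \<Lambda> Bd
  proof
    show "\<exists>d>0. \<forall>s\<in>{0..1}. \<forall>t\<in>{0..1}. \<bar>s - t\<bar> < d \<longrightarrow> (\<forall>z\<in>\<Omega>. norm (ham_field (Hh s) z - ham_field (Hh t) z) \<le> \<eta>)" if "\<eta> > 0" for \<eta>
      using tube_field.time[OF tf0 that] \<Omega>sub(1) by (meson subsetD)
  qed (use tube_field.r[OF tf0] tube_field.\<Lambda>[OF tf0] tube_field.M[OF tf0] tube_field.lipschitz[OF tf0] tube_field.bound[OF tf0] \<Omega>sub(1) in blast)+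
  have "\<exists>k0. \<forall>k\<ge>k0. \<exists>P. (\<forall>i. shear_lift (P i)) \<and> tf.consistent (2 ^ k) \<eta> P" if \<eta>: "\<eta> > 0" for \<eta>
  proof -
    obtain h0 where h0: "h0 > 0" and P: "\<forall>t\<in>{0..1}. \<forall>h. 0 < h \<longrightarrow> h < h0 \<longrightarrow>
     (\<exists>P. shear_lift P \<and> (\<forall>z\<in>nbhd per R \<rho>. norm (P z - z - h *\<^sub>R ham_field (Hh t) z) \<le> h * \<eta>))"
      using step[OF \<eta>] by blast
    obtain k0 :: nat where k0: "(1 / 2) ^ k0 < h0" using real_arch_pow_inv[OF h0, of "1 / 2"] by auto
    have "\<exists>P. (\<forall>i. shear_lift (P i)) \<and> tf.consistent (2 ^ k) \<eta> P" if k: "k \<ge> k0" for k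
    proof -
      let ?h = "1 / real (2 ^ k)"
      have "?h \<le> (1 / 2) ^ k0" using power_decreasing[OF k, of "1 / 2 :: real"] by (simp add: power_one_over)
      then have h: "0 < ?h" "?h < h0" using k0 by (auto simp del: of_nat_power)
      \<comment> \<open>The identity is a default for indices from \<open>2 ^ k\<close> on, which a
        run of \<open>2 ^ k\<close> steps never reaches.\<close>
      have "\<exists>P. shear_lift P \<and> (i < 2 ^ k \<longrightarrow> (\<forall>z\<in>nbhd per R \<rho>. norm (P z - z - ?h *\<^sub>R ham_field (Hh (real i / real (2 ^ k))) z) \<le> ?h * \<eta>))" for i
      proof (cases "i < 2 ^ k")
        case True
        then have "real i / real (2 ^ k) \<in> {0..1}" by (auto simp: less_imp_le)
        then show ?thesis using P h by blast
      next
        case False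
        then show ?thesis using shear_lift_id by blast
      qed
      then obtain P where P: "\<And>i. shear_lift (P i)" "\<And>i z. i < 2 ^ k \<Longrightarrow> z \<in> nbhd per R \<rho> \<Longrightarrow>
          norm (P i z - z - ?h *\<^sub>R ham_field (Hh (real i / real (2 ^ k))) z) \<le> ?h * \<eta>" by metis
      have "tf.consistent (2 ^ k) \<eta> P"
        unfolding tf.consistent_def unfolding \<Omega>_def
      proof (intro allI impI ballI)
        fix i :: nat and z :: "'n cpt" assume "i < 2 ^ k" "z \<in> nbhd per R \<rho>"
        from P(2)[OF this] show "norm (P i z - z - ?h *\<^sub>R ham_field (Hh (real i / real (2 ^ k))) z) \<le> \<eta> / real (2 ^ k)"
          by (simp only: times_divide_eq_left mult_1)
      qed
      then show ?thesis using P(1) by blast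
    qed
    then show ?thesis by blast
  qed
  then have "\<forall>j. \<exists>k0. \<forall>k\<ge>k0. \<exists>P. (\<forall>i. shear_lift (P i)) \<and> tf.consistent (2 ^ k) (1 / real (Suc j)) P"
    by simp
  then obtain k0 where k0: "\<And>j k. k \<ge> k0 j \<Longrightarrow> \<exists>P. (\<forall>i. shear_lift (P i)) \<and> tf.consistent (2 ^ k) (1 / real (Suc j)) P"
    by metis
  \<comment> \<open>The partial sums dominate every required exponent \<open>k0 j\<close>, and the
    successors make them strictly increasing.\<close>
  define k where "k j = (\<Sum>i\<le>j. Suc (k0 i))" for j
  have kmono: "strict_mono k" by (rule strict_monoI_Suc) (simp add: k_def)
  have "k0 j \<le> k j" for j
  proof -
    have "Suc (k0 j) \<le> k j" unfolding k_def by (rule member_le_sum) auto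
    then show ?thesis by simp
  qed
  then have "\<forall>j. \<exists>P. (\<forall>i. shear_lift (P i)) \<and> tf.consistent (2 ^ k j) (1 / real (Suc j)) P" using k0 by blast
  then obtain P where P: "\<And>j i. shear_lift (P j i)" "\<And>j. tf.consistent (2 ^ k j) (1 / real (Suc j)) (P j)" by metis
  define Q where "Q j = run (P j) (2 ^ k j)" for j
  have Q: "shear_lift (Q j)" for j unfolding Q_def by (rule shear_lift_run) (rule P(1))
  \<comment> \<open>With this radius \<open>exp \<Lambda> * \<rho>0\<close> is
    \<open>r0 / 8\<close>, below the threshold \<open>r0 / 4\<close> of
    \<open>scheme_converges\<close>; it depends on neither \<delta> nor the schemes.\<close>
  define \<rho>0 where "\<rho>0 = r0 * exp (- \<Lambda>) / 8"
  have \<rho>0: "\<rho>0 > 0" "\<rho>0 \<le> 1" "exp \<Lambda> * \<rho>0 < r0 / 4"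
  proof -
    show "\<rho>0 > 0" using r0 by (simp add: \<rho>0_def)
    have "exp (- \<Lambda>) \<le> 1" using tf.\<Lambda> by simp
    then have "r0 * exp (- \<Lambda>) \<le> 1 * 1" using r0 by (intro mult_mono) auto
    then show "\<rho>0 \<le> 1" by (simp add: \<rho>0_def)
    show "exp \<Lambda> * \<rho>0 < r0 / 4" using r0 by (simp add: \<rho>0_def exp_minus)
  qed
  define S :: "'n cpt set" where "S = {cv x + shift l | x l. x \<in> phase_box (R0 + 1) \<and> l \<in> lattice per}"
  have traj: "\<exists>u. tf.trajectory (\<lambda>t. cv (u t)) \<and> u 0 = x + shift l \<and> f (proj B (x + shift l)) = proj B (u 1)"
    if x: "x \<in> phase_box (R0 + 1)" and l: "l \<in> lattice per" for x l
  proof -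
    \<comment> \<open>The solution starts at the translated point. It is moved back by
      \<open>- l\<close> only to apply the bound on solutions; its image under \<open>cv\<close>
      lies in the tube by lattice invariance.\<close>
    obtain u where u: "lifted_solution H u" "u 0 = x + shift l" "f (proj B (x + shift l)) = proj B (u 1)" using ex by blast
    have us: "lifted_solution H (\<lambda>t. u t + shift (- l))" by (rule lifted_solution_shift[OF lattice_minus[OF l] u(1)])
    have inb: "u t + shift (- l) \<in> phase_box R" if "t \<in> {0..1}" for t
      using Rb[OF us _ that] x by (simp add: u(2) shift_simps)
    have ballu: "ball (cv (u t)) r0 \<subseteq> \<Omega>" if t: "t \<in> {0..1}" for t
    proof
      fix z assume z: "z \<in> ball (cv (u t)) r0"
      have "cv (u t + shift (- l)) + shift l = cv (u t)" by (simp add: cv_simps cv_shift shift_simps)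
      then have "dist z (cv (u t + shift (- l)) + shift l) < \<rho>" using z r0 by (simp add: dist_commute)
      then show "z \<in> \<Omega>" unfolding \<Omega>_def using inb[OF t] l by (intro nbhdI)
    qed
    have "tf.trajectory (\<lambda>t. cv (u t))"
      unfolding tf.trajectory_def
    proof (intro ballI conjI ballu)
      fix t :: real assume t: "t \<in> {0..1}"
      have "cv (u t) \<in> nbhd per (R + 1) r" using ballu[OF t] r0(1) \<Omega>sub(2) centre_in_ball by blast
      then obtain u' where u': "(u has_vector_derivative u') (at t within {0..1})" "cv u' = ham_field (Hh t) (cv (u t))"
        using lifted_solution_ham_field[OF u(1) t lf real] by blast
      then show "((\<lambda>t. cv (u t)) has_vector_derivative ham_field (Hh t) (cv (u t))) (at t within {0..1})"
        using bounded_linear.has_vector_derivative[OF bounded_linear_cv u'(1)] by simp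
    qed
    then show ?thesis using u by blast
  qed
  have S: "\<exists>v. tf.trajectory v \<and> v 0 = s" if s: "s \<in> S" for s
  proof -
    obtain x l where xl: "s = cv x + shift l" "x \<in> phase_box (R0 + 1)" "l \<in> lattice per"
      using s unfolding S_def by blast
    obtain u where "tf.trajectory (\<lambda>t. cv (u t))" "u 0 = x + shift l" using traj[OF xl(2,3)] by blast
    then show ?thesis using xl(1) by (intro exI[of _ "\<lambda>t. cv (u t)"]) (simp add: cv_simps cv_shift)
  qed
  define V :: "'n cpt set" where "V = nbhd per R0 \<rho>0"
  have V: "\<exists>s\<in>S. exp \<Lambda> * dist s z < r0 / 4" if z: "z \<in> V" for z
  proof -
    obtain x l where xl: "x \<in> phase_box R0" "l \<in> lattice per" "dist z (cv x + shift l) < \<rho>0"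
      using z unfolding V_def nbhd_def by blast
    have "cv x + shift l \<in> S" unfolding S_def using xl(1,2) phase_box_mono[of R0 "R0 + 1"]
      by (intro CollectI exI[of _ x] exI[of _ l]) auto
    moreover have "exp \<Lambda> * dist (cv x + shift l) z < r0 / 4"
    proof -
      have "exp \<Lambda> * dist (cv x + shift l) z < exp \<Lambda> * \<rho>0" using xl(3) by (simp add: dist_commute)
      then show ?thesis using \<rho>0(3) by linarith
    qed
    ultimately show ?thesis by blast
  qed
  have conv1: "uniformly_Cauchy_on V Q"
    unfolding Q_def by (rule tf.scheme_converges(1)[where S = S and W = V, OF kmono P(2)]) (erule S, erule V)
  have conv2: "(\<lambda>j. Q j (v 0)) \<longlonglongrightarrow> v 1" if "tf.trajectory v" for v
    unfolding Q_def
    by (rule tf.scheme_converges(2)[where S = S and W = V, OF kmono P(2) _ _ that]) (erule S, erule V)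
  have "uniformly_convergent_on V Q" by (rule Cauchy_uniformly_convergent) (rule conv1)
  then obtain \<Phi> where \<Phi>: "uniform_limit V Q \<Phi> sequentially" by (auto simp: uniformly_convergent_on_def)
  have openV: "open V" unfolding V_def by (rule open_nbhd)
  have holQ: "cdiff (Q j) z" "Q j (z + shift l) = Q j z + shift l" if "l \<in> lattice per" for j z l
    using Q[of j] that unfolding shear_lift_def cholomorphic_on_cdiff by blast+
  have hol\<Phi>: "cholomorphic_on \<Phi> V"
    unfolding cholomorphic_on_cdiff
  proof
    fix z assume "z \<in> V"
    then obtain e where e: "e > 0" "ball z e \<subseteq> V" using openV by (meson open_contains_ball)
    have "cdiff (\<lambda>w. coord i (\<Phi> w)) z" for i
    proof (rule cdiff_uniform_limit[OF _ e(1)])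
      show "cholomorphic_on (\<lambda>w. coord i (Q n w)) (ball z e)" for n
        unfolding cholomorphic_on_cdiff by (intro ballI cdiff_coord holQ(1)[OF lattice_0])
      show "uniform_limit (ball z e) (\<lambda>n w. coord i (Q n w)) (\<lambda>w. coord i (\<Phi> w)) sequentially"
      proof (rule uniform_limitI)
        fix \<epsilon> :: real assume "\<epsilon> > 0"
        then have "\<forall>\<^sub>F n in sequentially. \<forall>w\<in>V. dist (Q n w) (\<Phi> w) < \<epsilon>" using \<Phi> by (auto simp: uniform_limit_iff)
        then show "\<forall>\<^sub>F n in sequentially. \<forall>w\<in>ball z e. dist (coord i (Q n w)) (coord i (\<Phi> w)) < \<epsilon>"
        proof eventually_elim
          case (elim n)
          show ?case
          proof
            fix w assume "w \<in> ball z e"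
            then have "dist (Q n w) (\<Phi> w) < \<epsilon>" using elim e(2) by blast
            then show "dist (coord i (Q n w)) (coord i (\<Phi> w)) < \<epsilon>"
              using norm_coord_le[of i "Q n w - \<Phi> w"] by (simp add: dist_norm)
          qed
        qed
      qed
    qed
    then have "cdiff (\<lambda>w. of_coords (\<lambda>i. coord i (\<Phi> w)) :: 'n cpt) z" by (rule cdiff_of_coords)
    moreover have "(\<lambda>w. of_coords (\<lambda>i. coord i (\<Phi> w)) :: 'n cpt) = \<Phi>" by (rule ext, rule coord_eqI) simp
    ultimately show "cdiff \<Phi> z" by simp
  qed
  have lim\<Phi>: "(\<lambda>j. Q j z) \<longlonglongrightarrow> \<Phi> z" if "z \<in> V" for z by (rule tendsto_uniform_limitI[OF \<Phi> that])
  have equi\<Phi>: "\<Phi> (z + shift l) = \<Phi> z + shift l" if z: "z \<in> V" and l: "l \<in> lattice per" for z l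
  proof (rule LIMSEQ_unique)
    have "z + shift l \<in> V" using z nbhd_shift[OF l] unfolding V_def by blast
    then show "(\<lambda>j. Q j (z + shift l)) \<longlonglongrightarrow> \<Phi> (z + shift l)" by (rule lim\<Phi>)
    show "(\<lambda>j. Q j (z + shift l)) \<longlonglongrightarrow> \<Phi> z + shift l"
      unfolding holQ(2)[OF l] by (intro tendsto_intros lim\<Phi> z)
  qed
  have real\<Phi>: "cproj B (\<Phi> (cv x)) = incl B (f (proj B x))" if x: "cv x \<in> V" for x
  proof -
    obtain y l where yl: "y \<in> phase_box R0" "l \<in> lattice per" "dist (cv x) (cv y + shift l) < \<rho>0"
      using x unfolding V_def nbhd_def by blast
    have "cv (x + shift (- l)) - cv y = cv x - (cv y + shift l)" by (simp add: cv_simps cv_shift shift_simps)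
    then have "dist (cv (x + shift (- l))) (cv y) < \<rho>0" using yl(3) by (simp only: dist_norm)
    then have "dist (x + shift (- l)) y \<le> 1" using \<rho>0(2) by simp
    then have inb: "x + shift (- l) \<in> phase_box (R0 + 1)" using phase_box_dist[OF yl(1)] by blast
    obtain u where u: "tf.trajectory (\<lambda>t. cv (u t))" "u 0 = (x + shift (- l)) + shift l"
      "f (proj B ((x + shift (- l)) + shift l)) = proj B (u 1)"
      using traj[OF inb yl(2)] by blast
    have xx: "(x + shift (- l)) + shift l = x" by (simp add: shift_simps)
    have "(\<lambda>j. Q j (cv (u 0))) \<longlonglongrightarrow> cv (u 1)" by (rule conv2[OF u(1)])
    then have "\<Phi> (cv x) = cv (u 1)" using LIMSEQ_unique[OF lim\<Phi>[OF x]] u(2) xx by simp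
    then show ?thesis using u(3) xx by (simp add: incl_proj)
  qed
  obtain F where F: "\<And>z. z \<in> V \<Longrightarrow> F (cproj B z) = cproj B (\<Phi> z)" and extF: "holomorphic_extension B (cproj B ` V) f F"
    using descend_holomorphic[of \<Phi> R0 \<rho>0 f] hol\<Phi> equi\<Phi> real\<Phi> unfolding V_def by metis
  have nb: "complex_nbhd B (cproj B ` V) K"
    unfolding complex_nbhd_def
  proof
    show "open (cproj B ` V)" by (rule open_cproj[OF openV])
    show "incl B ` K \<subseteq> cproj B ` V"
    proof (rule image_subsetI)
      fix y assume "y \<in> K"
      then obtain x where x: "y = proj B x" "x \<in> phase_box R0" using R0(2) by blast
      have "cv x \<in> V" unfolding V_def by (rule nbhdI[OF x(2) lattice_0]) (use \<rho>0 in \<open>simp add: shift_simps\<close>)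
      then show "incl B y \<in> cproj B ` V" by (simp add: x incl_proj)
    qed
  qed
  have "\<exists>g G. shear_composition B g \<and> holomorphic_extension B (cproj B ` V) g G \<and>
        (SUP z\<in>cproj B ` V. ereal (dist (F z) (G z))) < ereal \<delta>" if \<delta>: "\<delta> > 0" for \<delta>
  proof -
    have "\<forall>\<^sub>F j in sequentially. \<forall>z\<in>V. dist (Q j z) (\<Phi> z) < \<delta> / 2"
      using \<Phi> half_gt_zero[OF \<delta>] unfolding uniform_limit_iff by blast
    then obtain j where j: "\<And>z. z \<in> V \<Longrightarrow> dist (Q j z) (\<Phi> z) < \<delta> / 2" by (auto simp: eventually_sequentially)
    obtain G' g where G': "\<And>x. Q j (cv x) = cv (G' x)" "shear_composition B g" "\<And>x. g (proj B x) = proj B (G' x)"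
      using Q[of j] unfolding shear_lift_def by blast
    obtain G where G: "\<And>z. z \<in> V \<Longrightarrow> G (cproj B z) = cproj B (Q j z)" "holomorphic_extension B (cproj B ` V) g G"
    proof -
      have "\<exists>G. (\<forall>z\<in>nbhd per R0 \<rho>0. G (cproj B z) = cproj B (Q j z)) \<and> holomorphic_extension B (cproj B ` nbhd per R0 \<rho>0) g G"
      proof (rule descend_holomorphic)
        show "cholomorphic_on (Q j) (nbhd per R0 \<rho>0)" unfolding cholomorphic_on_cdiff using holQ(1)[OF lattice_0] by blast
        show "cproj B (Q j (cv x)) = incl B (g (proj B x))" for x by (simp add: G' incl_proj)
      qed (rule holQ(2))
      then show thesis using that unfolding V_def by blast
    qed
    \<comment> \<open>A supremum of strict bounds is only weakly bounded, so half of \<delta> is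
      used for the strict conclusion.\<close>
    have "(SUP z\<in>cproj B ` V. ereal (dist (F z) (G z))) \<le> ereal (\<delta> / 2)"
    proof (rule SUP_least)
      fix w assume "w \<in> cproj B ` V"
      then obtain z where z: "z \<in> V" "w = cproj B z" by blast
      have "dist (F w) (G w) \<le> dist (\<Phi> z) (Q j z)" using F[OF z(1)] G(1)[OF z(1)] dist_cproj by (simp add: z(2))
      also have "\<dots> \<le> \<delta> / 2" using j[OF z(1)] by (simp add: dist_commute)
      finally show "ereal (dist (F w) (G w)) \<le> ereal (\<delta> / 2)" by simp
    qed
    also have "\<dots> < ereal \<delta>" using \<delta> by simp
    finally show ?thesis using G' G by blast
  qed
  then show ?thesis using nb extF by blast
qed

end

section \<open>The Euclidean space and the torus as bases\<close>

lemma euclidean_covered_base: "covered_base (euclidean_base :: ('n::finite, _, _) base_space) False"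
proof
  fix K :: "(real ^ 'n) set" assume "compact K"
  then obtain R where R: "\<And>q. q \<in> K \<Longrightarrow> norm q \<le> R" by (meson bounded_iff compact_imp_bounded)
  have "\<bar>q $ i\<bar> \<le> R" if "q \<in> K" for q :: "real ^ 'n" and i using R[OF that] component_le_norm_cart[of q i] by linarith
  then show "\<exists>R. K \<subseteq> base_proj euclidean_base ` {q. \<forall>i. \<bar>q $ i\<bar> \<le> R}"
    by (intro exI[of _ R]) (auto simp: euclidean_base_def)
qed (auto simp: euclidean_base_def lattice_def)

lemma dist_torus_proj_le: "dist (torus_proj a) (torus_proj b) \<le> dist a b"
  unfolding dist_torus_def by (rule cInf_lower) (auto intro!: bdd_belowI[of _ 0])

text \<open>The infimum ranges over pairs of representatives; translating a pair by a common integer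
  vector preserves its distance and makes the first member equal to \<open>a\<close>.\<close>

lemma dist_torus_lift:
  assumes "dist (torus_proj a) y < e"
  shows "\<exists>b. torus_proj b = y \<and> dist a b < e"
proof -
  obtain b0 where "y = torus_proj b0" by (rule torus_proj_cases)
  then have "{dist a' b | a' b. torus_proj a' = torus_proj a \<and> torus_proj b = y} \<noteq> {}" by blast
  from cInf_lessD[OF this assms[unfolded dist_torus_def]]
  obtain a' b where ab: "torus_proj a' = torus_proj a" "torus_proj b = y" "dist a' b < e" by blast
  then obtain k where k: "a = a' + int_vec k" by (auto simp: torus_proj_eq_iff)
  have "torus_proj (b + int_vec k) = torus_proj b"
    using torus_proj_eq_iff[of b "b + int_vec k"] by auto
  moreover have "dist a (b + int_vec k) = dist a' b" by (simp add: k dist_norm)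
  ultimately show ?thesis using ab by auto
qed

text \<open>Openness of the projection follows by lifting small distances. Removing integer parts
  coordinatewise shows that the bound 1 in \<open>compact_base\<close> works for every compact
  set.\<close>

lemma torus_covered_base: "covered_base (torus_base :: ('n::finite, _, _) base_space) True"
proof
  show "surj (base_proj (torus_base :: ('n, _, _) base_space))"
    unfolding torus_base_def by (simp, metis surjI torus_proj_cases surj_def)
  fix U :: "(complex ^ 'n) set" assume U: "open U"
  have "open (torus_proj ` U)"
    unfolding open_dist
  proof
    fix x assume "x \<in> torus_proj ` U"
    then obtain a where a: "a \<in> U" "x = torus_proj a" by blast
    then obtain e where e: "e > 0" "\<And>b. dist b a < e \<Longrightarrow> b \<in> U" using U unfolding open_dist by blast
    have "y \<in> torus_proj ` U" if "dist y x < e" for y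
    proof -
      have "dist (torus_proj a) y < e" using that a by (simp add: dist_commute)
      then obtain b where "torus_proj b = y" "dist a b < e" using dist_torus_lift by blast
      then show ?thesis using e(2)[of b] by (auto simp: dist_commute)
    qed
    then show "\<exists>e>0. \<forall>y. dist y x < e \<longrightarrow> y \<in> torus_proj ` U" using e(1) by blast
  qed
  then show "open (base_cproj torus_base ` U)" by (simp add: torus_base_def)
next
  fix K :: "(real, 'n) torus set"
  have "x \<in> torus_proj ` {q :: real ^ 'n. \<forall>i. \<bar>q $ i\<bar> \<le> 1}" for x
  proof -
    obtain a where a: "x = torus_proj a" by (rule torus_proj_cases)
    let ?k = "\<chi> i. - \<lfloor>a $ i\<rfloor>"
    have "torus_proj (a + int_vec ?k) = x" using torus_proj_eq_iff[of a "a + int_vec ?k"] a by auto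
    moreover have "\<bar>(a + int_vec ?k) $ i\<bar> \<le> 1" for i
    proof -
      have "(a + int_vec ?k) $ i = frac (a $ i)" by (simp add: int_vec_def frac_def)
      then show ?thesis using frac_ge_0[of "a $ i"] frac_lt_1[of "a $ i"] by simp
    qed
    ultimately show ?thesis by (intro image_eqI[of _ _ "a + int_vec ?k"]) auto
  qed
  then show "\<exists>R. K \<subseteq> base_proj torus_base ` {q. \<forall>i. \<bar>q $ i\<bar> \<le> R}"
    by (intro exI[of _ 1]) (auto simp: torus_base_def)
qed (auto simp: torus_base_def lattice_def torus_proj_eq_iff torus_incl.abs_eq dist_torus_proj_le)

theorem corollary1p2:
  fixes f :: "(real, 'n::finite) torus \<times> (real ^ 'n) \<Rightarrow> (real, 'n) torus \<times> (real ^ 'n)"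
    and h :: "(real ^ 'n) \<times> (real ^ 'n) \<Rightarrow> (real ^ 'n) \<times> (real ^ 'n)"
  shows "(hamiltonian_map torus_base f \<longrightarrow>
           (\<forall>K. compact K \<longrightarrow>
             (\<exists>W F. complex_nbhd torus_base W K \<and> holomorphic_extension torus_base W f F \<and>
               (\<forall>\<delta>>0. \<exists>g G. shear_composition torus_base g \<and>
                  holomorphic_extension torus_base W g G \<and>
                  (SUP z\<in>W. ereal (dist (F z) (G z))) < ereal \<delta>)))) \<and>
         (hamiltonian_map euclidean_base h \<longrightarrow>
           (\<forall>K. compact K \<longrightarrow>
             (\<exists>W F. complex_nbhd euclidean_base W K \<and> holomorphic_extension euclidean_base W h F \<and>
               (\<forall>\<delta>>0. \<exists>g G. shear_composition euclidean_base g \<and>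
                  holomorphic_extension euclidean_base W g G \<and>
                  (SUP z\<in>W. ereal (dist (F z) (G z))) < ereal \<delta>))))"
  using covered_base.hamiltonian_map_approximation[OF torus_covered_base]
    covered_base.hamiltonian_map_approximation[OF euclidean_covered_base] by blast

end
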